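(* Let $S$ be either $O_8^+(2)$ or $O_8^+(3)$, and let $\rho$ be a triality automorphism of $S$ (of order $3$). Then: (i) for every $g\in S$, the subgroup $\langle\rho,\rho^g\rangle$ of $\langle S,\rho\rangle$ is a $\{2,3\}$-group, i.e. its order has no prime divisors other than $2$ and $3$; moreover, $\alpha(\rho)=3$; (ii) if $\varrho\in S\rho$ is an element of order $3$ that is not conjugate to $\rho$, then $\alpha(\varrho)=2$.
   Context: Identify $S$ with $\operatorname{Inn}S\leqslant\operatorname{Aut}S$, and write $O_8^+(q)=\mathrm{P}\Omega_8^+(q)\cong D_4(q)$ (the Chevalley group of type $D_4$ over $\mathbb{F}_q$). The Dynkin diagram of type $D_4$ has a symmetry of order $3$, which lifts canonically to an automorphism $\rho_0$ of order $3$ of $D_4(q)\cong S$; a triality automorphism of $S$ is any automorphism conjugate to $\rho_0$ in $\operatorname{Aut}S$. $S\rho$ denotes the coset of $S$ in $\operatorname{Aut}S$ containing $\rho$; "conjugate" in (ii) means conjugate under $S$ (equivalently under $\langle S,\rho\rangle$). For a nonabelian simple group $S$ and a nonidentity $x\in\operatorname{Aut}S$, $\alpha(x)$ denotes the minimum number of conjugates of $x$ in $\langle S,x\rangle$ that generate a subgroup containing $S$. Here $\rho^g=g^{-1}\rho g$. *)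

theory Defs
  imports "HOL-Algebra.Algebra"
begin

text \<open>Matrices over F_p (p prime) of size 8x8 are represented as functions
  nat \<Rightarrow> nat \<Rightarrow> int, with entries in {0..<p} for indices < 8 and 0 elsewhere.
  Basis of the natural module: index k-1 is e_k, index 4+k-1 is f_k (k = 1..4),
  quadratic form Q = x_{e1} x_{f1} + ... + x_{e4} x_{f4}.\<close>

definition mat_carrier :: "nat \<Rightarrow> (nat \<Rightarrow> nat \<Rightarrow> int) set" where
  "mat_carrier p = {A. \<forall>i j. (i < 8 \<and> j < 8 \<longrightarrow> A i j \<in> {0..<int p})
                          \<and> (\<not> (i < 8 \<and> j < 8) \<longrightarrow> A i j = 0)}"

definition mat_mult :: "nat \<Rightarrow> (nat \<Rightarrow> nat \<Rightarrow> int) \<Rightarrow> (nat \<Rightarrow> nat \<Rightarrow> int) \<Rightarrow> (nat \<Rightarrow> nat \<Rightarrow> int)" where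
  "mat_mult p A B = (\<lambda>i j. if i < 8 \<and> j < 8 then (\<Sum>k<8. A i k * B k j) mod int p else 0)"

definition mat_one :: "nat \<Rightarrow> nat \<Rightarrow> int" where
  "mat_one = (\<lambda>i j. if i < 8 \<and> j < 8 \<and> i = j then 1 else 0)"

definition Mat_monoid :: "nat \<Rightarrow> (nat \<Rightarrow> nat \<Rightarrow> int) monoid" where
  "Mat_monoid p = \<lparr>carrier = mat_carrier p, monoid.mult = mat_mult p, one = mat_one\<rparr>"

definition GL8 :: "nat \<Rightarrow> (nat \<Rightarrow> nat \<Rightarrow> int) monoid" where
  "GL8 p = units_of (Mat_monoid p)"

definition Emat :: "nat \<Rightarrow> nat \<Rightarrow> nat \<Rightarrow> nat \<Rightarrow> int" where
  "Emat a b = (\<lambda>i j. if i = a \<and> j = b then 1 else 0)"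

text \<open>Chevalley generators e_{\<alpha>_k} (Xpos k) and f_{\<alpha>_k} (Xneg k) of so(8) for the simple
  roots \<alpha>_1 = \<epsilon>_1-\<epsilon>_2, \<alpha>_2 = \<epsilon>_2-\<epsilon>_3 (central node), \<alpha>_3 = \<epsilon>_3-\<epsilon>_4, \<alpha>_4 = \<epsilon>_3+\<epsilon>_4,
  normalised so that [Xpos k, Xneg k] is the coroot h_{\<alpha>_k}.\<close>

definition Xpos :: "nat \<Rightarrow> nat \<Rightarrow> nat \<Rightarrow> int" where
  "Xpos k = (if k = 1 then (\<lambda>i j. Emat 0 1 i j - Emat 5 4 i j)
        else if k = 2 then (\<lambda>i j. Emat 1 2 i j - Emat 6 5 i j)
        else if k = 3 then (\<lambda>i j. Emat 2 3 i j - Emat 7 6 i j)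
        else (\<lambda>i j. Emat 2 7 i j - Emat 3 6 i j))"

definition Xneg :: "nat \<Rightarrow> nat \<Rightarrow> nat \<Rightarrow> int" where
  "Xneg k = (if k = 1 then (\<lambda>i j. Emat 1 0 i j - Emat 4 5 i j)
        else if k = 2 then (\<lambda>i j. Emat 2 1 i j - Emat 5 6 i j)
        else if k = 3 then (\<lambda>i j. Emat 3 2 i j - Emat 6 7 i j)
        else (\<lambda>i j. Emat 7 2 i j - Emat 6 3 i j))"

text \<open>Root element x(t) = exp(t X) = I + t X (X nilpotent of square 0), reduced mod p.\<close>
definition root_elt :: "nat \<Rightarrow> (nat \<Rightarrow> nat \<Rightarrow> int) \<Rightarrow> int \<Rightarrow> (nat \<Rightarrow> nat \<Rightarrow> int)" where
  "root_elt p M t = (\<lambda>i j. if i < 8 \<and> j < 8 then (mat_one i j + t * M i j) mod int p else 0)"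

definition simple_root_gens :: "nat \<Rightarrow> (nat \<Rightarrow> nat \<Rightarrow> int) set" where
  "simple_root_gens p =
     {root_elt p (Xpos k) t | k t. k \<in> {1..4} \<and> t \<in> {0..<int p}}
   \<union> {root_elt p (Xneg k) t | k t. k \<in> {1..4} \<and> t \<in> {0..<int p}}"

definition Omega8 :: "nat \<Rightarrow> (nat \<Rightarrow> nat \<Rightarrow> int) monoid" where
  "Omega8 p = (GL8 p)\<lparr>carrier := generate (GL8 p) (simple_root_gens p)\<rparr>"

definition group_center :: "('a, 'b) monoid_scheme \<Rightarrow> 'a set" where
  "group_center G = {z \<in> carrier G. \<forall>x \<in> carrier G. z \<otimes>\<^bsub>G\<^esub> x = x \<otimes>\<^bsub>G\<^esub> z}"

definition POmega8 :: "nat \<Rightarrow> (nat \<Rightarrow> nat \<Rightarrow> int) set monoid" where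
  "POmega8 p = Omega8 p Mod group_center (Omega8 p)"

definition xbar :: "nat \<Rightarrow> (nat \<Rightarrow> nat \<Rightarrow> int) \<Rightarrow> int \<Rightarrow> (nat \<Rightarrow> nat \<Rightarrow> int) set" where
  "xbar p M t = group_center (Omega8 p) #>\<^bsub>Omega8 p\<^esub> root_elt p M t"

text \<open>The order-3 symmetry of the D_4 Dynkin diagram: \<alpha>_1 \<mapsto> \<alpha>_3 \<mapsto> \<alpha>_4 \<mapsto> \<alpha>_1, \<alpha>_2 fixed.\<close>
definition tri_perm :: "nat \<Rightarrow> nat" where
  "tri_perm k = (if k = 1 then 3 else if k = 3 then 4 else if k = 4 then 1 else k)"

text \<open>The canonical lift \<rho>_0 of the diagram symmetry: the automorphism of S with
  x_{\<pm>\<alpha>_k}(t) \<mapsto> x_{\<pm>\<alpha>_{\<sigma>(k)}}(t). (It is unique, as these elements generate S.)\<close>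
definition is_graph_triality :: "nat \<Rightarrow> ((nat \<Rightarrow> nat \<Rightarrow> int) set \<Rightarrow> (nat \<Rightarrow> nat \<Rightarrow> int) set) \<Rightarrow> bool" where
  "is_graph_triality p \<phi> \<longleftrightarrow> \<phi> \<in> auto (POmega8 p) \<and>
     (\<forall>k \<in> {1..4}. \<forall>t \<in> {0..<int p}.
        \<phi> (xbar p (Xpos k) t) = xbar p (Xpos (tri_perm k)) t \<and>
        \<phi> (xbar p (Xneg k) t) = xbar p (Xneg (tri_perm k)) t)"

text \<open>Inner automorphism induced by g (used to identify S with Inn S \<le> Aut S).\<close>
definition inn :: "('a, 'b) monoid_scheme \<Rightarrow> 'a \<Rightarrow> ('a \<Rightarrow> 'a)" where
  "inn G g = (\<lambda>x \<in> carrier G. g \<otimes>\<^bsub>G\<^esub> x \<otimes>\<^bsub>G\<^esub> inv\<^bsub>G\<^esub> g)"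

definition Inn :: "('a, 'b) monoid_scheme \<Rightarrow> ('a \<Rightarrow> 'a) set" where
  "Inn G = inn G ` carrier G"

definition conjg :: "('a, 'b) monoid_scheme \<Rightarrow> 'a \<Rightarrow> 'a \<Rightarrow> 'a" where
  "conjg H x h = inv\<^bsub>H\<^esub> h \<otimes>\<^bsub>H\<^esub> x \<otimes>\<^bsub>H\<^esub> h"

definition alpha_inv :: "('a, 'b) monoid_scheme \<Rightarrow> ('a \<Rightarrow> 'a) \<Rightarrow> nat" where
  "alpha_inv S x =
     (let A = AutoGroup S; SX = generate A (Inn S \<union> {x}) in
      LEAST k. \<exists>ys. length ys = k \<and> (\<forall>y \<in> set ys. \<exists>h \<in> SX. y = conjg A x h)
                  \<and> Inn S \<subseteq> generate A (set ys))"

definition is_pi_group_set :: "nat set \<Rightarrow> 'a set \<Rightarrow> bool" where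
  "is_pi_group_set \<pi> H \<longleftrightarrow> finite H \<and> (\<forall>r::nat. Factorial_Ring.prime r \<and> r dvd card H \<longrightarrow> r \<in> \<pi>)"

end

theory Submission
  imports Defs
begin

text \<open>The 8-dimensional module carries a product with x (y x) proportional to the norm of x for which
  the graph automorphism permutes the three natural actions of a word in the root elements: prd of the
  images of x and y under a word and its shift is the image of prd x y under the twice shifted word.

  For (i), a triality automorphism fixes the vector unit_vec, and a conjugate of it corresponds to
  the pair of images of unit_vec under the first two actions. Up to elements commuting with r, every such
  pair is the image of the standard one under a parabolic word, so r and its conjugate lie in a conjugate
  of the r-stable parabolic subgroup of the central node, whose elements have order dividing a number of the
  form 2^a 3^b. An element of order 5 shows that two conjugates do not generate, and an explicit triple
  of conjugates does.

  For (ii), an element of order 3 in the coset stabilizes a vector line in each of the three actions, by a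
  counting argument of Chevalley--Warning type, so it can be conjugated into the stabilizer of a flag and
  then, by Sylow-type counting, into a complement. There it is normalised to a single class other than that of r,
  for which an explicit generating pair exists.

  Explicit words are verified by evaluating their action on a basis.\<close>

text \<open>The groups are too large to enumerate, so every finite check runs over the 2^8 or 3^8
  vectors of the module. Words stand for group elements because the graph automorphism is then a
  relabelling of letters, and shifting a word once or twice realises the two half-spin modules on
  the same space. The bound q <= 3 enters through the parabolic subgroup: its Levi factor is built
  from three commuting copies of SL2(q), which triality permutes, and SL2(2) and SL2(3) are
  {2,3}-groups. In (ii) the flag exists because a quadratic and a cubic form have total degree 5,
  less than the 8 variables. Its stabilizer is U SL2(q) with U unipotent, and the two fields need
  opposite complements: for q = 2 the 2-group U is the factor removed, leaving SL2(2) and r; for q =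
  3 the quaternion subgroup of SL2(3) is removed, leaving the 3-group U and r. The removed factor
  has order prime to 3, so an element of order 3 fixes one of its cosets.\<close>

datatype f2 = Z2 | I2
datatype f3 = Z3 | I3 | J3

instantiation f2 :: field begin
definition "0 = Z2"
definition "1 = I2"
fun plus_f2 where "Z2 + y = (y::f2)" | "x + Z2 = x" | "I2 + I2 = Z2"
fun times_f2 where "Z2 * y = (Z2::f2)" | "x * Z2 = Z2" | "I2 * I2 = I2"
definition "- x = (x::f2)"
definition "x - y = x + (y::f2)"
definition "inverse x = (x::f2)"
definition "x div y = x * (y::f2)"
instance
proof
  fix a b c :: f2
  show "a + b + c = a + (b + c)" by (cases a; cases b; cases c) auto
  show "a + b = b + a" by (cases a; cases b) auto
  show "0 + a = a" by (simp add: zero_f2_def)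
  show "- a + a = 0" by (cases a) (auto simp: uminus_f2_def zero_f2_def)
  show "a - b = a + - b" by (simp add: uminus_f2_def minus_f2_def)
  show "a * b * c = a * (b * c)" by (cases a; cases b; cases c) auto
  show "a * b = b * a" by (cases a; cases b) auto
  show "1 * a = a" by (cases a) (auto simp: one_f2_def)
  show "(a + b) * c = a * c + b * c" by (cases a; cases b; cases c) auto
  show "(0::f2) \<noteq> 1" by (simp add: zero_f2_def one_f2_def)
  show "a \<noteq> 0 \<Longrightarrow> inverse a * a = 1" by (cases a) (auto simp: zero_f2_def one_f2_def inverse_f2_def)
  show "a div b = a * inverse b" by (simp add: divide_f2_def inverse_f2_def)
  show "inverse (0::f2) = 0" by (simp add: inverse_f2_def)
qed
end

instantiation f3 :: field begin
definition "0 = Z3"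
definition "1 = I3"
fun plus_f3 where "Z3 + y = (y::f3)" | "I3 + Z3 = I3" | "I3 + I3 = J3" | "I3 + J3 = Z3"
  | "J3 + Z3 = J3" | "J3 + I3 = Z3" | "J3 + J3 = I3"
fun uminus_f3 where "- Z3 = Z3" | "- I3 = J3" | "- J3 = I3"
fun times_f3 where "Z3 * y = (Z3::f3)" | "I3 * y = y" | "J3 * y = - y"
definition "x - y = x + - (y::f3)"
definition "inverse x = (x::f3)"
definition "x div y = x * (y::f3)"
instance
proof
  fix a b c :: f3
  show "a + b + c = a + (b + c)" by (cases a; cases b; cases c) auto
  show "a + b = b + a" by (cases a; cases b) auto
  show "0 + a = a" by (simp add: zero_f3_def)
  show "- a + a = 0" by (cases a) (auto simp: zero_f3_def)
  show "a - b = a + - b" by (simp add: minus_f3_def)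
  show "a * b * c = a * (b * c)" by (cases a; cases b; cases c) auto
  show "a * b = b * a" by (cases a; cases b) auto
  show "1 * a = a" by (cases a) (auto simp: one_f3_def)
  show "(a + b) * c = a * c + b * c" by (cases a; cases b; cases c) auto
  show "(0::f3) \<noteq> 1" by (simp add: zero_f3_def one_f3_def)
  show "a \<noteq> 0 \<Longrightarrow> inverse a * a = 1" by (cases a) (auto simp: zero_f3_def one_f3_def inverse_f3_def)
  show "a div b = a * inverse b" by (simp add: divide_f3_def inverse_f3_def)
  show "inverse (0::f3) = 0" by (simp add: inverse_f3_def)
qed
end

lemma UNIV_f2: "UNIV = {Z2, I2}" by (auto intro: f2.exhaust)
lemma UNIV_f3: "UNIV = {Z3, I3, J3}" by (auto intro: f3.exhaust)

instance f2 :: finite by standard (simp add: UNIV_f2)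
instance f3 :: finite by standard (simp add: UNIV_f3)

section \<open>Words in simple root elements, their action on vectors, and the triality
  product\<close>

datatype node = A1 | A2 | A3 | A4
datatype 'a letter = Pos node 'a | Neg node 'a
datatype 'a vec = Vec 'a 'a 'a 'a 'a 'a 'a 'a

fun tri :: "node \<Rightarrow> node" where
  "tri A1 = A3" | "tri A2 = A2" | "tri A3 = A4" | "tri A4 = A1"

fun shl :: "'a letter \<Rightarrow> 'a letter" where
  "shl (Pos k t) = Pos (tri k) t" | "shl (Neg k t) = Neg (tri k) t"

text \<open>The root elements I + t X in the coordinates e_1, ..., e_4, f_1, ..., f_4. That this
  table agrees with the matrices \<open>Xpos\<close>, \<open>Xneg\<close> is the content of
  \<open>coord_step_basis\<close>.\<close>

fun step :: "'a::comm_ring_1 letter \<Rightarrow> 'a vec \<Rightarrow> 'a vec" where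
  "step (Pos A1 t) (Vec a b c d e f g h) = Vec (a + t * b) b c d e (f - t * e) g h"
| "step (Pos A2 t) (Vec a b c d e f g h) = Vec a (b + t * c) c d e f (g - t * f) h"
| "step (Pos A3 t) (Vec a b c d e f g h) = Vec a b (c + t * d) d e f g (h - t * g)"
| "step (Pos A4 t) (Vec a b c d e f g h) = Vec a b (c + t * h) (d - t * g) e f g h"
| "step (Neg A1 t) (Vec a b c d e f g h) = Vec a (b + t * a) c d (e - t * f) f g h"
| "step (Neg A2 t) (Vec a b c d e f g h) = Vec a b (c + t * b) d e (f - t * g) g h"
| "step (Neg A3 t) (Vec a b c d e f g h) = Vec a b c (d + t * c) e f (g - t * h) h"
| "step (Neg A4 t) (Vec a b c d e f g h) = Vec a b c d e f (g - t * d) (h + t * c)"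

fun run :: "'a::comm_ring_1 letter list \<Rightarrow> 'a vec \<Rightarrow> 'a vec" where
  "run [] v = v" | "run (l # w) v = step l (run w v)"

definition nrm :: "'a::comm_ring_1 vec \<Rightarrow> 'a" where
  "nrm v = (case v of Vec a b c d e f g h \<Rightarrow> a * e + b * f + c * g + d * h)"

instantiation vec :: (ab_group_add) ab_group_add begin
definition "0 = Vec 0 0 0 0 0 0 0 0"
fun plus_vec where "Vec a b c d e f g h + Vec a' b' c' d' e' f' g' h' =
  Vec (a + a') (b + b') (c + c') (d + d') (e + e') (f + f') (g + g') (h + h')"
fun uminus_vec where "- Vec a b c d e f g h = Vec (- a) (- b) (- c) (- d) (- e) (- f) (- g) (- h)"
definition "x - y = x + - (y :: 'a vec)"
instance
proof
  fix x y z :: "'a vec"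
  show "x + y + z = x + (y + z)" by (cases x; cases y; cases z) (simp add: add.assoc)
  show "x + y = y + x" by (cases x; cases y) (simp add: add.commute)
  show "0 + x = x" by (cases x) (simp add: zero_vec_def)
  show "- x + x = 0" by (cases x) (simp add: zero_vec_def)
  show "x - y = x + - y" by (simp add: minus_vec_def)
qed
end

fun scale :: "'a::times \<Rightarrow> 'a vec \<Rightarrow> 'a vec" where
  "scale t (Vec a b c d e f g h) = Vec (t * a) (t * b) (t * c) (t * d) (t * e) (t * f) (t * g) (t * h)"

fun bil :: "'a::comm_ring_1 vec \<Rightarrow> 'a vec \<Rightarrow> 'a" where
  "bil (Vec a b c d e f g h) (Vec a' b' c' d' e' f' g' h') =
     a * e' + b * f' + c * g' + d * h' + e * a' + f * b' + g * c' + h * d'"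

text \<open>The split para-octonion product. With the norm \<open>- nrm\<close> it is a symmetric
  composition: multiplicative by \<open>nrm_prd\<close>, with associative polar form by
  \<open>bil_prd_cyclic\<close>, and with (x y) x equal to the norm of x times y by
  \<open>prd_prd_same\<close>.\<close>

fun prd :: "'a::comm_ring_1 vec \<Rightarrow> 'a vec \<Rightarrow> 'a vec" where
  "prd (Vec a b c d e f g h) (Vec a' b' c' d' e' f' g' h') = Vec
     (b * c' - c * b' + h * a' - a * d')
     (a * g' + b * h' - d * b' - g * a')
     (c * h' + f * a' - a * f' - d * c')
     (a * e' + f * b' + g * c' + h * h')
     (e * h' + g * f' - d * e' - f * g')
     (c * e' + h * f' - e * c' - f * d')
     (e * b' + h * g' - b * e' - g * d')
     (- b * f' - c * g' - d * d' - e * a')"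

lemma nrm_Vec [simp]: "nrm (Vec a b c d e f g h) = a * e + b * f + c * g + d * h"
  by (simp add: nrm_def)

lemma bil_prd_cyclic: "bil (prd x y) z = bil (prd y z) x"
  by (cases x; cases y; cases z) (simp add: algebra_simps)

lemma bil_commute: "bil x y = bil y x"
  by (cases x; cases y) (simp add: algebra_simps)

lemma prd_prd_linear: "prd (prd x y) z + prd (prd z y) x = - scale (bil x z) y"
  by (cases x; cases y; cases z) (simp add: algebra_simps)

lemma prd_prd_same: "prd (prd x y) x = - scale (nrm x) y"
  by (cases x; cases y) (simp add: algebra_simps)

lemma nrm_prd: "nrm (prd x y) = - (nrm x * nrm y)"
  by (cases x; cases y) (simp add: algebra_simps)

lemma prd_step: "prd (step l x) (step (shl l) y) = step (shl (shl l)) (prd x y)"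
proof (cases l)
  case (Pos k t) then show ?thesis
    by (cases k; cases x; cases y) (simp_all add: algebra_simps)
next
  case (Neg k t) then show ?thesis
    by (cases k; cases x; cases y) (simp_all add: algebra_simps)
qed

text \<open>A common class for the fields with two and three elements, which lets most arguments
  treat both characteristics at once.\<close>

class small_field = field + finite +
  assumes small: "x = 0 \<or> x = 1 \<or> x = - 1"

instance f2 :: small_field
proof
  fix x :: f2 show "x = 0 \<or> x = 1 \<or> x = - 1" by (cases x) (auto simp: zero_f2_def one_f2_def)
qed

instance f3 :: small_field
proof
  fix x :: f3 show "x = 0 \<or> x = 1 \<or> x = - 1" by (cases x) (auto simp: zero_f3_def one_f3_def)
qed

definition shift :: "'a letter list \<Rightarrow> 'a letter list" where "shift = map shl"

fun linv :: "'a::uminus letter \<Rightarrow> 'a letter" where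
  "linv (Pos k t) = Pos k (- t)" | "linv (Neg k t) = Neg k (- t)"

definition winv :: "'a::uminus letter list \<Rightarrow> 'a letter list" where
  "winv w = rev (map linv w)"

fun wpow :: "'a letter list \<Rightarrow> nat \<Rightarrow> 'a letter list" where
  "wpow w 0 = []" | "wpow w (Suc n) = w @ wpow w n"

fun lnode :: "'a letter \<Rightarrow> node" where
  "lnode (Pos k t) = k" | "lnode (Neg k t) = k"

lemma shift_simps [simp]: "shift [] = []" "shift (l # w) = shl l # shift w"
  "shift (u @ w) = shift u @ shift w"
  by (simp_all add: shift_def)

lemma tri_tri_tri [simp]: "tri (tri (tri k)) = k" by (cases k) auto
lemma shl_shl_shl [simp]: "shl (shl (shl l)) = l" by (cases l) auto
lemma shift_shift_shift [simp]: "shift (shift (shift w)) = w" by (induction w) auto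

lemma winv_simps [simp]: "winv [] = []" "winv (u @ w) = winv w @ winv u"
  "winv (l # w) = winv w @ [linv l]"
  by (simp_all add: winv_def)

lemma linv_linv [simp]: "linv (linv l) = (l :: 'a::group_add letter)" by (cases l) auto
lemma winv_winv [simp]: "winv (winv w) = (w :: 'a::group_add letter list)" by (induction w) auto
lemma shl_linv: "shl (linv l) = linv (shl l)" by (cases l) auto
lemma shift_winv: "shift (winv w) = winv (shift w)" by (induction w) (auto simp: shl_linv)
lemma shift_wpow: "shift (wpow w n) = wpow (shift w) n" by (induction n) auto

lemma vec_simps [simp]:
  "Vec a b c d e f g h - Vec a' b' c' d' e' f' g' h' =
     Vec (a - a') (b - b') (c - c') (d - d') (e - e') (f - f') (g - g') (h - (h'::'a::ab_group_add))"
  "(0 = Vec a b c d e f g h) \<longleftrightarrow> a = 0 \<and> b = 0 \<and> c = 0 \<and> d = 0 \<and> e = 0 \<and> f = 0 \<and> g = 0 \<and> h = 0"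
  "(Vec a b c d e f g h = 0) \<longleftrightarrow> a = 0 \<and> b = 0 \<and> c = 0 \<and> d = 0 \<and> e = 0 \<and> f = 0 \<and> g = 0 \<and> h = 0"
  by (auto simp: minus_vec_def zero_vec_def)

lemma step_add: "step l (x + y) = step l x + step l y"
proof (cases l)
  case (Pos k t) then show ?thesis by (cases k; cases x; cases y) (simp_all add: algebra_simps)
next
  case (Neg k t) then show ?thesis by (cases k; cases x; cases y) (simp_all add: algebra_simps)
qed

lemma step_scale: "step l (scale s x) = scale s (step l x)"
proof (cases l)
  case (Pos k t) then show ?thesis by (cases k; cases x) (simp_all add: algebra_simps)
next
  case (Neg k t) then show ?thesis by (cases k; cases x) (simp_all add: algebra_simps)
qed

lemma step_linv [simp]: "step (linv l) (step l x) = x"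
proof (cases l)
  case (Pos k t) then show ?thesis by (cases k; cases x) (simp_all add: algebra_simps)
next
  case (Neg k t) then show ?thesis by (cases k; cases x) (simp_all add: algebra_simps)
qed

lemma step_linv' [simp]: "step l (step (linv l) x) = x"
  using step_linv[of "linv l" x] by simp

lemma bil_step: "bil (step l x) (step l y) = bil x y"
proof (cases l)
  case (Pos k t) then show ?thesis by (cases k; cases x; cases y) (simp_all add: algebra_simps)
next
  case (Neg k t) then show ?thesis by (cases k; cases x; cases y) (simp_all add: algebra_simps)
qed

lemma nrm_step: "nrm (step l x) = nrm x"
proof (cases l)
  case (Pos k t) then show ?thesis by (cases k; cases x) (simp_all add: algebra_simps)
next
  case (Neg k t) then show ?thesis by (cases k; cases x) (simp_all add: algebra_simps)
qed

lemma scale_simps [simp]: "scale 1 x = (x :: 'a::comm_ring_1 vec)" "scale (- 1) x = - (x :: 'a::comm_ring_1 vec)"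
  "scale 0 x = (0 :: 'a::comm_ring_1 vec)" "scale s (0 :: 'a::comm_ring_1 vec) = 0"
  "scale (- s) x = - scale s (x :: 'a::comm_ring_1 vec)"  "scale s (- x) = - scale s (x :: 'a::comm_ring_1 vec)"
  by (cases x; simp add: zero_vec_def)+

lemma scale_scale [simp]: "scale s (scale t x) = scale (s * t) (x :: 'a::comm_ring_1 vec)"
  by (cases x) (simp add: mult.assoc)

lemma scale_add: "scale s (x + y) = scale s x + scale s (y :: 'a::comm_ring_1 vec)"
  by (cases x; cases y) (simp add: algebra_simps)

lemma scale_add_left: "scale (s + t) x = scale s x + scale t (x :: 'a::comm_ring_1 vec)"
  by (cases x) (simp add: algebra_simps)

lemma run_append [simp]: "run (u @ w) x = run u (run w x)" by (induction u) auto
lemma run_add: "run w (x + y) = run w x + run w y" by (induction w) (auto simp: step_add)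
lemma run_scale: "run w (scale s x) = scale s (run w x)" by (induction w) (auto simp: step_scale)
lemma run_uminus: "run w (- x) = - run w x" using run_scale[of w "-1" x] by simp
lemma run_zero [simp]: "run w 0 = 0" using run_scale[of w 0 0] by simp
lemma run_diff: "run w (x - y) = run w x - run w y" by (simp add: run_add run_uminus diff_conv_add_uminus del: add_uminus_conv_diff)
lemma run_winv [simp]: "run (winv w) (run w x) = x" by (induction w) auto
lemma run_winv' [simp]: "run w (run (winv w) x) = x" using run_winv[of "winv w" x] by simp
lemma bil_run: "bil (run w x) (run w y) = bil x y" by (induction w) (auto simp: bil_step)
lemma nrm_run: "nrm (run w x) = nrm x" by (induction w) (auto simp: nrm_step)
lemma prd_run: "prd (run w x) (run (shift w) y) = run (shift (shift w)) (prd x y)"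
  by (induction w) (auto simp: prd_step)
lemma run_inj: "run w x = run w y \<longleftrightarrow> x = y" by (metis run_winv)
lemma run_eq_zero_iff [simp]: "run w x = 0 \<longleftrightarrow> x = 0" by (metis run_winv run_zero)
lemma run_wpow: "run (wpow w n) x = (run w ^^ n) x" by (induction n) auto

lemma prd_scale: "prd (scale s x) y = scale s (prd x y)" "prd x (scale s y) = scale s (prd x y)"
  by (cases x; cases y; simp add: algebra_simps)+
lemma prd_uminus [simp]: "prd (- x) y = - prd x y" "prd x (- y) = - prd x y"
  using prd_scale(1)[of "-1" x y] prd_scale(2)[of x "-1" y] by simp_all
lemma prd_zero [simp]: "prd 0 y = 0" "prd x 0 = 0"
  using prd_scale(1)[of 0 0 y] prd_scale(2)[of x 0 0] by simp_all
lemma bil_uminus [simp]: "bil (- x) y = - bil x y" "bil x (- y) = - bil x y"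
  by (cases x; cases y; simp add: algebra_simps)+
lemma bil_zero [simp]: "bil 0 y = 0" "bil x 0 = 0"
  by (cases y; simp add: zero_vec_def) (cases x; simp add: zero_vec_def)

definition basis :: "'a::zero_neq_one vec list" where
  "basis = [Vec 1 0 0 0 0 0 0 0, Vec 0 1 0 0 0 0 0 0, Vec 0 0 1 0 0 0 0 0, Vec 0 0 0 1 0 0 0 0,
    Vec 0 0 0 0 1 0 0 0, Vec 0 0 0 0 0 1 0 0, Vec 0 0 0 0 0 0 1 0, Vec 0 0 0 0 0 0 0 1]"

text \<open>Equality of two actions in a form that can be evaluated; \<open>agree_iff\<close>
  recovers the quantified form by linearity.\<close>

definition agree :: "'a::comm_ring_1 letter list \<Rightarrow> 'a letter list \<Rightarrow> bool" where
  "agree u w \<longleftrightarrow> map (run u) basis = map (run w) basis"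

lemma vec_basis_expand: "(Vec a b c d e f g h :: 'a::comm_ring_1 vec) =
   scale a (Vec 1 0 0 0 0 0 0 0) + scale b (Vec 0 1 0 0 0 0 0 0) + scale c (Vec 0 0 1 0 0 0 0 0)
 + scale d (Vec 0 0 0 1 0 0 0 0) + scale e (Vec 0 0 0 0 1 0 0 0) + scale f (Vec 0 0 0 0 0 1 0 0)
 + scale g (Vec 0 0 0 0 0 0 1 0) + scale h (Vec 0 0 0 0 0 0 0 1)"
  by simp

lemma agree_iff: "agree u w \<longleftrightarrow> (\<forall>x. run u x = run w x)"
proof
  assume a: "agree u w"
  show "\<forall>x. run u x = run w x"
  proof
    fix x :: "'a vec"
    obtain a b c d e f g h where x: "x = Vec a b c d e f g h" by (cases x)
    show "run u x = run w x"
      unfolding x vec_basis_expand[of a b c d e f g h] run_add run_scale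
      using a by (simp add: agree_def basis_def)
  qed
qed (simp add: agree_def)

definition triv :: "'a::comm_ring_1 letter list \<Rightarrow> bool" where
  "triv w \<longleftrightarrow> (\<forall>x. run w x = x) \<or> (\<forall>x. run w x = - x)"

lemma agree_refl [simp]: "agree w w" by (simp add: agree_iff)

section \<open>Counting arguments in finite groups\<close>

lemma (in group) cauchy:
  assumes "finite (carrier G)" "Factorial_Ring.prime (q::nat)" "q dvd order G"
  obtains x where "x \<in> carrier G" "x \<noteq> \<one>" "x [^] q = \<one>"
proof -
  obtain m where m: "order G = q ^ 1 * m" using assms(3) by (auto elim: dvdE)
  interpret sylow G q 1 m "{s. s \<subseteq> carrier G \<and> card s = q ^ 1}"
     "{(N1, N2). N1 \<in> {s. s \<subseteq> carrier G \<and> card s = q ^ 1} \<and> N2 \<in> {s. s \<subseteq> carrier G \<and> card s = q ^ 1} \<and> (\<exists>g\<in>carrier G. N1 = N2 #> g)}"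
    using assms m by unfold_locales auto
  obtain H where H: "subgroup H G" "card H = q ^ 1" using sylow_thm by auto
  have fH: "finite H" using H(1) assms(1) by (meson finite_subset subgroup.subset)
  have "q > 1" using assms(2) prime_gt_1_nat by blast
  then have "\<not> H \<subseteq> {\<one>}" using H(2) fH card_mono[of "{\<one>}" H] by auto
  then obtain x where x: "x \<in> H" "x \<noteq> \<one>" by auto
  interpret H: group "G\<lparr>carrier := H\<rparr>" using H(1) by (rule subgroup_imp_group)
  have "x [^]\<^bsub>G\<lparr>carrier := H\<rparr>\<^esub> order (G\<lparr>carrier := H\<rparr>) = \<one>"
    using H.pow_order_eq_1[of x] x fH by simp
  then have "x [^] q = \<one>" using H(2) by (simp add: order_def nat_pow_consistent[symmetric])
  then show ?thesis using that x H(1) subgroup.subset by blast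
qed

lemma (in group) pi_group_set_23:
  assumes "finite (carrier G)" "subgroup K G"
    and "\<And>x. x \<in> K \<Longrightarrow> x [^] (2 ^ a * 3 ^ b :: nat) = \<one>"
  shows "is_pi_group_set {2, 3} K"
  unfolding is_pi_group_set_def
proof (intro conjI allI impI)
  show fK: "finite K" using assms by (meson finite_subset subgroup.subset)
  interpret K: group "G\<lparr>carrier := K\<rparr>" using assms(2) by (rule subgroup_imp_group)
  fix q :: nat assume q: "Factorial_Ring.prime q \<and> q dvd card K"
  obtain x where x: "x \<in> K" "x \<noteq> \<one>" "x [^]\<^bsub>G\<lparr>carrier := K\<rparr>\<^esub> q = \<one>"
    using K.cauchy[of q] q fK by (auto simp: order_def)
  have xG: "x \<in> carrier G" using x assms(2) subgroup.subset by blast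
  have "x [^] q = \<one>" using x by (simp add: nat_pow_consistent[symmetric])
  then have "ord x dvd q" using pow_eq_id[OF xG] by simp
  then have oq: "ord x = q" using q x(2) xG ord_eq_1 by (auto simp: prime_nat_iff)
  have "ord x dvd 2 ^ a * 3 ^ b" using assms(3)[OF x(1)] pow_eq_id[OF xG] by simp
  then have "q dvd 2 ^ a \<or> q dvd 3 ^ b" using oq q prime_dvd_mult_nat by blast
  then have "q dvd 2 \<or> q dvd 3" using q prime_dvd_power_nat by blast
  then have "q \<le> 3" by (auto dest!: dvd_imp_le)
  moreover have "q > 1" using q prime_gt_1_nat by blast
  ultimately show "q \<in> {2, 3}" by auto
qed

lemma three_dvd_card_fixpoint_free:
  assumes "finite Y" "\<And>x. x \<in> Y \<Longrightarrow> f x \<in> Y" "\<And>x. x \<in> Y \<Longrightarrow> f (f (f x)) = x" "\<And>x. x \<in> Y \<Longrightarrow> f x \<noteq> x"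
  shows "3 dvd card Y"
proof -
  let ?c = "\<lambda>x. {x, f x, f (f x)}"
  have c3: "card (?c x) = 3" if "x \<in> Y" for x
  proof -
    have "f (f x) \<noteq> f x" using assms that by blast
    moreover have "f (f x) \<noteq> x" using assms that by metis
    ultimately show ?thesis using assms(4)[OF that] by auto
  qed
  have orb: "?c y = ?c x" if "x \<in> Y" "y \<in> ?c x" for x y
    using that assms(3)[OF that(1)] by auto
  have "\<Union> (?c ` Y) = Y" using assms(2) by auto
  moreover have "3 dvd card (\<Union> (?c ` Y))"
  proof (rule dvd_partition)
    show "finite (\<Union> (?c ` Y))" using assms(1) by auto
    show "\<forall>c\<in>?c ` Y. 3 dvd card c" using c3 by auto
    show "\<forall>c1\<in>?c ` Y. \<forall>c2\<in>?c ` Y. c1 \<noteq> c2 \<longrightarrow> c1 \<inter> c2 = {}"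
    proof (intro ballI impI)
      fix c1 c2 assume "c1 \<in> ?c ` Y" "c2 \<in> ?c ` Y" and ne: "c1 \<noteq> c2"
      then obtain x y where xy: "x \<in> Y" "y \<in> Y" "c1 = ?c x" "c2 = ?c y" by auto
      show "c1 \<inter> c2 = {}"
      proof (rule ccontr)
        assume "c1 \<inter> c2 \<noteq> {}"
        then obtain z where "z \<in> ?c x" "z \<in> ?c y" using xy by auto
        then have "?c z = ?c x" "?c z = ?c y" using orb xy by blast+
        then show False using ne xy by simp
      qed
    qed
  qed
  ultimately show ?thesis by simp
qed

text \<open>Since H = R M, the set of cosets r M with r in R is stable under left multiplication by
  x. Its size divides the order of R, hence is prime to 3, so the permutation of order dividing 3
  has a fixed coset r M, and this says that x conjugated by r lies in M.\<close>

lemma (in group) order_3_conj_into_complement: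
  assumes fin: "finite (carrier G)" and H: "subgroup H G" and R: "subgroup R G" and M: "subgroup M G"
    and RH: "R \<subseteq> H" and RM: "\<And>h. h \<in> H \<Longrightarrow> \<exists>r\<in>R. \<exists>m\<in>M. h = r \<otimes> m"
    and R3: "\<not> 3 dvd card R" and x: "x \<in> H" "x \<otimes> x \<otimes> x = \<one>"
  shows "\<exists>r\<in>R. inv r \<otimes> x \<otimes> r \<in> M"
proof (rule ccontr)
  assume neg: "\<not> ?thesis"
  let ?Y = "(\<lambda>r. r <#\<^bsub>G\<^esub> M) ` R"
  have RG: "R \<subseteq> carrier G" and MG: "M \<subseteq> carrier G" and HG: "H \<subseteq> carrier G"
    using R M H subgroup.subset by auto
  have fR: "finite R" using fin RG finite_subset by blast
  have xG: "x \<in> carrier G" using x HG by auto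
  have absorb: "m <#\<^bsub>G\<^esub> M = M" if "m \<in> M" for m
    using that M by (simp add: coset_join3 subgroup.mem_carrier)
  have f1: "x <#\<^bsub>G\<^esub> C \<in> ?Y" if C: "C \<in> ?Y" for C
  proof -
    obtain r where r: "r \<in> R" "C = r <#\<^bsub>G\<^esub> M" using C by auto
    have "x \<otimes> r \<in> H" using subgroup.m_closed[OF H x(1)] r RH by auto
    then obtain r' m where r': "r' \<in> R" "m \<in> M" "x \<otimes> r = r' \<otimes> m" using RM by blast
    have "x <#\<^bsub>G\<^esub> C = (x \<otimes> r) <#\<^bsub>G\<^esub> M" using r xG RG MG by (simp add: lcos_m_assoc subset_iff)
    also have "\<dots> = r' <#\<^bsub>G\<^esub> (m <#\<^bsub>G\<^esub> M)" using r' RG MG by (simp add: lcos_m_assoc subset_iff)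
    also have "\<dots> = r' <#\<^bsub>G\<^esub> M" using absorb r' by simp
    finally show ?thesis using r' by blast
  qed
  have CG: "C \<subseteq> carrier G" if "C \<in> ?Y" for C
    using that RG MG by (auto simp: l_coset_def)
  have f3: "x <#\<^bsub>G\<^esub> (x <#\<^bsub>G\<^esub> (x <#\<^bsub>G\<^esub> C)) = C" if C: "C \<in> ?Y" for C
  proof -
    have "x <#\<^bsub>G\<^esub> (x <#\<^bsub>G\<^esub> (x <#\<^bsub>G\<^esub> C)) = (x \<otimes> x \<otimes> x) <#\<^bsub>G\<^esub> C"
      using CG[OF C] xG by (simp add: lcos_m_assoc m_assoc)
    then show ?thesis using x CG[OF C] by (simp add: lcos_mult_one)
  qed
  have ffree: "x <#\<^bsub>G\<^esub> C \<noteq> C" if C: "C \<in> ?Y" for C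
  proof
    assume eq: "x <#\<^bsub>G\<^esub> C = C"
    obtain r where r: "r \<in> R" "C = r <#\<^bsub>G\<^esub> M" using C by auto
    have rG: "r \<in> carrier G" using r RG by auto
    have "r \<in> C" using r rG subgroup.one_closed[OF M] by (force simp: l_coset_def)
    then have "x \<otimes> r \<in> C" using eq by (auto simp: l_coset_def)
    then obtain m where m: "m \<in> M" "x \<otimes> r = r \<otimes> m" using r by (auto simp: l_coset_def)
    have "inv r \<otimes> x \<otimes> r = m" using m rG xG MG by (auto simp: m_assoc inv_solve_left' subset_iff)
    then show False using neg r m by auto
  qed
  have "3 dvd card ?Y"
    by (rule three_dvd_card_fixpoint_free[of _ "\<lambda>C. x <#\<^bsub>G\<^esub> C"]) (use fR f1 f3 ffree in blast)+
  \<comment> \<open>The cosets cut R into disjoint pieces, each a translate of the intersection of R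
    with M.\<close>
  moreover have "card ?Y dvd card R"
  proof -
    have un: "\<Union> ((\<lambda>C. R \<inter> C) ` ?Y) = R"
    proof -
      have "r \<in> r <#\<^bsub>G\<^esub> M" if "r \<in> R" for r
        using that RG subgroup.one_closed[OF M] by (force simp: l_coset_def)
      then show ?thesis by auto
    qed
    have cardc: "card (R \<inter> C) = card (R \<inter> M)" if C: "C \<in> ?Y" for C
    proof -
      obtain r where r: "r \<in> R" "C = r <#\<^bsub>G\<^esub> M" using C by auto
      have rG: "r \<in> carrier G" using r RG by auto
      have "R \<inter> C = (\<lambda>m. r \<otimes> m) ` (R \<inter> M)"
      proof
        show "R \<inter> C \<subseteq> (\<lambda>m. r \<otimes> m) ` (R \<inter> M)"
        proof
          fix c assume c: "c \<in> R \<inter> C"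
          then obtain m where m: "m \<in> M" "c = r \<otimes> m" using r by (auto simp: l_coset_def)
          have "m = inv r \<otimes> c" using m rG MG by (auto simp: inv_solve_left subset_iff)
          then have "m \<in> R" using c r R by (simp add: subgroup.m_closed subgroup.m_inv_closed)
          then show "c \<in> (\<lambda>m. r \<otimes> m) ` (R \<inter> M)" using m by auto
        qed
        show "(\<lambda>m. r \<otimes> m) ` (R \<inter> M) \<subseteq> R \<inter> C"
          using r R by (auto simp: l_coset_def subgroup.m_closed)
      qed
      moreover have "inj_on (\<lambda>m. r \<otimes> m) (R \<inter> M)" using rG RG by (auto simp: inj_on_def subset_iff)
      ultimately show ?thesis by (simp add: card_image)
    qed
    have inj: "inj_on (\<lambda>C. R \<inter> C) ?Y"
    proof (rule inj_onI)
      fix C D assume C: "C \<in> ?Y" and D: "D \<in> ?Y" and eq: "R \<inter> C = R \<inter> D"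
      obtain r where r: "r \<in> R" "C = r <#\<^bsub>G\<^esub> M" using C by auto
      obtain s where s: "s \<in> R" "D = s <#\<^bsub>G\<^esub> M" using D by auto
      have rG: "r \<in> carrier G" "s \<in> carrier G" using r s RG by auto
      have "r \<in> C" using r rG subgroup.one_closed[OF M] by (force simp: l_coset_def)
      then obtain m where m: "m \<in> M" "r = s \<otimes> m" using eq r s by (auto simp: l_coset_def)
      have "C = s <#\<^bsub>G\<^esub> (m <#\<^bsub>G\<^esub> M)" using m r rG MG by (simp add: lcos_m_assoc subset_iff)
      then show "C = D" using absorb m s by simp
    qed
    have "card (R \<inter> M) * card ((\<lambda>C. R \<inter> C) ` ?Y) = card (\<Union> ((\<lambda>C. R \<inter> C) ` ?Y))"
    proof (rule card_partition)
      show "finite ((\<lambda>C. R \<inter> C) ` ?Y)" using fR by auto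
      show "finite (\<Union> ((\<lambda>C. R \<inter> C) ` ?Y))" using fR un by simp
      show "\<And>c. c \<in> (\<lambda>C. R \<inter> C) ` ?Y \<Longrightarrow> card c = card (R \<inter> M)" using cardc by blast
      fix c1 c2 assume c12: "c1 \<in> (\<lambda>C. R \<inter> C) ` ?Y" "c2 \<in> (\<lambda>C. R \<inter> C) ` ?Y" "c1 \<noteq> c2"
      then obtain r s where r: "r \<in> R" "c1 = R \<inter> (r <#\<^bsub>G\<^esub> M)" and s: "s \<in> R" "c2 = R \<inter> (s <#\<^bsub>G\<^esub> M)" by auto
      have rG: "r \<in> carrier G" "s \<in> carrier G" using r s RG by auto
      show "c1 \<inter> c2 = {}"
      proof (rule ccontr)
        assume "c1 \<inter> c2 \<noteq> {}"
        then obtain m m' where m: "m \<in> M" "m' \<in> M" "r \<otimes> m = s \<otimes> m'"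
          using r s by (auto simp: l_coset_def)
        have "r <#\<^bsub>G\<^esub> M = (r \<otimes> m) <#\<^bsub>G\<^esub> M"
          using absorb[OF m(1)] lcos_m_assoc[OF MG rG(1), of m] m(1) MG by (metis subsetD)
        also have "\<dots> = s <#\<^bsub>G\<^esub> M"
          using absorb[OF m(2)] lcos_m_assoc[OF MG rG(2), of m'] m MG by (metis subsetD)
        finally show False using r s c12 by simp
      qed
    qed
    then show ?thesis using un inj by (metis card_image dvd_triv_right)
  qed
  ultimately show False using R3 dvd_trans by blast
qed

lemma (in group) order_pow_2_not_3_dvd:
  assumes "finite (carrier G)" "subgroup R G" "\<And>x. x \<in> R \<Longrightarrow> x [^] (2 ^ k :: nat) = \<one>"
  shows "\<not> 3 dvd card R"
proof
  assume d: "3 dvd card R"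
  have fR: "finite R" using assms by (meson finite_subset subgroup.subset)
  interpret R: group "G\<lparr>carrier := R\<rparr>" using assms(2) by (rule subgroup_imp_group)
  obtain x where x: "x \<in> R" "x \<noteq> \<one>" "x [^]\<^bsub>G\<lparr>carrier := R\<rparr>\<^esub> (3::nat) = \<one>"
    using R.cauchy[of 3] d fR by (auto simp: order_def)
  have xG: "x \<in> carrier G" using x assms(2) subgroup.subset by blast
  have "x [^] (3::nat) = \<one>" using x by (simp add: nat_pow_consistent[symmetric])
  then have "ord x dvd 3" using pow_eq_id[OF xG] by simp
  moreover have "ord x dvd 2 ^ k" using assms(3)[OF x(1)] pow_eq_id[OF xG] by simp
  moreover have "coprime 3 (2 ^ k :: nat)" by simp
  ultimately have "ord x = 1" using coprime_common_divisor_nat by (metis nat_dvd_1_iff_1 One_nat_def)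
  then show False using x(2) xG ord_eq_1 by simp
qed

text \<open>Equality in the projective group: the scalars 1 and -1 are the centre that is divided
  out. Testing on the basis keeps it executable.\<close>

definition same :: "'a::comm_ring_1 letter list \<Rightarrow> 'a letter list \<Rightarrow> bool" where
  "same u w \<longleftrightarrow> map (run u) basis = map (run w) basis \<or> map (run u) basis = map (\<lambda>x. - run w x) basis"

lemma same_triv: "same u w \<Longrightarrow> triv (winv u @ w)"
proof -
  assume "same u w"
  then have "(\<forall>x. run u x = run w x) \<or> (\<forall>x. run u x = - run w x)"
    unfolding same_def
  proof
    assume "map (run u) basis = map (\<lambda>x. - run w x) basis"
    then have a: "\<And>x. x \<in> set basis \<Longrightarrow> run u x = - run w x" by simp
    have "run u x = - run w x" for x
    proof -
      obtain a b c d e f g h where x: "x = Vec a b c d e f g h" by (cases x)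
      have "- run w x = run w (- x)" by (simp add: run_uminus)
      show ?thesis
        unfolding x vec_basis_expand[of a b c d e f g h] run_add run_scale
        using a by (simp add: basis_def add.commute)
    qed
    then show ?thesis by blast
  qed (use agree_iff agree_def in blast)
  then show ?thesis
  proof
    assume "\<forall>x. run u x = run w x"
    then have "run (winv u @ w) x = x" for x using run_winv[of u x] by simp
    then show ?thesis unfolding triv_def by blast
  next
    assume "\<forall>x. run u x = - run w x"
    then have "run w x = - run u x" for x by simp
    then have "run (winv u @ w) x = - x" for x by (simp add: run_uminus)
    then show ?thesis unfolding triv_def by blast
  qed
qed

lemma triv_winv_append: "triv (winv u @ w) \<longleftrightarrow> (\<forall>x. run w x = run u x) \<or> (\<forall>x. run w x = - run u x)"
proof -
  have "run (winv u @ w) x = x \<longleftrightarrow> run w x = run u x" for x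
    by (metis run_append run_winv run_winv')
  moreover have "run (winv u @ w) x = - x \<longleftrightarrow> run w x = - run u x" for x
    by (metis run_append run_winv run_winv' run_uminus)
  ultimately show ?thesis by (simp add: triv_def del: run_append)
qed

lemma triv_Nil [simp]: "triv []" by (simp add: triv_def)

section \<open>The abstract setting: words acting in a group together with a triality
  element\<close>

lemma conjg_in_carrier: "group A \<Longrightarrow> x \<in> carrier A \<Longrightarrow> h \<in> carrier A \<Longrightarrow> conjg A x h \<in> carrier A"
  by (simp add: conjg_def group.is_monoid monoid.m_closed group.inv_closed)

text \<open>What remains of the product (s_1 r)(s_2 r)(s_3 r)... when every r is moved to the right:
  each factor passed is shifted once, and shifts count modulo 3. The three functions record the
  current residue.\<close>

fun twist twist1 twist2 :: "'a letter list list \<Rightarrow> 'a letter list" where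
  "twist [] = []" | "twist (s # ss) = s @ twist1 ss"
| "twist1 [] = []" | "twist1 (s # ss) = shift s @ twist2 ss"
| "twist2 [] = []" | "twist2 (s # ss) = shift (shift s) @ twist ss"

text \<open>Here A is the automorphism group, N the inner automorphisms and r a triality
  automorphism. The map \<open>\<pi>\<close> is left abstract because r is only conjugate to the
  graph automorphism: \<open>triality_action_conj\<close> transports the whole structure along such
  a conjugation.\<close>

locale triality_action = group A for A :: "('g, 'm) monoid_scheme" (structure) +
  fixes N :: "'g set" and \<pi> :: "'f::small_field letter list \<Rightarrow> 'g" and r :: 'g
  assumes fin: "finite (carrier A)"
    and pi_closed [simp]: "\<pi> w \<in> carrier A"
    and pi_append: "\<pi> (u @ w) = \<pi> u \<otimes> \<pi> w"
    and pi_range: "range \<pi> = N"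
    and r_closed [simp]: "r \<in> carrier A"
    and r_pi: "r \<otimes> \<pi> w = \<pi> (shift w) \<otimes> r"
    and r_cube: "r \<otimes> r \<otimes> r = \<one>"
    and pi_one_iff: "\<pi> w = \<one> \<longleftrightarrow> triv w"
begin

lemma pi_Nil [simp]: "\<pi> [] = \<one>" by (simp add: pi_one_iff)

lemma pi_winv: "\<pi> (winv w) = inv (\<pi> w)"
proof -
  have "\<pi> (winv w) \<otimes> \<pi> w = \<one>"
    unfolding pi_append[symmetric] pi_one_iff triv_def by simp
  then show ?thesis by (simp add: inv_equality[symmetric])
qed

lemma pi_eqI: "triv (winv u @ w) \<Longrightarrow> \<pi> u = \<pi> w"
proof -
  assume "triv (winv u @ w)"
  then have "inv (\<pi> u) \<otimes> \<pi> w = \<one>" by (simp add: pi_one_iff[symmetric] pi_append pi_winv)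
  then show ?thesis by (metis inv_closed inv_equality inv_inv pi_closed inv_comm)
qed

lemma pi_same: "same u w \<Longrightarrow> \<pi> u = \<pi> w" by (simp add: same_triv pi_eqI)

lemma pi_cong: "(\<And>x. run u x = run w x) \<Longrightarrow> \<pi> u = \<pi> w"
  by (rule pi_same) (simp add: same_def)

lemma pi_in_N [simp]: "\<pi> w \<in> N" using pi_range by auto

lemma N_carrier: "N \<subseteq> carrier A" using pi_range by auto

lemma r_pow_pi: "r [^] i \<otimes> \<pi> w = \<pi> ((shift ^^ i) w) \<otimes> r [^] (i::nat)"
proof (induction i arbitrary: w)
  case (Suc i)
  have "r [^] Suc i \<otimes> \<pi> w = r [^] i \<otimes> (r \<otimes> \<pi> w)" by (simp add: m_assoc)
  also have "\<dots> = (r [^] i \<otimes> \<pi> (shift w)) \<otimes> r" by (simp add: r_pi m_assoc)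
  also have "\<dots> = \<pi> ((shift ^^ Suc i) w) \<otimes> r [^] Suc i" by (simp add: Suc m_assoc funpow_swap1)
  finally show ?case .
qed simp

lemma conjg_r: "conjg A (\<pi> s \<otimes> r) (\<pi> g) = \<pi> (winv g @ s @ shift g) \<otimes> r"
  by (simp add: conjg_def pi_append pi_winv r_pi m_assoc)

lemma conjg_conjg: "\<lbrakk>x \<in> carrier A; g \<in> carrier A; h \<in> carrier A\<rbrakk> \<Longrightarrow> conjg A (conjg A x g) h = conjg A x (g \<otimes> h)"
  by (simp add: conjg_def inv_mult_group m_assoc)

lemma N_subset:
  assumes K: "subgroup K A" and P: "\<And>k. \<pi> [Pos k 1] \<in> K" and Q: "\<And>k. \<pi> [Neg k 1] \<in> K"
  shows "N \<subseteq> K"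
proof -
  have l: "\<pi> [l] \<in> K" for l
  proof -
    have z: "\<pi> [Pos k 0] = \<pi> []" "\<pi> [Neg k 0] = \<pi> []" for k
      by (rule pi_cong, case_tac x, cases k; simp)+
    have m: "\<pi> [Pos k (- 1)] = inv (\<pi> [Pos k 1])" "\<pi> [Neg k (- 1)] = inv (\<pi> [Neg k 1])" for k
      by (simp_all add: pi_winv[symmetric])
    have K1: "\<one> \<in> K" using K by (rule subgroup.one_closed)
    have Ki: "x \<in> K \<Longrightarrow> inv x \<in> K" for x using K by (rule subgroup.m_inv_closed)
    show ?thesis
    proof (cases l)
      case (Pos k t)
      from small[of t] show ?thesis by (elim disjE) (simp_all add: Pos z m P K1 Ki)
    next
      case (Neg k t)
      from small[of t] show ?thesis by (elim disjE) (simp_all add: Neg z m Q K1 Ki)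
    qed
  qed
  have "\<pi> w \<in> K" for w
  proof (induction w)
    case (Cons a w)
    have "\<pi> (a # w) = \<pi> [a] \<otimes> \<pi> w" using pi_append[of "[a]" w] by simp
    then show ?case using Cons l K subgroup.m_closed by metis
  qed (simp add: K subgroup.one_closed)
  then show ?thesis using pi_range by auto
qed

definition alphaN :: "'g \<Rightarrow> nat" where
  "alphaN x = (LEAST k. \<exists>ys. length ys = k \<and> (\<forall>y\<in>set ys. \<exists>h\<in>generate A (N \<union> {x}). y = conjg A x h)
      \<and> N \<subseteq> generate A (set ys))"

lemma N_nonabelian: "\<exists>u w. \<pi> u \<otimes> \<pi> w \<noteq> \<pi> w \<otimes> \<pi> u"
proof (rule ccontr)
  let ?u = "[Pos A1 1] :: 'f letter list" and ?w = "[Pos A2 1] :: 'f letter list"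
  assume "\<not> ?thesis"
  then have "\<pi> (?u @ ?w) = \<pi> (?w @ ?u)" by (simp add: pi_append del: append.simps)
  then have "\<pi> (winv (?w @ ?u) @ (?u @ ?w)) = \<one>" by (simp add: pi_append pi_winv del: append.simps winv_simps)
  then have t: "triv (winv (?w @ ?u) @ (?u @ ?w))" by (simp only: pi_one_iff)
  have "(\<forall>x. run (?u @ ?w) x = run (?w @ ?u) x) \<or> (\<forall>x. run (?u @ ?w) x = - run (?w @ ?u) x)"
    using t unfolding triv_winv_append .
  then show False
  proof
    assume "\<forall>x. run (?u @ ?w) x = run (?w @ ?u) x"
    from spec[OF this, of "Vec 0 0 1 0 0 0 0 0"] show False by simp
  next
    assume "\<forall>x. run (?u @ ?w) x = - run (?w @ ?u) x"
    from spec[OF this, of "Vec 0 0 1 0 0 0 0 0"] show False by simp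
  qed
qed

lemma generate_single_comm:
  assumes "y \<in> carrier A" "a \<in> generate A {y}" "b \<in> generate A {y}"
  shows "a \<otimes> b = b \<otimes> a"
proof -
  obtain i j :: int where "a = y [^] i" "b = y [^] j" using assms generate_pow[OF assms(1)] by auto
  then show ?thesis using assms(1) by (simp add: int_pow_mult[symmetric] add.commute)
qed

text \<open>One element generates an abelian group, whereas two root elements at adjacent nodes do
  not commute.\<close>

lemma not_N_subset_generate_short:
  assumes "length ys < 2" "set ys \<subseteq> carrier A"
  shows "\<not> N \<subseteq> generate A (set ys)"
proof
  assume sub: "N \<subseteq> generate A (set ys)"
  obtain y where y: "y \<in> carrier A" "generate A (set ys) \<subseteq> generate A {y}"
  proof (cases ys)
    case Nil then show ?thesis using that[of \<one>] mono_generate[of "{}" "{\<one>}"] by auto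
  next
    case (Cons a l) then show ?thesis using that[of a] assms by auto
  qed
  obtain u w where "\<pi> u \<otimes> \<pi> w \<noteq> \<pi> w \<otimes> \<pi> u" using N_nonabelian by blast
  then show False using generate_single_comm[OF y(1)] y(2) sub pi_in_N by blast
qed

lemma generate_conj:
  assumes "S \<subseteq> carrier A" "h \<in> carrier A" "z \<in> generate A S"
  shows "conjg A z h \<in> generate A ((\<lambda>x. conjg A x h) ` S)"
  using assms(3)
proof (induction rule: generate.induct)
  case one
  have "conjg A \<one> h = \<one>" using assms by (simp add: conjg_def)
  then show ?case by (simp add: generate.one)
next
  case (incl x) then show ?case by (simp add: generate.incl)
next
  case (inv x)
  have "conjg A (inv x) h = inv (conjg A x h)"
    using inv assms by (auto simp: conjg_def inv_mult_group m_assoc subset_iff)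
  then show ?case using inv by (simp add: generate.inv)
next
  case (eng x y)
  have c: "x \<in> carrier A" "y \<in> carrier A" using eng generate_in_carrier[OF assms(1)] by auto
  have "inv h \<otimes> (x \<otimes> y) \<otimes> h = (inv h \<otimes> x \<otimes> h) \<otimes> (inv h \<otimes> y \<otimes> h)"
    using c assms by (simp add: m_assoc inv_solve_left' flip: m_assoc[of h])
  then show ?case using eng by (simp add: conjg_def generate.eng)
qed

lemma N_conj:
  assumes "N \<subseteq> generate A S" "S \<subseteq> carrier A"
  shows "N \<subseteq> generate A ((\<lambda>x. conjg A x (\<pi> h)) ` S)"
proof
  fix n assume n: "n \<in> N"
  then obtain w where w: "n = \<pi> w" using pi_range by auto
  have "conjg A (\<pi> (h @ w @ winv h)) (\<pi> h) = n"
    by (simp add: conjg_def pi_append pi_winv w m_assoc) (simp add: m_assoc[symmetric])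
  then show "n \<in> generate A ((\<lambda>x. conjg A x (\<pi> h)) ` S)"
    using generate_conj[OF assms(2), of "\<pi> h" "\<pi> (h @ w @ winv h)"] assms(1) by (simp add: subset_iff)
qed

lemma alphaN_eq_2:
  assumes x: "x \<in> carrier A" and gen: "N \<subseteq> generate A {x, conjg A x (\<pi> g)}"
  shows "alphaN x = 2"
  unfolding alphaN_def
proof (rule Least_equality)
  let ?H = "generate A (N \<union> {x})"
  have "\<one> \<in> ?H" by (rule generate.one)
  moreover have "\<pi> g \<in> ?H" by (simp add: generate.incl)
  moreover have "x = conjg A x \<one>" using x by (simp add: conjg_def)
  ultimately have "\<forall>y\<in>set [x, conjg A x (\<pi> g)]. \<exists>h\<in>?H. y = conjg A x h" by auto
  then show "\<exists>ys. length ys = 2 \<and> (\<forall>y\<in>set ys. \<exists>h\<in>?H. y = conjg A x h) \<and> N \<subseteq> generate A (set ys)"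
    using gen by (intro exI[of _ "[x, conjg A x (\<pi> g)]"]) auto
next
  fix k assume "\<exists>ys. length ys = k \<and> (\<forall>y\<in>set ys. \<exists>h\<in>generate A (N \<union> {x}). y = conjg A x h) \<and> N \<subseteq> generate A (set ys)"
  then obtain ys where ys: "length ys = k" "\<forall>y\<in>set ys. \<exists>h\<in>generate A (N \<union> {x}). y = conjg A x h" "N \<subseteq> generate A (set ys)" by auto
  have "generate A (N \<union> {x}) \<subseteq> carrier A" using N_carrier x by (intro generate_incl) auto
  then have "set ys \<subseteq> carrier A" using ys(2) x by (auto intro!: conjg_in_carrier[OF is_group])
  then show "2 \<le> k" using not_N_subset_generate_short[of ys] ys by (meson not_le)
qed

end

section \<open>The centralizer of triality and the reduction of pairs of vectors of norm -1\<close>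

definition unit_vec :: "'a::comm_ring_1 vec" where "unit_vec = Vec 0 0 0 (- 1) 0 0 0 1"

definition pm :: "'a::comm_ring_1 vec \<Rightarrow> 'a vec \<Rightarrow> bool" where "pm x y \<longleftrightarrow> x = y \<or> x = - y"

definition sym_word :: "'a::comm_ring_1 letter list \<Rightarrow> bool" where
  "sym_word w \<longleftrightarrow> agree (shift w) w"

fun parab_letter :: "'a letter \<Rightarrow> bool" where
  "parab_letter (Neg A2 t) = False" | "parab_letter l = True"

definition parab :: "'a letter list \<Rightarrow> bool" where "parab = list_all parab_letter"

text \<open>A double coset statement: if g carries \<open>unit_vec\<close> to u in the first action
  and to v in the second, then g lies in C P C, where C is the centralizer of r and P the parabolic
  subgroup, because the word \<open>winv h @ c @ g\<close> fixes \<open>unit_vec\<close> up to sign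
  in both actions and \<open>stabilizer_sym\<close> applies to it.\<close>

definition pair_reducible :: "'a::comm_ring_1 vec \<Rightarrow> 'a vec \<Rightarrow> bool" where
  "pair_reducible u v \<longleftrightarrow> (\<exists>c h. sym_word c \<and> parab h \<and> pm (run c u) (run h unit_vec) \<and>
     pm (run (shift c) v) (run (shift h) unit_vec))"

lemma sym_word_run: "sym_word w \<longleftrightarrow> (\<forall>x. run (shift w) x = run w x)"
  by (simp add: sym_word_def agree_iff)

lemma sym_word_append: "sym_word u \<Longrightarrow> sym_word w \<Longrightarrow> sym_word (u @ w)"
  by (simp add: sym_word_run)

lemma sym_word_concat: "\<forall>w\<in>set ws. sym_word w \<Longrightarrow> sym_word (concat ws)"
  by (induction ws) (auto intro: sym_word_append simp: sym_word_run)

text \<open>The negative of \<open>unit_vec\<close> is the para-unit of the product: an idempotent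
  commuting with everything, multiplication by which is an involution.\<close>

lemma prd_unit_swap: "prd x unit_vec = prd unit_vec x" "prd (prd x unit_vec) unit_vec = x"
  by (cases x; simp add: unit_vec_def)+

lemma prd_unit_unit: "prd unit_vec unit_vec = - unit_vec"
  by (simp add: unit_vec_def)

text \<open>Multiplication by \<open>unit_vec\<close> intertwines the third action with each of the
  first two: with the first through \<open>prd x unit_vec\<close>, with the second through
  \<open>prd unit_vec x\<close>. These two multiplications coincide and are injective, so the first
  two actions of the word agree, up to the sign collected from the hypotheses. This is the fact that
  the stabilizer of the para-unit in two of the actions is the group of type G2 centralizing
  triality.\<close>

lemma stabilizer_sym:
  fixes w :: "'a::field letter list"
  assumes "pm (run w unit_vec) unit_vec" "pm (run (shift w) unit_vec) unit_vec"
  shows "triv (winv w @ shift w)"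
proof -
  let ?a = "run w" and ?b = "run (shift w)" and ?c = "run (shift (shift w))"
  let ?k = "\<lambda>x :: 'a vec. prd x unit_vec"
  have k: "?a x = y" if "?k (?a x) = ?k y" for x y
    using that prd_unit_swap(2) by metis
  have 1: "prd (?a x) (?b unit_vec) = ?c (?k x)" for x by (rule prd_run)
  have 2: "prd (?a unit_vec) (?b x) = ?c (?k x)" for x
    using prd_run[of w unit_vec x] by (simp add: prd_unit_swap)
  have 3: "?k (?b x) = prd unit_vec (?b x)" for x by (simp add: prd_unit_swap)
  have "(\<forall>x. ?k (?a x) = ?k (?b x)) \<or> (\<forall>x. ?k (?a x) = ?k (- ?b x))"
  proof -
    consider (pp) "run w unit_vec = unit_vec" "run (shift w) unit_vec = unit_vec"
      | (pn) "run w unit_vec = unit_vec" "run (shift w) unit_vec = - unit_vec"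
      | (np) "run w unit_vec = - unit_vec" "run (shift w) unit_vec = unit_vec"
      | (nn) "run w unit_vec = - unit_vec" "run (shift w) unit_vec = - unit_vec"
      using assms unfolding pm_def by blast
    then show ?thesis
    proof cases
    case pp
    have "?k (?a x) = ?k (?b x)" for x
    proof -
      have "?k (?a x) = ?c (?k x)" using 1[of x] pp by simp
      moreover have "?k (?b x) = ?c (?k x)" using 2[of x] 3[of x] pp by simp
      ultimately show ?thesis by (metis minus_minus prd_uminus(1))
    qed
    then show ?thesis by blast
    next
    case pn
    have "?k (?a x) = ?k (- ?b x)" for x
    proof -
      have "- ?k (?a x) = ?c (?k x)" using 1[of x] pn by simp
      moreover have "?k (?b x) = ?c (?k x)" using 2[of x] 3[of x] pn by simp
      ultimately show ?thesis by (metis minus_minus prd_uminus(1))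
    qed
    then show ?thesis by blast
    next
    case np
    have "?k (?a x) = ?k (- ?b x)" for x
    proof -
      have "?k (?a x) = ?c (?k x)" using 1[of x] np by simp
      moreover have "- ?k (?b x) = ?c (?k x)" using 2[of x] 3[of x] np by simp
      ultimately show ?thesis by (metis minus_minus prd_uminus(1))
    qed
    then show ?thesis by blast
    next
    case nn
    have "?k (?a x) = ?k (?b x)" for x
    proof -
      have "- ?k (?a x) = ?c (?k x)" using 1[of x] nn by simp
      moreover have "- ?k (?b x) = ?c (?k x)" using 2[of x] 3[of x] nn by simp
      ultimately show ?thesis by (metis minus_minus prd_uminus(1))
    qed
    then show ?thesis by blast
    qed
  qed
  then have "(\<forall>x. ?b x = ?a x) \<or> (\<forall>x. ?b x = - ?a x)"
  proof (elim disjE)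
    assume "\<forall>x. ?k (?a x) = ?k (?b x)"
    then show ?thesis using k by auto
  next
    assume "\<forall>x. ?k (?a x) = ?k (- ?b x)"
    then have "?a x = - ?b x" for x using k by blast
    then show ?thesis by simp
  qed
  then show ?thesis by (simp add: triv_winv_append)
qed

text \<open>A digit expansion orders the vectors; a finite check that every vector outside a list of
  representatives is lowered by some generator then reduces all of them.\<close>

definition dig :: "'a::small_field \<Rightarrow> nat" where
  "dig x = (if x = 0 then 0 else if x = 1 then 1 else 2)"

definition flt :: "'a::small_field \<Rightarrow> 'a \<Rightarrow> bool" where
  "flt x y = (if x = 0 then y \<noteq> 0 else if x = 1 then y \<noteq> 0 \<and> y \<noteq> 1 else False)"

fun llt :: "'a::small_field list \<Rightarrow> 'a list \<Rightarrow> bool" where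
  "llt (x # xs) (y # ys) = (if x = y then llt xs ys else flt x y)"
| "llt _ _ = False"

fun coords :: "'a vec \<Rightarrow> 'a list" where
  "coords (Vec a b c d e f g h) = [a, b, c, d, e, f, g, h]"

fun rev_coords :: "'a vec \<Rightarrow> 'a list" where
  "rev_coords (Vec a b c d e f g h) = [h, g, f, e, d, c, b, a]"

text \<open>Serves as the termination measure of \<open>descent\<close>; the evaluated checks
  compare digits with \<open>llt\<close> and involve no arithmetic on numbers.\<close>

definition vcode :: "('a vec \<Rightarrow> 'a list) \<Rightarrow> 'a::small_field vec \<Rightarrow> nat" where
  "vcode rd x = foldl (\<lambda>n t. n * 3 + dig t) 0 (rd x)"

lemma llt_foldl:
  assumes "length xs = length ys" "m < n \<or> m = n \<and> llt xs ys"
  shows "foldl (\<lambda>n t. n * 3 + dig t) m xs < foldl (\<lambda>n t. n * 3 + dig t) n ys"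
  using assms
proof (induction xs ys arbitrary: m n rule: list_induct2)
  case (Cons x xs y ys)
  have "dig x < 3" by (simp add: dig_def)
  moreover have "flt x y \<Longrightarrow> dig x < dig y" by (auto simp: flt_def dig_def split: if_splits)
  ultimately have "m * 3 + dig x < n * 3 + dig y \<or> m * 3 + dig x = n * 3 + dig y \<and> llt xs ys"
    using Cons.prems by (auto split: if_splits)
  then show ?case using Cons.IH by simp
qed simp

lemma llt_vcode: "length (rd x) = length (rd y) \<Longrightarrow> llt (rd x) (rd y) \<Longrightarrow> vcode rd x < vcode rd y"
  unfolding vcode_def by (rule llt_foldl) auto

definition lowered :: "('a vec \<Rightarrow> 'a list) \<Rightarrow> 'a::small_field vec list \<Rightarrow> 'a letter list list \<Rightarrow> 'a vec \<Rightarrow> bool" where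
  "lowered rd reps gens v = (if list_ex (\<lambda>g. llt (rd (run g v)) (rd v)) gens then True else v \<in> set reps)"

lemma length_coords: "length (coords x) = 8" "length (rev_coords x) = 8"
  by (cases x; simp)+

lemma descent:
  assumes rd: "\<And>x. length (rd x) = 8"
    and "\<And>v. Q v \<Longrightarrow> lowered rd reps gens v" "\<And>g v. g \<in> set gens \<Longrightarrow> Q v \<Longrightarrow> Q (run g v)" "Q v"
  shows "\<exists>ws. set ws \<subseteq> set gens \<and> run (concat ws) v \<in> set reps"
  using assms(4)
proof (induction "vcode rd v" arbitrary: v rule: less_induct)
  case less
  show ?case
  proof (cases "v \<in> set reps")
    case True then show ?thesis by (intro exI[of _ "[]"]) simp
  next
    case False
    then obtain g where g: "g \<in> set gens" "llt (rd (run g v)) (rd v)"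
      using assms(2)[OF less.prems] by (auto simp: lowered_def list_ex_iff split: if_splits)
    have "vcode rd (run g v) < vcode rd v" using g(2) by (intro llt_vcode) (simp_all add: rd)
    then obtain ws where "set ws \<subseteq> set gens" "run (concat ws) (run g v) \<in> set reps"
      using less.hyps assms(3)[OF g(1) less.prems] by blast
    then show ?thesis using g by (intro exI[of _ "ws @ [g]"]) simp
  qed
qed

definition allf :: "('a::small_field \<Rightarrow> bool) \<Rightarrow> bool" where
  "allf P = (if P 0 then if P 1 then if (1 :: 'a) = - 1 then True else P (- 1) else False else False)"

definition allv :: "('a::small_field vec \<Rightarrow> bool) \<Rightarrow> bool" where
  "allv P = allf (\<lambda>a. allf (\<lambda>b. allf (\<lambda>c. allf (\<lambda>d. allf (\<lambda>e. allf (\<lambda>f. allf (\<lambda>g. allf (\<lambda>h.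
     P (Vec a b c d e f g h)))))))))"

lemma allf_iff: "allf P \<longleftrightarrow> (\<forall>x. P x)"
proof
  assume a: "allf P"
  show "\<forall>x. P x"
  proof
    fix x :: 'a
    from small[of x] show "P x" by (elim disjE) (use a in \<open>metis allf_def\<close>)+
  qed
qed (simp add: allf_def)

lemma allv_iff: "allv P \<longleftrightarrow> (\<forall>x. P x)"
  unfolding allv_def allf_iff by (metis vec.exhaust)

text \<open>Symmetric words act alike in the first two actions. Once the first vector has been
  brought to r, the second may therefore be moved only by symmetric words that fix r. Each remaining
  representative carries its own witness for \<open>pair_reducible\<close>.\<close>

definition second_stage :: "'a::small_field vec \<Rightarrow> 'a letter list list \<Rightarrow>
    ('a vec \<times> 'a letter list \<times> 'a letter list) list \<Rightarrow> bool" where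
  "second_stage r gs cs \<longleftrightarrow>
     allv (\<lambda>v. if nrm v = - 1 then lowered coords (map fst cs) gs v else True) \<and>
     list_all (\<lambda>g. sym_word g \<and> run g r = r) gs \<and>
     list_all (\<lambda>(v, c, h). sym_word c \<and> parab h \<and> pm (run c r) (run h unit_vec) \<and>
        pm (run c v) (run (shift h) unit_vec)) cs"

definition pair_certificate ::
  "('a::small_field vec \<times> 'a letter list) list \<Rightarrow> 'a letter list list \<Rightarrow>
   ('a vec \<times> 'a letter list list \<times> ('a vec \<times> 'a letter list \<times> 'a letter list) list) list \<Rightarrow> bool" where
  "pair_certificate reps gens tab \<longleftrightarrow>
     allv (\<lambda>u. if nrm u = - 1 then lowered coords (map fst reps) gens u else True) \<and>
     list_all sym_word gens \<and>
     list_all (\<lambda>(u, c). sym_word c \<and> list_ex (\<lambda>(r, _). pm (run c u) r) tab) reps \<and>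
     list_all (\<lambda>(r, gs, cs). second_stage r gs cs) tab"

lemma pm_trans: "pm x y \<Longrightarrow> pm y z \<Longrightarrow> pm x z" by (auto simp: pm_def)
lemma pm_run: "pm x y \<Longrightarrow> pm (run w x) (run w y)" by (auto simp: pm_def run_uminus)
lemma pair_certificate_reducible:
  fixes u v :: "'a::small_field vec"
  assumes cert: "pair_certificate (reps :: ('a vec \<times> 'a letter list) list) gens tab" and n: "nrm u = - 1" "nrm v = - 1"
  shows "pair_reducible u v"
proof -
  have 1: "\<And>u :: 'a vec. nrm u = - 1 \<Longrightarrow> lowered coords (map fst reps) gens u"
    and 2: "\<And>g. g \<in> set gens \<Longrightarrow> sym_word g"
    using cert unfolding pair_certificate_def allv_iff by (auto simp: list_all_iff)
  obtain ws where ws: "set ws \<subseteq> set gens" "run (concat ws) u \<in> set (map fst reps)"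
    using descent[of coords "\<lambda>u. nrm u = - 1", OF length_coords(1) 1 _ n(1)] by (auto simp: nrm_run)
  then obtain c0 where "(run (concat ws) u, c0) \<in> set reps" by auto
  then obtain r gs cs where c0: "sym_word c0" and r: "(r, gs, cs) \<in> set tab" "pm (run (c0 @ concat ws) u) r"
    using cert unfolding pair_certificate_def by (fastforce simp: list_all_iff list_ex_iff)
  let ?c1 = "c0 @ concat ws"
  have s1: "sym_word ?c1" using ws(1) 2 c0 by (auto intro!: sym_word_concat sym_word_append)
  have st: "second_stage r gs cs" using cert r(1) unfolding pair_certificate_def list_all_iff by auto
  have 3: "\<And>v. nrm v = - 1 \<Longrightarrow> lowered coords (map fst cs) gs v"
    using st unfolding second_stage_def allv_iff by metis
  have 4: "\<And>g. g \<in> set gs \<Longrightarrow> sym_word g \<and> run g r = r"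
    using st unfolding second_stage_def list_all_iff by blast
  have 5: "\<And>v c h. (v, c, h) \<in> set cs \<Longrightarrow> sym_word c \<and> parab h \<and> pm (run c r) (run h unit_vec) \<and>
          pm (run c v) (run (shift h) unit_vec)"
    using st unfolding second_stage_def list_all_iff by blast
  have nv: "nrm (run ?c1 v) = - 1" using n by (simp add: nrm_run)
  obtain ws2 where ws2: "set ws2 \<subseteq> set gs" "run (concat ws2) (run ?c1 v) \<in> set (map fst cs)"
    using descent[of coords "\<lambda>u. nrm u = - 1", OF length_coords(1) 3 _ nv] by (auto simp: nrm_run)
  let ?c2 = "concat ws2"
  have s2: "sym_word ?c2" using ws2 4 by (auto intro: sym_word_concat)
  have "run ?c2 r = r" using ws2(1) 4 by (induction ws2) auto
  then have r2: "pm (run ?c2 (run ?c1 u)) r" using pm_run[OF r(2), of ?c2] by simp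
  obtain c h where ch: "(run ?c2 (run ?c1 v), c, h) \<in> set cs" using ws2(2) by auto
  note c5 = 5[OF ch]
  have sy: "sym_word (c @ ?c2 @ ?c1)" using sym_word_append[OF conjunct1[OF c5] sym_word_append[OF s2 s1]] .
  have "pm (run (c @ ?c2 @ ?c1) u) (run h unit_vec)"
    using pm_run[OF r2, of c] c5 by (auto intro: pm_trans)
  moreover have "pm (run (shift (c @ ?c2 @ ?c1)) v) (run (shift h) unit_vec)"
    using sy c5 unfolding sym_word_run by auto
  ultimately show ?thesis using sy c5 unfolding pair_reducible_def by blast
qed

text \<open>Fixing the first coordinate splits a check over all 3^8 vectors into three evaluations
  of manageable size.\<close>

definition slice :: "'a::small_field \<Rightarrow> ('a vec \<Rightarrow> bool) \<Rightarrow> bool" where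
  "slice a P = allf (\<lambda>b. allf (\<lambda>c. allf (\<lambda>d. allf (\<lambda>e. allf (\<lambda>f. allf (\<lambda>g. allf (\<lambda>h.
     P (Vec a b c d e f g h))))))))"

lemma allv_slices: "slice 0 P \<Longrightarrow> slice 1 P \<Longrightarrow> slice (- 1) P \<Longrightarrow> allv P"
  unfolding allv_def slice_def[symmetric] by (simp add: allf_def)

text \<open>The three representatives are \<open>unit_vec\<close>, \<open>unit_vec\<close> plus a
  singular vector orthogonal to it, and a vector whose inner product with \<open>unit_vec\<close> is
  1 instead of 0. Over three elements the table \<open>pair_tab_f3\<close> has the same shape up to
  sign, the last inner product being 0 instead of 1 or -1.\<close>

lemma pair_reducible_f2: "nrm u = - 1 \<Longrightarrow> nrm v = - 1 \<Longrightarrow> pair_reducible u (v :: f2 vec)"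
  by (rule pair_certificate_reducible[where reps = "[(Vec 0 0 0 1 0 0 0 1, []),
     (Vec 0 0 0 1 0 0 1 1, []),
     (Vec 0 0 1 0 0 0 1 1, [])]" and
    gens = "[[Pos A2 1, Neg A2 1],
     [Pos A1 1, Pos A3 1, Pos A4 1],
     [Pos A1 1, Pos A3 1, Pos A4 1, Neg A1 1, Neg A3 1, Neg A4 1],
     [Neg A2 1],
     [Neg A1 1, Neg A3 1, Neg A4 1, Neg A2 1, Pos A2 1],
     [Neg A1 1, Neg A3 1, Neg A4 1, Pos A1 1, Pos A3 1, Pos A4 1]]" and
    tab = "[(Vec 0 0 0 1 0 0 0 1, [[Pos A2 1, Neg A2 1],
     [Pos A1 1, Pos A3 1, Pos A4 1],
     [Pos A1 1, Pos A3 1, Pos A4 1, Neg A1 1, Neg A3 1, Neg A4 1],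
     [Neg A2 1],
     [Neg A1 1, Neg A3 1, Neg A4 1, Neg A2 1, Pos A2 1],
     [Neg A1 1, Neg A3 1, Neg A4 1, Pos A1 1, Pos A3 1, Pos A4 1]],
    [(Vec 0 0 0 1 0 0 0 1, [], []),
     (Vec 0 0 0 1 0 0 1 1, [], [Neg A1 1]),
     (Vec 0 0 1 0 0 0 1 1, [], [Neg A1 1, Pos A1 1])]),
    (Vec 0 0 0 1 0 0 1 1, [[Pos A2 1],
     [Neg A1 1, Neg A3 1, Neg A4 1],
     [Neg A2 1, Pos A2 1, Pos A1 1, Pos A3 1, Pos A4 1, Pos A2 1, Neg A2 1],
     [Neg A2 1, Pos A2 1, Neg A4 1, Neg A3 1, Neg A1 1, Pos A4 1, Pos A3 1, Pos A1 1, Pos A2 1, Pos A1 1, Pos A3 1, Pos A4 1, Neg A2 1, Neg A1 1, Neg A3 1, Neg A4 1, Pos A2 1, Neg A2 1],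
     [Neg A2 1, Pos A4 1, Pos A3 1, Pos A1 1, Neg A4 1, Neg A3 1, Neg A1 1, Neg A2 1, Neg A1 1, Neg A3 1, Neg A4 1, Pos A1 1, Pos A3 1, Pos A4 1, Neg A2 1],
     [Pos A4 1, Pos A3 1, Pos A1 1, Pos A2 1, Neg A4 1, Neg A3 1, Neg A1 1, Neg A2 1, Neg A1 1, Neg A3 1, Neg A4 1, Neg A2 1, Neg A1 1, Neg A3 1, Neg A4 1, Pos A2 1, Pos A1 1, Pos A3 1, Pos A4 1],
     [Neg A1 1, Neg A3 1, Neg A4 1, Pos A4 1, Pos A3 1, Pos A1 1, Pos A2 1, Neg A2 1, Neg A4 1, Neg A3 1, Neg A1 1, Neg A2 1, Pos A2 1, Pos A1 1, Pos A3 1, Pos A4 1, Neg A1 1, Neg A3 1, Neg A4 1, Neg A2 1]],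
    [(Vec 0 0 0 1 0 0 0 1, [], [Neg A4 1]),
     (Vec 0 0 0 1 0 0 1 1, [], [Neg A3 1]),
     (Vec 0 0 0 1 0 1 0 1, [Neg A2 1, Neg A1 1, Neg A3 1, Neg A4 1, Pos A2 1, Pos A1 1, Pos A3 1, Pos A4 1, Neg A2 1, Neg A1 1, Neg A3 1, Neg A4 1, Pos A2 1, Pos A1 1, Pos A3 1, Pos A4 1, Pos A2 1, Neg A2 1], [Pos A4 1, Pos A2 1, Neg A3 1, Pos A3 1, Pos A2 1, Pos A1 1]),
     (Vec 0 0 0 1 1 0 0 1, [Neg A2 1, Neg A1 1, Neg A3 1, Neg A4 1, Pos A2 1, Pos A1 1, Pos A3 1, Pos A4 1], [Pos A4 1, Pos A2 1, Neg A1 1, Pos A4 1]),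
     (Vec 0 0 1 0 0 0 1 0, [], [Neg A3 1, Neg A1 1, Pos A1 1]),
     (Vec 0 0 1 0 0 0 1 1, [], [Neg A4 1, Neg A1 1, Pos A1 1]),
     (Vec 0 1 0 0 0 1 0 1, [Neg A2 1, Neg A1 1, Neg A3 1, Neg A4 1, Pos A2 1, Pos A1 1, Pos A3 1, Pos A4 1, Neg A2 1, Pos A2 1, Neg A4 1, Neg A3 1, Neg A1 1, Neg A2 1, Neg A1 1, Neg A3 1, Neg A4 1, Pos A2 1, Neg A2 1, Pos A4 1, Pos A3 1, Pos A1 1, Pos A2 1, Pos A4 1, Pos A3 1, Pos A1 1, Pos A2 1, Pos A1 1, Pos A3 1, Pos A4 1, Pos A2 1, Pos A1 1, Pos A3 1, Pos A4 1], [Pos A4 1, Pos A2 1, Neg A1 1, Pos A3 1])]),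
    (Vec 0 0 1 0 0 0 1 1, [[Neg A1 1, Neg A3 1, Neg A4 1, Pos A1 1, Pos A3 1, Pos A4 1],
     [Neg A2 1, Pos A2 1, Neg A4 1, Neg A3 1, Neg A1 1, Neg A2 1, Neg A1 1, Neg A3 1, Neg A4 1, Neg A2 1, Neg A1 1, Neg A3 1, Neg A4 1, Pos A2 1],
     [Pos A2 1, Neg A2 1, Pos A4 1, Pos A3 1, Pos A1 1, Neg A4 1, Neg A3 1, Neg A1 1, Neg A2 1, Neg A1 1, Neg A3 1, Neg A4 1, Pos A1 1, Pos A3 1, Pos A4 1, Neg A2 1, Pos A2 1],
     [Pos A2 1, Pos A4 1, Pos A3 1, Pos A1 1, Neg A4 1, Neg A3 1, Neg A1 1, Pos A1 1, Pos A3 1, Pos A4 1, Pos A2 1, Pos A1 1, Pos A3 1, Pos A4 1, Pos A2 1],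
     [Neg A2 1, Pos A2 1, Pos A4 1, Pos A3 1, Pos A1 1, Pos A2 1, Pos A1 1, Pos A3 1, Pos A4 1, Neg A2 1, Neg A1 1, Neg A3 1, Neg A4 1, Pos A2 1],
     [Neg A2 1, Pos A2 1, Neg A4 1, Neg A3 1, Neg A1 1, Neg A2 1, Neg A1 1, Neg A3 1, Neg A4 1, Neg A2 1, Neg A1 1, Neg A3 1, Neg A4 1, Pos A4 1, Pos A3 1, Pos A1 1, Pos A2 1, Pos A1 1, Pos A3 1, Pos A4 1, Neg A1 1, Neg A3 1, Neg A4 1, Pos A1 1, Pos A3 1, Pos A4 1, Pos A2 1],
     [Pos A2 1, Neg A2 1, Pos A4 1, Pos A3 1, Pos A1 1, Pos A2 1, Pos A1 1, Pos A3 1, Pos A4 1, Pos A2 1, Pos A1 1, Pos A3 1, Pos A4 1, Neg A2 1],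
     [Pos A4 1, Pos A3 1, Pos A1 1, Neg A1 1, Neg A3 1, Neg A4 1, Neg A2 1, Pos A4 1, Pos A3 1, Pos A1 1, Neg A4 1, Neg A3 1, Neg A1 1, Pos A1 1, Pos A3 1, Pos A4 1, Neg A2 1, Neg A1 1, Neg A3 1, Neg A4 1, Neg A2 1]],
    [(Vec 0 0 0 1 0 0 0 1, [], [Pos A4 1, Neg A4 1]),
     (Vec 0 0 0 1 0 0 1 1, [], [Neg A3 1, Pos A4 1]),
     (Vec 0 0 0 1 0 1 0 1, [Neg A2 1, Neg A4 1, Neg A3 1, Neg A1 1, Pos A4 1, Pos A3 1, Pos A1 1, Neg A2 1, Neg A1 1, Neg A3 1, Neg A4 1, Pos A1 1, Pos A3 1, Pos A4 1, Pos A2 1, Pos A4 1, Pos A3 1, Pos A1 1, Pos A2 1, Pos A1 1, Pos A3 1, Pos A4 1, Neg A2 1, Neg A1 1, Neg A3 1, Neg A4 1, Pos A2 1], [Neg A3 1, Pos A3 1, Pos A2 1, Neg A1 1, Pos A1 1]),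
     (Vec 0 0 1 0 0 0 1 1, [], [Pos A4 1, Neg A4 1, Neg A1 1, Pos A1 1]),
     (Vec 0 0 1 0 0 1 1 1, [Neg A2 1, Neg A4 1, Neg A3 1, Neg A1 1, Pos A4 1, Pos A3 1, Pos A1 1, Neg A2 1, Neg A1 1, Neg A3 1, Neg A4 1, Pos A1 1, Pos A3 1, Pos A4 1, Pos A2 1, Pos A4 1, Pos A3 1, Pos A1 1, Pos A2 1, Pos A1 1, Pos A3 1, Pos A4 1, Neg A2 1, Neg A1 1, Neg A3 1, Neg A4 1, Pos A2 1], [Neg A3 1, Pos A3 1, Pos A2 1, Pos A1 1, Neg A1 1]),
     (Vec 0 0 1 1 0 0 1 0, [], [Neg A3 1, Pos A3 1]),
     (Vec 0 0 1 1 0 1 1 0, [Pos A2 1, Neg A4 1, Neg A3 1, Neg A1 1, Neg A2 1, Neg A4 1, Neg A3 1, Neg A1 1, Neg A2 1, Neg A1 1, Neg A3 1, Neg A4 1, Pos A2 1, Neg A2 1, Pos A2 1, Neg A2 1, Pos A4 1, Pos A3 1, Pos A1 1, Pos A2 1, Pos A1 1, Pos A3 1, Pos A4 1, Pos A2 1, Pos A1 1, Pos A3 1, Pos A4 1, Neg A2 1], [Pos A4 1, Pos A2 1, Neg A3 1, Pos A1 1])])]"]) code_simp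

definition pair_reps_f3 :: "(f3 vec \<times> f3 letter list) list" where
  "pair_reps_f3 = [(Vec 0 0 0 1 0 0 0 (- 1), []),
     (Vec 0 0 0 1 0 0 1 (- 1), []),
     (Vec 0 0 0 (- 1) 0 0 0 1, []),
     (Vec 0 0 0 (- 1) 0 0 1 1, [Pos A2 1, Neg A2 (- 1), Pos A2 (- 1), Neg A2 (- 1), Pos A2 1]),
     (Vec 0 0 1 0 0 0 (- 1) 0, [])]"

definition pair_gens_f3 :: "f3 letter list list" where
  "pair_gens_f3 = [[Neg A2 1],
     [Pos A2 1, Neg A2 (- 1)],
     [Pos A1 1, Pos A3 1, Pos A4 1, Neg A4 (- 1), Neg A3 (- 1), Neg A1 (- 1)],
     [Pos A1 1, Pos A3 1, Pos A4 1],
     [Neg A1 1, Neg A3 1, Neg A4 1, Pos A4 (- 1), Pos A3 (- 1), Pos A1 (- 1)],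
     [Neg A2 1, Pos A2 1, Neg A2 1],
     [Neg A2 (- 1)],
     [Neg A1 1, Neg A3 1, Neg A4 1, Neg A2 (- 1), Neg A4 (- 1), Neg A3 (- 1), Neg A1 (- 1)],
     [Neg A1 1, Neg A3 1, Neg A4 1, Neg A2 1, Pos A2 (- 1)]]"

definition stage_gens_f3_1 :: "f3 letter list list" where
  "stage_gens_f3_1 = pair_gens_f3"

definition stage_reps_f3_1 :: "(f3 vec \<times> f3 letter list \<times> f3 letter list) list" where
  "stage_reps_f3_1 = [(Vec 0 0 0 1 0 0 0 (- 1), [], []),
     (Vec 0 0 0 1 0 0 1 (- 1), [], [Neg A1 1]),
     (Vec 0 0 0 (- 1) 0 0 0 1, [], []),
     (Vec 0 0 0 (- 1) 0 0 1 1, [], [Neg A1 1, Neg A1 1]),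
     (Vec 0 0 1 0 0 0 (- 1) 0, [], [Pos A1 1, Neg A1 1, Neg A1 1, Pos A1 1])]"

definition stage_gens_f3_2 :: "f3 letter list list" where
  "stage_gens_f3_2 = [[Pos A2 (- 1)],
     [Pos A2 1],
     [Neg A1 1, Neg A3 1, Neg A4 1],
     [Neg A2 (- 1), Pos A2 1, Pos A4 (- 1), Pos A3 (- 1), Pos A1 (- 1), Pos A2 (- 1), Neg A2 1],
     [Pos A2 1, Neg A4 (- 1), Neg A3 (- 1), Neg A1 (- 1)],
     [Pos A1 1, Pos A3 1, Pos A4 1, Neg A1 1, Neg A3 1, Neg A4 1, Pos A1 1, Pos A3 1, Pos A4 1],
     [Neg A1 1, Neg A3 1, Neg A4 1, Neg A2 (- 1), Neg A1 1, Neg A3 1, Neg A4 1, Neg A2 (- 1), Neg A1 1, Neg A3 1, Neg A4 1, Neg A2 (- 1)],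
     [Neg A2 (- 1), Pos A2 1, Pos A1 1, Pos A3 1, Pos A4 1, Pos A2 (- 1), Neg A2 1],
     [Pos A4 (- 1), Pos A3 (- 1), Pos A1 (- 1), Neg A2 1, Neg A1 1, Neg A3 1, Neg A4 1, Neg A2 1, Neg A4 (- 1), Neg A3 (- 1), Neg A1 (- 1), Neg A2 (- 1), Pos A1 1, Pos A3 1, Pos A4 1],
     [Pos A4 (- 1), Pos A3 (- 1), Pos A1 (- 1), Pos A2 (- 1), Pos A1 1, Pos A3 1, Pos A4 1, Pos A2 1, Pos A4 (- 1), Pos A3 (- 1), Pos A1 (- 1), Pos A2 1, Pos A1 1, Pos A3 1, Pos A4 1, Neg A2 1, Neg A4 (- 1), Neg A3 (- 1), Neg A1 (- 1), Neg A2 1, Neg A4 (- 1), Neg A3 (- 1), Neg A1 (- 1), Neg A2 1],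
     [Neg A1 1, Neg A3 1, Neg A4 1, Pos A1 1, Pos A3 1, Pos A4 1, Neg A1 1, Neg A3 1, Neg A4 1, Pos A1 1, Pos A3 1, Pos A4 1],
     [Neg A1 1, Neg A3 1, Neg A4 1, Neg A2 1, Neg A1 1, Neg A3 1, Neg A4 1, Neg A2 1, Neg A1 1, Neg A3 1, Neg A4 1, Neg A2 1],
     [Neg A2 1, Pos A2 (- 1), Neg A4 (- 1), Neg A3 (- 1), Neg A1 (- 1), Neg A2 1, Neg A1 1, Neg A3 1, Neg A4 1, Pos A2 (- 1), Neg A1 1, Neg A3 1, Neg A4 1, Neg A2 (- 1), Neg A1 1, Neg A3 1, Neg A4 1, Pos A2 1, Neg A2 1],
     [Neg A2 1, Pos A2 (- 1), Neg A4 (- 1), Neg A3 (- 1), Neg A1 (- 1), Pos A4 (- 1), Pos A3 (- 1), Pos A1 (- 1), Neg A4 (- 1), Neg A3 (- 1), Neg A1 (- 1), Pos A2 (- 1), Neg A2 1],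
     [Neg A2 1, Pos A2 1, Neg A1 1, Neg A3 1, Neg A4 1, Neg A2 (- 1), Neg A1 1, Neg A3 1, Neg A4 1, Pos A2 (- 1), Neg A1 1, Neg A3 1, Neg A4 1, Neg A2 1, Neg A4 (- 1), Neg A3 (- 1), Neg A1 (- 1), Pos A2 (- 1), Neg A2 1],
     [Neg A2 (- 1), Pos A2 (- 1), Neg A4 (- 1), Neg A3 (- 1), Neg A1 (- 1), Neg A2 1, Neg A4 (- 1), Neg A3 (- 1), Neg A1 (- 1), Pos A2 1, Neg A4 (- 1), Neg A3 (- 1), Neg A1 (- 1), Neg A2 (- 1), Neg A1 1, Neg A3 1, Neg A4 1, Pos A2 1, Neg A2 (- 1)],
     [Neg A2 (- 1), Pos A2 1, Neg A1 1, Neg A3 1, Neg A4 1, Neg A2 (- 1), Neg A4 (- 1), Neg A3 (- 1), Neg A1 (- 1), Pos A2 1, Neg A4 (- 1), Neg A3 (- 1), Neg A1 (- 1), Neg A2 1, Neg A4 (- 1), Neg A3 (- 1), Neg A1 (- 1), Pos A2 (- 1), Neg A2 (- 1)]]"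

definition stage_reps_f3_2 :: "(f3 vec \<times> f3 letter list \<times> f3 letter list) list" where
  "stage_reps_f3_2 = [(Vec 0 0 0 1 0 0 0 (- 1), [], [Neg A3 1, Neg A1 1]),
     (Vec 0 0 0 1 0 0 1 (- 1), [], [Neg A3 1, Neg A1 1, Neg A1 1]),
     (Vec 0 0 0 1 0 0 (- 1) (- 1), [], [Neg A3 1]),
     (Vec 0 0 0 1 0 1 0 (- 1), [Neg A2 (- 1), Neg A1 1, Neg A3 1, Neg A4 1, Pos A2 1, Neg A2 1, Neg A1 1, Neg A3 1, Neg A4 1, Pos A1 1, Pos A3 1, Pos A4 1, Pos A2 1, Pos A1 1, Pos A3 1, Pos A4 1, Pos A2 (- 1), Neg A2 1], [Pos A4 1, Pos A4 1, Pos A2 1, Pos A3 1, Pos A2 1, Neg A3 1, Pos A1 1, Pos A1 1]),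
     (Vec 0 0 0 1 1 0 0 (- 1), [Neg A2 (- 1), Neg A4 (- 1), Neg A3 (- 1), Neg A1 (- 1), Pos A2 1, Pos A1 1, Pos A3 1, Pos A4 1], [Pos A4 1, Pos A4 1, Pos A2 1, Neg A1 1, Pos A4 1]),
     (Vec 0 0 0 (- 1) 0 0 0 1, [], [Neg A3 1, Neg A1 1]),
     (Vec 0 0 0 (- 1) 0 0 1 1, [], [Neg A3 1]),
     (Vec 0 0 0 (- 1) 0 0 (- 1) 1, [], [Neg A3 1, Neg A1 1, Neg A1 1]),
     (Vec 0 0 0 (- 1) 0 1 0 1, [Neg A2 (- 1), Neg A1 1, Neg A3 1, Neg A4 1, Pos A2 1, Neg A2 1, Neg A1 1, Neg A3 1, Neg A4 1, Pos A1 1, Pos A3 1, Pos A4 1, Pos A2 1, Pos A1 1, Pos A3 1, Pos A4 1, Pos A2 (- 1), Neg A2 1], [Neg A3 1, Neg A3 1, Pos A3 1, Pos A2 1, Pos A4 1, Pos A2 1, Neg A1 1, Pos A1 1]),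
     (Vec 0 0 0 (- 1) 1 0 0 1, [Neg A2 1, Neg A4 (- 1), Neg A3 (- 1), Neg A1 (- 1), Pos A2 (- 1), Pos A1 1, Pos A3 1, Pos A4 1], [Pos A4 1, Pos A2 1, Neg A1 1, Pos A3 1, Pos A1 1]),
     (Vec 0 0 1 0 0 0 (- 1) 0, [], [Neg A3 1, Neg A1 1, Neg A1 1, Pos A1 1]),
     (Vec 0 0 1 0 0 0 (- 1) 1, [], [Neg A4 1, Neg A4 1, Neg A1 1, Pos A1 1, Pos A1 1]),
     (Vec 0 0 1 0 0 0 (- 1) (- 1), [], [Neg A3 1, Neg A1 1, Pos A1 1, Pos A1 1]),
     (Vec 0 0 (- 1) 0 0 0 1 0, [], [Neg A3 1, Neg A1 1, Neg A1 1, Pos A1 1]),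
     (Vec 0 0 (- 1) 0 0 0 1 1, [], [Neg A3 1, Neg A1 1, Pos A1 1, Pos A1 1]),
     (Vec 0 0 (- 1) 0 0 0 1 (- 1), [], [Neg A4 1, Neg A4 1, Neg A1 1, Pos A1 1, Pos A1 1]),
     (Vec 0 1 0 0 0 (- 1) 0 0, [Neg A2 1, Neg A4 (- 1), Neg A3 (- 1), Neg A1 (- 1), Pos A2 (- 1), Pos A1 1, Pos A3 1, Pos A4 1, Neg A2 (- 1), Pos A4 (- 1), Pos A3 (- 1), Pos A1 (- 1), Neg A1 1, Neg A3 1, Neg A4 1, Neg A2 1, Neg A4 (- 1), Neg A3 (- 1), Neg A1 (- 1), Pos A1 1, Pos A3 1, Pos A4 1, Neg A2 1, Pos A4 (- 1), Pos A3 (- 1), Pos A1 (- 1), Pos A2 (- 1), Pos A1 1, Pos A3 1, Pos A4 1, Pos A2 (- 1), Pos A4 (- 1), Pos A3 (- 1), Pos A1 (- 1), Pos A2 1, Pos A1 1, Pos A3 1, Pos A4 1], [Pos A4 1, Pos A2 1, Pos A1 1, Pos A1 1, Neg A1 1, Pos A3 1])]"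

definition stage_gens_f3_3 :: "f3 letter list list" where
  "stage_gens_f3_3 = [[Neg A2 (- 1), Pos A1 1, Pos A3 1, Pos A4 1, Pos A2 (- 1), Neg A2 (- 1), Neg A4 (- 1), Neg A3 (- 1), Neg A1 (- 1), Pos A2 (- 1)],
     [Neg A1 1, Neg A3 1, Neg A4 1, Neg A2 (- 1), Neg A1 1, Neg A3 1, Neg A4 1, Neg A2 (- 1), Neg A1 1, Neg A3 1, Neg A4 1, Neg A2 1],
     [Pos A4 (- 1), Pos A3 (- 1), Pos A1 (- 1), Neg A4 (- 1), Neg A3 (- 1), Neg A1 (- 1), Pos A4 (- 1), Pos A3 (- 1), Pos A1 (- 1), Neg A4 (- 1), Neg A3 (- 1), Neg A1 (- 1)],
     [Neg A1 1, Neg A3 1, Neg A4 1, Pos A4 (- 1), Pos A3 (- 1), Pos A1 (- 1), Neg A1 1, Neg A3 1, Neg A4 1],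
     [Neg A4 (- 1), Neg A3 (- 1), Neg A1 (- 1), Pos A2 1, Neg A2 (- 1), Neg A1 1, Neg A3 1, Neg A4 1, Neg A2 (- 1), Neg A4 (- 1), Neg A3 (- 1), Neg A1 (- 1), Neg A2 (- 1), Pos A2 (- 1)],
     [Neg A2 (- 1), Neg A4 (- 1), Neg A3 (- 1), Neg A1 (- 1), Neg A2 (- 1), Neg A1 1, Neg A3 1, Neg A4 1, Neg A2 1, Neg A4 (- 1), Neg A3 (- 1), Neg A1 (- 1), Neg A2 1, Neg A1 1, Neg A3 1, Neg A4 1],
     [Pos A2 (- 1), Neg A1 1, Neg A3 1, Neg A4 1, Neg A2 (- 1), Pos A2 (- 1), Pos A4 (- 1), Pos A3 (- 1), Pos A1 (- 1), Neg A2 (- 1)],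
     [Neg A4 (- 1), Neg A3 (- 1), Neg A1 (- 1), Neg A2 1, Neg A4 (- 1), Neg A3 (- 1), Neg A1 (- 1), Neg A2 1, Neg A4 (- 1), Neg A3 (- 1), Neg A1 (- 1), Neg A2 (- 1)],
     [Pos A2 (- 1), Neg A2 (- 1), Neg A4 (- 1), Neg A3 (- 1), Neg A1 (- 1), Neg A2 (- 1), Neg A1 1, Neg A3 1, Neg A4 1, Neg A2 (- 1), Neg A4 (- 1), Neg A3 (- 1), Neg A1 (- 1), Pos A2 1],
     [Neg A2 (- 1), Pos A2 (- 1), Neg A1 1, Neg A3 1, Neg A4 1, Neg A2 (- 1), Neg A4 (- 1), Neg A3 (- 1), Neg A1 (- 1), Pos A2 (- 1), Pos A1 1, Pos A3 1, Pos A4 1, Neg A2 1, Pos A2 1, Pos A4 (- 1), Pos A3 (- 1), Pos A1 (- 1), Pos A2 (- 1), Pos A4 (- 1), Pos A3 (- 1), Pos A1 (- 1), Pos A2 (- 1), Pos A4 (- 1), Pos A3 (- 1), Pos A1 (- 1)],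
     [Pos A2 1, Pos A4 (- 1), Pos A3 (- 1), Pos A1 (- 1), Neg A1 1, Neg A3 1, Neg A4 1, Pos A2 1, Pos A4 (- 1), Pos A3 (- 1), Pos A1 (- 1), Pos A2 1],
     [Pos A1 1, Pos A3 1, Pos A4 1, Pos A2 (- 1), Pos A1 1, Pos A3 1, Pos A4 1, Pos A2 (- 1), Pos A1 1, Pos A3 1, Pos A4 1, Pos A2 1],
     [Pos A4 (- 1), Pos A3 (- 1), Pos A1 (- 1), Pos A2 1, Pos A4 (- 1), Pos A3 (- 1), Pos A1 (- 1), Pos A2 1, Pos A4 (- 1), Pos A3 (- 1), Pos A1 (- 1), Pos A2 (- 1)],
     [Pos A2 (- 1), Pos A1 1, Pos A3 1, Pos A4 1, Pos A2 1, Pos A1 1, Pos A3 1, Pos A4 1, Pos A2 1, Pos A1 1, Pos A3 1, Pos A4 1],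
     [Pos A1 1, Pos A3 1, Pos A4 1, Pos A2 (- 1), Pos A4 (- 1), Pos A3 (- 1), Pos A1 (- 1), Pos A2 1, Pos A4 (- 1), Pos A3 (- 1), Pos A1 (- 1), Pos A2 (- 1), Pos A1 1, Pos A3 1, Pos A4 1],
     [Pos A1 1, Pos A3 1, Pos A4 1, Pos A2 1, Pos A4 (- 1), Pos A3 (- 1), Pos A1 (- 1), Pos A2 (- 1), Pos A4 (- 1), Pos A3 (- 1), Pos A1 (- 1), Pos A2 1, Pos A1 1, Pos A3 1, Pos A4 1],
     [Pos A2 1, Pos A4 (- 1), Pos A3 (- 1), Pos A1 (- 1), Neg A1 1, Neg A3 1, Neg A4 1, Pos A2 1, Pos A4 (- 1), Pos A3 (- 1), Pos A1 (- 1), Neg A1 1, Neg A3 1, Neg A4 1, Neg A2 (- 1), Pos A2 (- 1), Pos A4 (- 1), Pos A3 (- 1), Pos A1 (- 1), Neg A2 (- 1)],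
     [Pos A2 (- 1), Pos A4 (- 1), Pos A3 (- 1), Pos A1 (- 1), Pos A2 (- 1), Neg A1 1, Neg A3 1, Neg A4 1, Pos A4 (- 1), Pos A3 (- 1), Pos A1 (- 1), Pos A2 1, Neg A1 1, Neg A3 1, Neg A4 1, Neg A2 (- 1), Pos A2 (- 1), Pos A4 (- 1), Pos A3 (- 1), Pos A1 (- 1), Neg A2 (- 1)]]"

definition stage_reps_f3_3 :: "(f3 vec \<times> f3 letter list \<times> f3 letter list) list" where
  "stage_reps_f3_3 = [(Vec 0 0 0 1 0 0 0 (- 1), [], [Pos A4 1, Neg A4 1, Neg A4 1, Pos A4 1]),
     (Vec 0 0 0 1 0 0 1 (- 1), [], [Neg A4 1, Neg A3 1, Neg A3 1, Pos A3 1, Pos A1 1]),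
     (Vec 0 0 0 1 0 0 (- 1) (- 1), [], [Neg A4 1, Neg A4 1, Neg A3 1, Pos A4 1]),
     (Vec 0 0 0 1 0 1 0 (- 1), [Neg A2 (- 1), Neg A1 1, Neg A3 1, Neg A4 1, Pos A1 1, Pos A3 1, Pos A4 1, Pos A2 (- 1), Neg A2 1, Neg A4 (- 1), Neg A3 (- 1), Neg A1 (- 1), Neg A2 1, Pos A2 (- 1), Neg A2 (- 1), Pos A2 (- 1), Pos A1 1, Pos A3 1, Pos A4 1, Pos A2 (- 1), Pos A4 (- 1), Pos A3 (- 1), Pos A1 (- 1), Pos A2 (- 1), Pos A1 1, Pos A3 1, Pos A4 1, Neg A2 1], [Pos A4 1, Neg A4 1, Neg A4 1, Pos A4 1, Pos A1 1, Pos A2 1, Pos A1 1, Pos A1 1]),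
     (Vec 0 0 0 (- 1) 0 0 0 1, [], [Pos A4 1, Neg A4 1, Neg A4 1, Pos A4 1]),
     (Vec 0 0 0 (- 1) 0 0 1 1, [], [Neg A4 1, Neg A4 1, Neg A3 1, Pos A4 1]),
     (Vec 0 0 0 (- 1) 0 0 (- 1) 1, [], [Neg A4 1, Neg A3 1, Neg A3 1, Pos A3 1, Pos A1 1]),
     (Vec 0 0 0 (- 1) 0 1 0 1, [Neg A2 (- 1), Neg A1 1, Neg A3 1, Neg A4 1, Pos A1 1, Pos A3 1, Pos A4 1, Pos A2 (- 1), Neg A2 1, Neg A4 (- 1), Neg A3 (- 1), Neg A1 (- 1), Neg A2 1, Pos A2 (- 1), Neg A2 (- 1), Pos A2 (- 1), Pos A1 1, Pos A3 1, Pos A4 1, Pos A2 (- 1), Pos A4 (- 1), Pos A3 (- 1), Pos A1 (- 1), Pos A2 (- 1), Pos A1 1, Pos A3 1, Pos A4 1, Neg A2 1], [Neg A4 1, Pos A4 1, Pos A4 1, Pos A1 1, Pos A2 1, Neg A4 1, Pos A1 1, Pos A1 1]),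
     (Vec 0 0 1 0 0 0 (- 1) 0, [], [Pos A3 1, Neg A3 1, Neg A3 1, Pos A3 1]),
     (Vec 0 0 1 0 0 1 (- 1) 0, [Neg A2 (- 1), Neg A1 1, Neg A3 1, Neg A4 1, Pos A1 1, Pos A3 1, Pos A4 1, Pos A2 (- 1), Neg A2 1, Neg A4 (- 1), Neg A3 (- 1), Neg A1 (- 1), Neg A2 1, Pos A2 (- 1), Neg A2 (- 1), Pos A2 (- 1), Pos A1 1, Pos A3 1, Pos A4 1, Pos A2 (- 1), Pos A4 (- 1), Pos A3 (- 1), Pos A1 (- 1), Pos A2 (- 1), Pos A1 1, Pos A3 1, Pos A4 1, Neg A2 1], [Pos A1 1, Pos A2 1, Pos A4 1, Pos A3 1, Pos A2 1, Pos A3 1, Neg A3 1]),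
     (Vec 0 0 1 1 0 0 1 1, [], [Neg A4 1, Pos A3 1, Neg A3 1, Pos A4 1]),
     (Vec 0 0 (- 1) 0 0 0 1 0, [], [Pos A3 1, Neg A3 1, Neg A3 1, Pos A3 1]),
     (Vec 0 0 (- 1) 0 0 1 1 0, [Pos A2 1, Neg A2 (- 1), Neg A1 1, Neg A3 1, Neg A4 1, Pos A1 1, Pos A3 1, Pos A4 1, Pos A2 (- 1), Neg A2 1, Neg A4 (- 1), Neg A3 (- 1), Neg A1 (- 1), Neg A2 1, Pos A2 (- 1), Neg A2 (- 1), Pos A2 (- 1), Pos A1 1, Pos A3 1, Pos A4 1, Pos A2 (- 1), Pos A4 (- 1), Pos A3 (- 1), Pos A1 (- 1), Pos A2 (- 1), Pos A1 1, Pos A3 1, Pos A4 1, Neg A2 1], [Pos A4 1, Pos A2 1, Pos A3 1, Pos A3 1, Neg A3 1, Pos A1 1])]"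

definition pair_tab_f3 :: "(f3 vec \<times> f3 letter list list \<times> (f3 vec \<times> f3 letter list \<times> f3 letter list) list) list" where
  "pair_tab_f3 = [(Vec 0 0 0 1 0 0 0 (- 1), stage_gens_f3_1, stage_reps_f3_1),
     (Vec 0 0 0 1 0 0 1 (- 1), stage_gens_f3_2, stage_reps_f3_2),
     (Vec 0 0 1 0 0 0 (- 1) 0, stage_gens_f3_3, stage_reps_f3_3)]"

lemma pair_lowered_f3_0: "slice (0 :: f3) (\<lambda>u. if nrm u = - 1 then lowered coords (map fst pair_reps_f3) pair_gens_f3 u else True)"
  by code_simp

lemma pair_lowered_f3_1: "slice (1 :: f3) (\<lambda>u. if nrm u = - 1 then lowered coords (map fst pair_reps_f3) pair_gens_f3 u else True)"
  by code_simp

lemma pair_lowered_f3_m: "slice (- 1 :: f3) (\<lambda>u. if nrm u = - 1 then lowered coords (map fst pair_reps_f3) pair_gens_f3 u else True)"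
  by code_simp

lemma stage_lowered_f3_1_0: "slice (0 :: f3) (\<lambda>u. if nrm u = - 1 then lowered coords (map fst stage_reps_f3_1) stage_gens_f3_1 u else True)"
  by code_simp

lemma stage_lowered_f3_1_1: "slice (1 :: f3) (\<lambda>u. if nrm u = - 1 then lowered coords (map fst stage_reps_f3_1) stage_gens_f3_1 u else True)"
  by code_simp

lemma stage_lowered_f3_1_m: "slice (- 1 :: f3) (\<lambda>u. if nrm u = - 1 then lowered coords (map fst stage_reps_f3_1) stage_gens_f3_1 u else True)"
  by code_simp

lemma stage_f3_1: "second_stage (Vec 0 0 0 1 0 0 0 (- 1)) stage_gens_f3_1 stage_reps_f3_1"
  unfolding second_stage_def
  by (intro conjI allv_slices stage_lowered_f3_1_0 stage_lowered_f3_1_1 stage_lowered_f3_1_m; code_simp)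

lemma stage_lowered_f3_2_0: "slice (0 :: f3) (\<lambda>u. if nrm u = - 1 then lowered coords (map fst stage_reps_f3_2) stage_gens_f3_2 u else True)"
  by code_simp

lemma stage_lowered_f3_2_1: "slice (1 :: f3) (\<lambda>u. if nrm u = - 1 then lowered coords (map fst stage_reps_f3_2) stage_gens_f3_2 u else True)"
  by code_simp

lemma stage_lowered_f3_2_m: "slice (- 1 :: f3) (\<lambda>u. if nrm u = - 1 then lowered coords (map fst stage_reps_f3_2) stage_gens_f3_2 u else True)"
  by code_simp

lemma stage_f3_2: "second_stage (Vec 0 0 0 1 0 0 1 (- 1)) stage_gens_f3_2 stage_reps_f3_2"
  unfolding second_stage_def
  by (intro conjI allv_slices stage_lowered_f3_2_0 stage_lowered_f3_2_1 stage_lowered_f3_2_m; code_simp)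

lemma stage_lowered_f3_3_0: "slice (0 :: f3) (\<lambda>u. if nrm u = - 1 then lowered coords (map fst stage_reps_f3_3) stage_gens_f3_3 u else True)"
  by code_simp

lemma stage_lowered_f3_3_1: "slice (1 :: f3) (\<lambda>u. if nrm u = - 1 then lowered coords (map fst stage_reps_f3_3) stage_gens_f3_3 u else True)"
  by code_simp

lemma stage_lowered_f3_3_m: "slice (- 1 :: f3) (\<lambda>u. if nrm u = - 1 then lowered coords (map fst stage_reps_f3_3) stage_gens_f3_3 u else True)"
  by code_simp

lemma stage_f3_3: "second_stage (Vec 0 0 1 0 0 0 (- 1) 0) stage_gens_f3_3 stage_reps_f3_3"
  unfolding second_stage_def
  by (intro conjI allv_slices stage_lowered_f3_3_0 stage_lowered_f3_3_1 stage_lowered_f3_3_m; code_simp)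

lemma pair_certificate_f3: "pair_certificate pair_reps_f3 pair_gens_f3 pair_tab_f3"
  unfolding pair_certificate_def
proof (intro conjI)
  show "allv (\<lambda>u. if nrm u = - 1 then lowered coords (map fst pair_reps_f3) pair_gens_f3 u else True)"
    by (rule allv_slices[OF pair_lowered_f3_0 pair_lowered_f3_1 pair_lowered_f3_m])
  show "list_all sym_word pair_gens_f3" by code_simp
  show "list_all (\<lambda>(u, c). sym_word c \<and> list_ex (\<lambda>(r, _). pm (run c u) r) pair_tab_f3) pair_reps_f3" by code_simp
  show "list_all (\<lambda>(r, gs, cs). second_stage r gs cs) pair_tab_f3"
    unfolding pair_tab_f3_def by (simp only: list.pred_inject prod.case simp_thms
      stage_f3_1 stage_f3_2 stage_f3_3)
qed

lemma pair_reducible_f3: "nrm u = - 1 \<Longrightarrow> nrm v = - 1 \<Longrightarrow> pair_reducible u (v :: f3 vec)"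
  by (rule pair_certificate_reducible[OF pair_certificate_f3])

section \<open>The exponent of the parabolic subgroup of the central node\<close>

lemma rank_one_word:
  fixes w :: "'a::comm_ring_1 letter list"
  assumes "\<forall>l\<in>set w. lnode l = A1"
  shows "\<exists>\<alpha> \<beta> \<gamma> \<delta>. \<alpha> * \<delta> - \<beta> * \<gamma> = 1 \<and> (\<forall>a b c d e f g h. run w (Vec a b c d e f g h) =
    Vec (\<alpha> * a + \<beta> * b) (\<gamma> * a + \<delta> * b) c d (\<delta> * e - \<gamma> * f) (\<alpha> * f - \<beta> * e) g h)"
  using assms
proof (induction w)
  case Nil
  show ?case by (intro exI[of _ 1] exI[of _ 0]) (simp; rule exI[of _ 1]; simp)
next
  case (Cons l w)
  then obtain \<alpha> \<beta> \<gamma> \<delta> where 1: "\<alpha> * \<delta> - \<beta> * \<gamma> = 1" and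
    r: "\<And>a b c d e f g h. run w (Vec a b c d e f g h) =
    Vec (\<alpha> * a + \<beta> * b) (\<gamma> * a + \<delta> * b) c d (\<delta> * e - \<gamma> * f) (\<alpha> * f - \<beta> * e) g h" by auto
  show ?case
  proof (cases l)
    case (Pos k t)
    then have "k = A1" using Cons.prems by simp
    then show ?thesis using Pos 1
      by (intro exI[of _ "\<alpha> + t * \<gamma>"] exI[of _ "\<beta> + t * \<delta>"] exI[of _ \<gamma>] exI[of _ \<delta>]) (simp add: r algebra_simps)
  next
    case (Neg k t)
    then have "k = A1" using Cons.prems by simp
    then show ?thesis using Neg 1
      by (intro exI[of _ \<alpha>] exI[of _ \<beta>] exI[of _ "\<gamma> + t * \<alpha>"] exI[of _ "\<delta> + t * \<beta>"]) (simp add: r algebra_simps)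
  qed
qed

text \<open>The coefficient t is the trace of a matrix of determinant 1. For t = 0, 1, -1 the
  sequence has period 4, 6, 3, and 12 is the least common multiple.\<close>

lemma recurrence_period_12:
  fixes h :: "nat \<Rightarrow> 'a::small_field vec"
  assumes r: "\<And>k. h (Suc (Suc k)) = scale t (h (Suc k)) - h k"
  shows "h 12 = h 0"
proof -
  have n: "12 = Suc (Suc (Suc (Suc (Suc (Suc (Suc (Suc (Suc (Suc (Suc (Suc 0)))))))))))" by simp
  from small[of t] show ?thesis unfolding n by (elim disjE) (simp_all add: r)
qed

text \<open>On its two natural modules a word in one node acts by a matrix of determinant 1 over a field
  with at most three elements, so Cayley-Hamilton bounds its order by 12.\<close>

lemma rank_one_word_order:
  fixes w :: "'a::small_field letter list"
  assumes "\<forall>l\<in>set w. lnode l = A1"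
  shows "(run w ^^ 12) x = x"
proof -
  obtain \<alpha> \<beta> \<gamma> \<delta> where d: "\<alpha> * \<delta> - \<beta> * \<gamma> = 1" and
    r: "\<And>a b c d e f g h. run w (Vec a b c d e f g h) =
    Vec (\<alpha> * a + \<beta> * b) (\<gamma> * a + \<delta> * b) c d (\<delta> * e - \<gamma> * f) (\<alpha> * f - \<beta> * e) g h"
    using rank_one_word[OF assms] by auto
  obtain a b c d' e f g h where x: "x = Vec a b c d' e f g h" by (cases x)
  let ?y = "Vec a b 0 0 e f 0 0" and ?z = "Vec 0 0 c d' 0 0 g h"
  have z: "(run w ^^ k) ?z = ?z" for k by (induction k) (simp_all add: r)
  have add: "(run w ^^ k) (u + v) = (run w ^^ k) u + (run w ^^ k) v" for k u v
    by (induction k) (simp_all add: run_add)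
  have y: "\<exists>a b e f. (run w ^^ k) ?y = Vec a b 0 0 e f 0 0" for k
  proof (induction k)
    case (Suc k)
    then obtain a' b' e' f' where "(run w ^^ k) ?y = Vec a' b' 0 0 e' f' 0 0" by blast
    then show ?case by (simp add: r)
  qed simp
  have d': "\<beta> * \<gamma> = \<alpha> * \<delta> - 1" using d by (simp add: algebra_simps)
  have ch: "run w (run w (Vec a b 0 0 e f 0 0)) = scale (\<alpha> + \<delta>) (run w (Vec a b 0 0 e f 0 0)) - Vec a b 0 0 e f 0 0"
    for a b e f
  proof -
    have q: "s + \<beta> * (\<gamma> * s) = \<alpha> * (\<delta> * s)" for s
      using arg_cong[OF d', of "\<lambda>u. u * s"] by (simp add: algebra_simps)
    show ?thesis by (simp add: r q algebra_simps)
  qed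
  have "(run w ^^ 12) ?y = (run w ^^ 0) ?y"
  proof (rule recurrence_period_12[of _ "\<alpha> + \<delta>"])
    fix k
    obtain a' b' e' f' where "(run w ^^ k) ?y = Vec a' b' 0 0 e' f' 0 0" using y by blast
    then show "(run w ^^ Suc (Suc k)) ?y = scale (\<alpha> + \<delta>) ((run w ^^ Suc k) ?y) - (run w ^^ k) ?y"
      using ch by simp
  qed
  then show ?thesis using add[of 12 ?y ?z] z[of 12] by (simp add: x)
qed

text \<open>The filtration of the module that a parabolic word respects; the word and the word with its
  letters at the central node deleted act in the same way on the successive quotients.\<close>

fun lev1 lev2 :: "'a::zero vec \<Rightarrow> bool" where
  "lev1 (Vec a b c d e f g h) \<longleftrightarrow> c = 0 \<and> d = 0 \<and> e = 0 \<and> f = 0 \<and> g = 0 \<and> h = 0"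
| "lev2 (Vec a b c d e f g h) \<longleftrightarrow> e = 0 \<and> f = 0"

definition levi :: "'a letter list \<Rightarrow> 'a letter list" where "levi = filter (\<lambda>l. lnode l \<noteq> A2)"

lemma lev_add: "lev1 x \<Longrightarrow> lev1 y \<Longrightarrow> lev1 (x + y)" "lev2 x \<Longrightarrow> lev2 y \<Longrightarrow> lev2 (x + y)"
  for x y :: "'a::comm_ring_1 vec"
  by (cases x; cases y; simp)+

lemma parab_Cons: "parab (l # w) \<longleftrightarrow> parab_letter l \<and> parab w" by (simp add: parab_def)

lemma step_lev:
  assumes "parab_letter l"
  shows "lev1 x \<Longrightarrow> lev1 (step l x)" "lev2 x \<Longrightarrow> lev2 (step l x)"
proof -
  show "lev1 x \<Longrightarrow> lev1 (step l x)"
  proof (cases l)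
    case (Pos k t) then show "lev1 x \<Longrightarrow> lev1 (step l x)" by (cases k; cases x) auto
  next
    case (Neg k t) then show "lev1 x \<Longrightarrow> lev1 (step l x)" using assms by (cases k; cases x) auto
  qed
  show "lev2 x \<Longrightarrow> lev2 (step l x)"
  proof (cases l)
    case (Pos k t) then show "lev2 x \<Longrightarrow> lev2 (step l x)" by (cases k; cases x) auto
  next
    case (Neg k t) then show "lev2 x \<Longrightarrow> lev2 (step l x)" using assms by (cases k; cases x) auto
  qed
qed

lemma step_central_lev:
  "lev2 (step (Pos A2 t) x - x)" "lev2 x \<Longrightarrow> lev1 (step (Pos A2 t) x - x)"
  "lev1 x \<Longrightarrow> step (Pos A2 t) x = x"
  by (cases x; simp)+

lemma run_lev:
  assumes "parab w"
  shows "lev1 x \<Longrightarrow> lev1 (run w x)" "lev2 x \<Longrightarrow> lev2 (run w x)"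
  using assms by (induction w) (auto simp: parab_Cons step_lev)

lemma run_levi:
  assumes "parab w"
  shows "lev2 (run w x - run (levi w) x)" "lev2 x \<Longrightarrow> lev1 (run w x - run (levi w) x)"
    "lev1 x \<Longrightarrow> run w x = run (levi w) x"
proof -
  have "lev2 (run w x - run (levi w) x) \<and> (lev2 x \<longrightarrow> lev1 (run w x - run (levi w) x)) \<and>
    (lev1 x \<longrightarrow> run w x = run (levi w) x)"
    using assms
  proof (induction w)
    case Nil
    have "lev2 (0 :: 'a vec)" "lev1 (0 :: 'a vec)" by (simp_all add: zero_vec_def)
    then show ?case by (simp add: levi_def)
  next
    case (Cons l w)
    then have pl: "parab_letter l" and pw: "parab w" by (auto simp: parab_Cons)
    note IH = Cons.IH[OF pw]
    show ?case
    proof (cases "lnode l = A2")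
      case False
      then have "levi (l # w) = l # levi w" by (simp add: levi_def)
      then show ?thesis using IH step_lev[OF pl] by (simp add: step_add[symmetric] run_diff[of "[l]", simplified, symmetric])
    next
      case True
      then obtain t where l: "l = Pos A2 t" using pl by (cases l) auto
      have lv: "levi (l # w) = levi w" by (simp add: levi_def l)
      have sp: "step l (run w x) - run (levi w) x = (step l (run w x) - run w x) + (run w x - run (levi w) x)" by simp
      have "lev2 (step l (run w x) - run (levi w) x)"
        unfolding sp using IH step_central_lev(1)[of t] l by (intro lev_add) auto
      moreover have "lev1 (step l (run w x) - run (levi w) x)" if "lev2 x"
        unfolding sp using IH that step_central_lev(2)[OF run_lev(2)[OF pw that], of t] l by (intro lev_add) auto
      moreover have "step l (run w x) = run (levi w) x" if "lev1 x"
        using IH that step_central_lev(3) run_lev(1)[OF pw that] l by auto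
      ultimately show ?thesis by (simp add: lv)
    qed
  qed
  then show "lev2 (run w x - run (levi w) x)" "lev2 x \<Longrightarrow> lev1 (run w x - run (levi w) x)"
    "lev1 x \<Longrightarrow> run w x = run (levi w) x" by auto
qed

lemma small_field_six: "(6 :: 'a::small_field) = 0"
proof -
  have "(2 :: 'a) = 0 \<or> (3 :: 'a) = 0"
  proof (rule disjE[OF small[of "2 :: 'a"]])
    assume "(2 :: 'a) = 1 \<or> (2 :: 'a) = - 1"
    then show ?thesis
    proof
      assume "(2 :: 'a) = 1"
      then have "(2 :: 'a) - 1 = 1 - 1" by (rule arg_cong)
      then show ?thesis by simp
    next
      assume "(2 :: 'a) = - 1"
      then have "(2 :: 'a) + 1 = - 1 + 1" by (rule arg_cong)
      then show ?thesis by simp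
    qed
  qed simp
  moreover have "(6 :: 'a) = 2 * 3" by simp
  ultimately show ?thesis by (metis mult_zero_left mult_zero_right)
qed

lemma parab_wpow: "parab w \<Longrightarrow> parab (wpow w n)"
  by (induction n) (auto simp: parab_def)

lemma levi_wpow: "levi (wpow w n) = wpow (levi w) n"
  by (induction n) (auto simp: levi_def)

text \<open>If the Levi part acts trivially, then the word acts as 1 + D with D nilpotent of degree 3,
  so that k and the binomial coefficient k choose 2 are the only obstructions.\<close>

lemma parab_unipotent_pow:
  fixes w :: "'a::comm_ring_1 letter list"
  assumes p: "parab w" and lv: "\<And>x. run (levi w) x = x"
    and k: "of_nat k = (0 :: 'a)" "of_nat (k choose 2) = (0 :: 'a)"
  shows "(run w ^^ k) x = x"
proof -
  define D where "D y = run w y - y" for y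
  have f: "run w y = y + D y" for y by (simp add: D_def)
  have Dadd: "D (y + z) = D y + D z" for y z by (simp add: D_def run_add)
  have D3: "D (D (D y)) = 0" for y
  proof -
    have "lev2 (D y)" "lev1 (D (D y))" using run_levi[OF p] lv unfolding D_def by metis+
    then show ?thesis using run_levi(3)[OF p] lv unfolding D_def by simp
  qed
  have Dscale: "D (scale s y) = scale s (D y)" for s y
    by (simp add: D_def run_scale diff_conv_add_uminus scale_add del: add_uminus_conv_diff)
  have "(run w ^^ k) x = x + scale (of_nat k) (D x) + scale (of_nat (k choose 2)) (D (D x))" for k
  proof (induction k)
    case (Suc k)
    have "Suc k choose 2 = k + (k choose 2)" by (simp add: numeral_2_eq_2)
    then show ?case using Suc
      by (simp add: f Dadd Dscale D3 scale_add_left algebra_simps)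
  qed (simp add: numeral_2_eq_2)
  then show ?thesis by (simp add: k)
qed

text \<open>The exponent 12 works in both characteristics because 12 and the binomial coefficient 66
  are both multiples of 6.\<close>

lemma parab_unipotent:
  fixes w :: "'a::small_field letter list"
  assumes "parab w" "\<And>x. run (levi w) x = x"
  shows "(run w ^^ 12) x = x"
proof (rule parab_unipotent_pow[OF assms])
  have "of_nat 12 = (2 * 6 :: 'a)" by simp
  then show "of_nat 12 = (0 :: 'a)" unfolding small_field_six by simp
  have "of_nat 66 = (11 * 6 :: 'a)" by simp
  then have "of_nat 66 = (0 :: 'a)" unfolding small_field_six by simp
  moreover have "(12 :: nat) choose 2 = 66" by (simp add: numeral_eq_Suc)
  ultimately show "of_nat (12 choose 2) = (0 :: 'a)" by simp
qed

lemma step_commute: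
  assumes "lnode l \<noteq> lnode m" "lnode l \<noteq> A2" "lnode m \<noteq> A2"
  shows "step l (step m x) = step m (step l x)"
proof (cases l)
  case (Pos k t)
  show ?thesis
  proof (cases m)
    case (Pos j s) then show ?thesis using \<open>l = Pos k t\<close> assms by (cases k; cases j; cases x) (auto simp: algebra_simps)
  next
    case (Neg j s) then show ?thesis using \<open>l = Pos k t\<close> assms by (cases k; cases j; cases x) (auto simp: algebra_simps)
  qed
next
  case (Neg k t)
  show ?thesis
  proof (cases m)
    case (Pos j s) then show ?thesis using \<open>l = Neg k t\<close> assms by (cases k; cases j; cases x) (auto simp: algebra_simps)
  next
    case (Neg j s) then show ?thesis using \<open>l = Neg k t\<close> assms by (cases k; cases j; cases x) (auto simp: algebra_simps)
  qed
qed

definition at_node :: "node \<Rightarrow> 'a letter list \<Rightarrow> 'a letter list" where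
  "at_node k = filter (\<lambda>l. lnode l = k)"

lemma run_commute:
  assumes "\<forall>l\<in>set u. lnode l \<noteq> k" "k \<noteq> A2" "\<forall>l\<in>set u. lnode l \<noteq> A2" "lnode m = k"
  shows "step m (run u x) = run u (step m x)"
  using assms by (induction u) (auto simp: step_commute)

text \<open>The nodes \<open>A1\<close>, \<open>A3\<close>, \<open>A4\<close> are mutually
  orthogonal in the diagram, so the letters away from the central node generate three commuting
  groups of rank one and can be sorted by node.\<close>

lemma run_levi_split:
  assumes "\<forall>l\<in>set w. lnode l \<noteq> A2"
  shows "run w x = run (at_node A1 w) (run (at_node A3 w) (run (at_node A4 w) x))"
  using assms
proof (induction w)
  case (Cons l w)
  then have IH: "run w x = run (at_node A1 w) (run (at_node A3 w) (run (at_node A4 w) x))" by auto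
  have c: "step l (run (at_node k w) y) = run (at_node k w) (step l y)" if "lnode l \<noteq> k" "k \<noteq> A2" for k y
    using Cons.prems that by (intro run_commute[of _ "lnode l"]) (auto simp: at_node_def)
  have "lnode l = A1 \<or> lnode l = A3 \<or> lnode l = A4" using Cons.prems by (cases "lnode l") auto
  then show ?case
    by (elim disjE) (simp_all add: IH c, simp_all add: at_node_def)
qed (simp add: at_node_def)

lemma at_node_wpow: "at_node k (wpow w n) = wpow (at_node k w) n"
  by (induction n) (auto simp: at_node_def)

context triality_action begin

lemma pi_wpow: "\<pi> (wpow w n) = \<pi> w [^] n"
proof (induction n)
  case (Suc n) then show ?case using nat_pow_Suc2[OF pi_closed[of w], of n] by (simp add: pi_append)
qed simp

lemma pi_shift: "\<pi> (shift w) = r \<otimes> \<pi> w \<otimes> inv r"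
  by (simp add: r_pi m_assoc)

lemma pi_shift_one: "\<pi> w = \<one> \<Longrightarrow> \<pi> (shift w) = \<one>"
  by (simp add: pi_shift)

text \<open>The matrix computation \<open>rank_one_word_order\<close> is made only for the node
  \<open>A1\<close>; conjugation by r transfers it to the other two outer nodes.\<close>

lemma pi_at_node: "k \<noteq> A2 \<Longrightarrow> \<pi> (wpow (at_node k w) 12) = \<one>"
proof -
  have 1: "\<pi> (wpow u 12) = \<one>" if "\<forall>l\<in>set u. lnode l = A1" for u
    using rank_one_word_order[OF that] by (simp add: pi_one_iff triv_def run_wpow)
  have node: "lnode (shl l) = tri (lnode l)" for l :: "'f letter" by (cases l) auto
  have 2: "\<pi> (wpow u 12) = \<one>" if "\<forall>l\<in>set u. lnode l = A3" for u
  proof -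
    have "\<forall>l\<in>set (shift (shift u)). lnode l = A1" using that by (auto simp: shift_def node)
    then have "\<pi> (wpow (shift (shift u)) 12) = \<one>" by (rule 1)
    from pi_shift_one[OF this] show ?thesis by (simp add: shift_wpow)
  qed
  have 3: "\<pi> (wpow u 12) = \<one>" if "\<forall>l\<in>set u. lnode l = A4" for u
  proof -
    have "\<forall>l\<in>set (shift u). lnode l = A1" using that by (auto simp: shift_def node)
    then have "\<pi> (wpow (shift u) 12) = \<one>" by (rule 1)
    from pi_shift_one[OF pi_shift_one[OF this]] show ?thesis by (simp add: shift_wpow)
  qed
  assume "k \<noteq> A2"
  then show ?thesis by (cases k) (simp_all add: 1 2 3 at_node_def)
qed

lemma parab_exponent:
  assumes "parab w"
  shows "\<pi> w [^] (288::nat) = \<one>"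
proof -
  let ?n = "wpow (levi w) 12"
  have l: "\<forall>l\<in>set ?n. lnode l \<noteq> A2"
  proof -
    have "set (wpow u n) \<subseteq> set u" for u :: "'f letter list" and n by (induction n) auto
    then have "set ?n \<subseteq> set (levi w)" .
    then show ?thesis by (auto simp: levi_def)
  qed
  have "\<pi> ?n = \<pi> (at_node A1 ?n @ at_node A3 ?n @ at_node A4 ?n)"
    by (rule pi_cong) (simp add: run_levi_split[OF l])
  also have "\<dots> = \<one>" by (simp add: pi_append at_node_wpow pi_at_node)
  finally have t: "triv ?n" by (simp add: pi_one_iff)
  \<comment> \<open>After 12 steps the Levi part is known only to be 1 or -1, as that is all
    \<open>\<pi>\<close> sees. Doubling to 24 removes the sign, and the unipotent exponent 12 then
    gives 288 = 24 * 12.\<close>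
  have tt: "run (levi (wpow w 24)) x = x" for x
  proof -
    have "run (levi (wpow w 24)) x = (run (levi w) ^^ (12 + 12)) x" by (simp add: levi_wpow run_wpow)
    also have "\<dots> = run ?n (run ?n x)" unfolding funpow_add by (simp add: run_wpow)
    also have "\<dots> = x" using t unfolding triv_def by (metis run_uminus minus_minus)
    finally show ?thesis .
  qed
  have "\<pi> (wpow (wpow w 24) 12) = \<one>"
    using parab_unipotent[OF parab_wpow[OF assms] tt] by (simp add: pi_one_iff triv_def run_wpow)
  then show ?thesis by (simp add: pi_wpow nat_pow_pow)
qed

end

lemma shl_parab: "parab_letter (shl l) = parab_letter l"
proof (cases l)
  case (Pos k t) then show ?thesis by (cases k) auto
next
  case (Neg k t) then show ?thesis by (cases k) auto
qed

lemma linv_parab: "parab_letter (linv l) = parab_letter l"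
proof (cases l)
  case (Pos k t) then show ?thesis by (cases k) auto
next
  case (Neg k t) then show ?thesis by (cases k) auto
qed

lemma parab_closed:
  "parab u \<Longrightarrow> parab w \<Longrightarrow> parab (u @ w)" "parab w \<Longrightarrow> parab (shift w)"
  by (auto simp: parab_def shift_def list_all_iff shl_parab)

lemma parab_winv: "parab w \<Longrightarrow> parab (winv w)"
  by (auto simp: parab_def winv_def list_all_iff linv_parab)

lemma parab_shift_funpow: "parab w \<Longrightarrow> parab ((shift ^^ i) w)"
  by (induction i) (auto simp: parab_closed)

lemma shift_funpow_3: "(shift ^^ (3 * i)) w = w"
proof -
  have "(shift ^^ 3) = (\<lambda>w :: 'a letter list. w)" by (rule ext) (simp add: numeral_3_eq_3)
  then show ?thesis unfolding funpow_mult[symmetric] by (induction i) auto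
qed

context triality_action begin

abbreviation rr :: "nat \<Rightarrow> 'g" where "rr i \<equiv> r [^] i"

lemma r_pow_3: "rr (3 * i) = \<one>"
proof -
  have "rr 3 = \<one>" using r_cube by (simp add: numeral_3_eq_3)
  then show ?thesis by (simp add: nat_pow_pow[symmetric])
qed

lemma elem_mult: "(\<pi> u \<otimes> rr i) \<otimes> (\<pi> w \<otimes> rr j) = \<pi> (u @ (shift ^^ i) w) \<otimes> rr (i + j)"
proof -
  have "(\<pi> u \<otimes> rr i) \<otimes> (\<pi> w \<otimes> rr j) = \<pi> u \<otimes> (rr i \<otimes> \<pi> w) \<otimes> rr j" by (simp add: m_assoc)
  also have "\<dots> = \<pi> u \<otimes> \<pi> ((shift ^^ i) w) \<otimes> (rr i \<otimes> rr j)" by (simp add: r_pow_pi m_assoc)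
  finally show ?thesis by (simp add: pi_append nat_pow_mult)
qed

lemma elem_inv: "inv (\<pi> w \<otimes> rr i) = \<pi> ((shift ^^ (2 * i)) (winv w)) \<otimes> rr (2 * i)"
proof -
  have "(\<pi> ((shift ^^ (2 * i)) (winv w)) \<otimes> rr (2 * i)) \<otimes> (\<pi> w \<otimes> rr i)
    = rr (2 * i) \<otimes> (\<pi> (winv w) \<otimes> \<pi> w) \<otimes> rr i"
    by (simp add: r_pow_pi[symmetric] m_assoc)
  also have "\<dots> = rr (3 * i)" by (simp add: pi_winv nat_pow_mult)
  also have "\<dots> = \<one>" by (rule r_pow_3)
  finally show ?thesis by (simp add: inv_equality)
qed

lemma word_subgroup:
  assumes one: "Q []" and app: "\<And>u w. Q u \<Longrightarrow> Q w \<Longrightarrow> Q (u @ w)" and sh: "\<And>w. Q w \<Longrightarrow> Q (shift w)"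
    and wi: "\<And>w. Q w \<Longrightarrow> Q (winv w)"
  shows "subgroup {\<pi> w \<otimes> rr i | w i. Q w} A"
proof (rule subgroupI)
  have shn: "Q ((shift ^^ i) w)" if "Q w" for w i using that sh by (induction i) auto
  show "{\<pi> w \<otimes> rr i | w i. Q w} \<subseteq> carrier A" by auto
  show "{\<pi> w \<otimes> rr i | w i. Q w} \<noteq> {}" using one by blast
  show "inv a \<in> {\<pi> w \<otimes> rr i | w i. Q w}" if "a \<in> {\<pi> w \<otimes> rr i | w i. Q w}" for a
    using that shn wi elem_inv by blast
  show "a \<otimes> b \<in> {\<pi> w \<otimes> rr i | w i. Q w}"
    if "a \<in> {\<pi> w \<otimes> rr i | w i. Q w}" "b \<in> {\<pi> w \<otimes> rr i | w i. Q w}" for a b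
    using that shn app elem_mult by blast
qed

lemma parab_subgroup: "subgroup {\<pi> w \<otimes> rr i | w i. parab w} A"
  by (rule word_subgroup) (auto simp: parab_closed parab_winv, simp add: parab_def)

lemma elem_cube: "(\<pi> w \<otimes> rr i) [^] (3::nat) = \<pi> (w @ (shift ^^ i) w @ (shift ^^ (2 * i)) w)"
proof -
  have "(\<pi> w \<otimes> rr i) [^] (3::nat) = (\<pi> w \<otimes> rr i) \<otimes> (\<pi> w \<otimes> rr i) \<otimes> (\<pi> w \<otimes> rr i)"
    by (simp add: numeral_3_eq_3)
  also have "\<dots> = \<pi> ((w @ (shift ^^ i) w) @ (shift ^^ (i + i)) w) \<otimes> rr (i + i + i)"
    unfolding elem_mult ..
  also have "i + i + i = 3 * i" by simp
  finally show ?thesis using r_pow_3 by (simp add: mult_2)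
qed

text \<open>The cube of an element of the extension by r is again given by a parabolic word, whence
  864 = 3 * 288.\<close>

lemma parab_elem_exponent:
  assumes "parab w"
  shows "(\<pi> w \<otimes> rr i) [^] (864::nat) = \<one>"
proof -
  have "(\<pi> w \<otimes> rr i) [^] (3 * 288 :: nat) = \<one>"
    unfolding nat_pow_pow[symmetric, OF m_closed[OF pi_closed nat_pow_closed[OF r_closed]]] elem_cube
    using assms by (intro parab_exponent) (simp add: parab_closed parab_shift_funpow)
  then show ?thesis by simp
qed

lemma commutes_if_triv: "triv (winv w @ shift w) \<Longrightarrow> r \<otimes> \<pi> w = \<pi> w \<otimes> r"
  using pi_eqI[of w "shift w"] r_pi[of w] by simp

lemma conj_commuting: "z \<in> carrier A \<Longrightarrow> r \<otimes> z = z \<otimes> r \<Longrightarrow> conjg A r z = r"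
  by (simp add: conjg_def m_assoc inv_solve_left')

text \<open>Reducibility writes g as c^{-1} h w with c and w commuting with r. The factor c
  disappears from the conjugate of r by g, and w also fixes r, so w carries r and its conjugate by h
  to r and its conjugate by g at the same time; it serves as the witness z.\<close>

lemma conj_r_parab:
  assumes pr: "\<And>u v :: 'f vec. nrm u = - 1 \<Longrightarrow> nrm v = - 1 \<Longrightarrow> pair_reducible u v"
  shows "\<exists>z h. parab h \<and> conjg A r (\<pi> z) = r \<and> conjg A r (\<pi> g) = conjg A (conjg A r (\<pi> h)) (\<pi> z)"
proof -
  have "nrm (run g unit_vec) = (- 1 :: 'f)" "nrm (run (shift g) unit_vec) = (- 1 :: 'f)"
    by (simp_all add: nrm_run unit_vec_def)
  then obtain c h where ch: "sym_word c" "parab h" "pm (run c (run g unit_vec)) (run h unit_vec)"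
     "pm (run (shift c) (run (shift g) unit_vec)) (run (shift h) unit_vec)"
    using pr unfolding pair_reducible_def by blast
  let ?w = "winv h @ c @ g"
  have 1: "pm (run ?w unit_vec) unit_vec" using pm_run[OF ch(3), of "winv h"] by simp
  have 2: "pm (run (shift ?w) unit_vec) unit_vec"
    using pm_run[OF ch(4), of "winv (shift h)"] by (simp add: shift_winv)
  have w: "r \<otimes> \<pi> ?w = \<pi> ?w \<otimes> r" using stabilizer_sym[OF 1 2] by (rule commutes_if_triv)
  have "\<pi> (shift c) = \<pi> c" using ch(1) by (intro pi_cong) (simp add: sym_word_run)
  then have c: "r \<otimes> \<pi> c = \<pi> c \<otimes> r" by (simp add: r_pi)
  have c': "conjg A r (\<pi> (winv c)) = r"
  proof -
    have "inv (\<pi> c) \<otimes> r = inv (\<pi> c) \<otimes> (r \<otimes> \<pi> c) \<otimes> inv (\<pi> c)" by (simp add: m_assoc)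
    also have "\<dots> = inv (\<pi> c) \<otimes> (\<pi> c \<otimes> r) \<otimes> inv (\<pi> c)" unfolding c ..
    also have "\<dots> = r \<otimes> inv (\<pi> c)" by (simp add: m_assoc[symmetric])
    finally have "r \<otimes> inv (\<pi> c) = inv (\<pi> c) \<otimes> r" ..
    then show ?thesis unfolding pi_winv by (intro conj_commuting) simp_all
  qed
  have g: "\<pi> g = \<pi> (winv c) \<otimes> (\<pi> h \<otimes> \<pi> ?w)"
    by (simp add: pi_append pi_winv m_assoc) (simp add: m_assoc[symmetric])
  have "conjg A r (\<pi> g) = conjg A (conjg A (conjg A r (\<pi> (winv c))) (\<pi> h)) (\<pi> ?w)"
    unfolding g by (simp add: conjg_conjg conjg_in_carrier[OF is_group] m_assoc)
  then have "conjg A r (\<pi> g) = conjg A (conjg A r (\<pi> h)) (\<pi> ?w)" unfolding c' .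
  then show ?thesis using ch(2) conj_commuting[OF pi_closed w] by blast
qed

lemma conj_pow: "\<lbrakk>x \<in> carrier A; y \<in> carrier A\<rbrakk> \<Longrightarrow> conjg A x y [^] (n::nat) = conjg A (x [^] n) y"
proof (induction n)
  case 0 then show ?case by (simp add: conjg_def)
next
  case (Suc n)
  then show ?case by (simp add: conjg_def m_assoc) (simp add: m_assoc[symmetric])
qed

text \<open>By \<open>conj_r_parab\<close> the two conjugates are simultaneously conjugate to r and
  its conjugate by a parabolic word, both of which lie in the extension of the parabolic subgroup by
  r. Powers can be taken there and carried back.\<close>

lemma pair_exponent:
  assumes pr: "\<And>u v :: 'f vec. nrm u = - 1 \<Longrightarrow> nrm v = - 1 \<Longrightarrow> pair_reducible u v"
    and x: "x \<in> generate A {conjg A r (\<pi> g1), conjg A r (\<pi> g2)}"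
  shows "x [^] (864::nat) = \<one>"
proof -
  note cc = conjg_in_carrier[OF is_group]
  obtain z h where zh: "parab h" "conjg A r (\<pi> z) = r"
    "conjg A r (\<pi> (g2 @ winv g1)) = conjg A (conjg A r (\<pi> h)) (\<pi> z)"
    using conj_r_parab[OF pr, of "g2 @ winv g1"] by blast
  let ?y = "\<pi> z \<otimes> \<pi> g1"
  have y: "?y \<in> carrier A" by simp
  have "conjg A r (\<pi> g1) = conjg A r ?y"
    using zh(2) conjg_conjg[of r "\<pi> z" "\<pi> g1"] by simp
  moreover have "conjg A r (\<pi> g2) = conjg A (conjg A r (\<pi> h)) ?y"
  proof -
    have "\<pi> g2 = \<pi> (g2 @ winv g1) \<otimes> \<pi> g1" by (simp add: pi_append pi_winv m_assoc)
    then have "conjg A r (\<pi> g2) = conjg A (conjg A r (\<pi> (g2 @ winv g1))) (\<pi> g1)"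
      by (simp add: conjg_conjg)
    then show ?thesis unfolding zh(3) by (simp add: conjg_conjg cc m_assoc)
  qed
  ultimately have x': "x \<in> generate A {conjg A r ?y, conjg A (conjg A r (\<pi> h)) ?y}" using x by simp
  have bk: "conjg A (conjg A m ?y) (inv ?y) = m" if "m \<in> carrier A" for m
    using that by (simp add: conjg_conjg y) (simp add: conjg_def)
  have P: "subgroup {\<pi> w \<otimes> rr i | w i. parab w} A" by (rule parab_subgroup)
  have "r = \<pi> [] \<otimes> rr 1" "parab ([] :: 'f letter list)" by (simp_all add: parab_def)
  then have r1: "r \<in> {\<pi> w \<otimes> rr i | w i. parab w}" by blast
  have "conjg A r (\<pi> h) = \<pi> (winv h @ [] @ shift h) \<otimes> rr 1"
    using conjg_r[of "[]" h] by simp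
  then have r2: "conjg A r (\<pi> h) \<in> {\<pi> w \<otimes> rr i | w i. parab w}"
    using parab_closed(1)[OF parab_winv[OF zh(1)] parab_closed(2)[OF zh(1)]] unfolding append_Nil by blast
  have "conjg A x (inv ?y) \<in> generate A ((\<lambda>x. conjg A x (inv ?y)) ` {conjg A r ?y, conjg A (conjg A r (\<pi> h)) ?y})"
    by (rule generate_conj[OF _ _ x']) (simp_all add: cc)
  also have "\<dots> = generate A {r, conjg A r (\<pi> h)}" by (simp add: bk cc)
  also have "\<dots> \<subseteq> {\<pi> w \<otimes> rr i | w i. parab w}" using P r1 r2 by (intro generate_subgroup_incl) auto
  finally obtain w i where wi: "parab w" "conjg A x (inv ?y) = \<pi> w \<otimes> rr i" by blast
  have xc: "x \<in> carrier A" using x generate_in_carrier[of "{conjg A r (\<pi> g1), conjg A r (\<pi> g2)}"] by (simp add: cc)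
  have "conjg A (x [^] (864::nat)) (inv ?y) = \<one>"
    using conj_pow[OF xc, of "inv ?y" 864] wi parab_elem_exponent[OF wi(1), of i] by (simp)
  then have "conjg A (conjg A (x [^] (864::nat)) (inv ?y)) ?y = conjg A \<one> ?y" by simp
  moreover have "conjg A \<one> ?y = \<one>" by (simp add: conjg_def)
  ultimately show ?thesis using xc y by (simp add: conjg_conjg) (simp add: conjg_def)
qed

theorem pair_pi_group:
  assumes "\<And>u v :: 'f vec. nrm u = - 1 \<Longrightarrow> nrm v = - 1 \<Longrightarrow> pair_reducible u v" and "n \<in> N"
  shows "is_pi_group_set {2, 3} (generate A {r, conjg A r n})"
proof -
  obtain g where g: "n = \<pi> g" using assms(2) pi_range by auto
  have r: "r = conjg A r (\<pi> [])" by (simp add: conjg_def)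
  show ?thesis
  \<comment> \<open>864 = 2^5 * 3^3.\<close>
  proof (rule pi_group_set_23[of _ 5 3])
    show "finite (carrier A)" by (rule fin)
    show "subgroup (generate A {r, conjg A r n}) A"
      using assms N_carrier by (intro generate_is_subgroup) (auto intro!: conjg_in_carrier[OF is_group])
    show "x [^] (2 ^ 5 * 3 ^ 3 :: nat) = \<one>" if x: "x \<in> generate A {r, conjg A r n}" for x
    proof -
      have "x \<in> generate A {conjg A r (\<pi> []), conjg A r (\<pi> g)}" using x unfolding r[symmetric] g .
      then have "x [^] (864::nat) = \<one>" by (rule pair_exponent[rotated]) (rule assms(1))
      then show ?thesis by simp
    qed
  qed
qed

text \<open>Every element of the extension has the form r^i n with n in N, and r^i does not move r,
  so conjugating by the extension gives nothing beyond conjugating by N.\<close>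

lemma conj_r_by_extension:
  assumes "h \<in> generate A (N \<union> {r})"
  shows "\<exists>g. conjg A r h = conjg A r (\<pi> g)"
proof -
  have sg: "subgroup {\<pi> w \<otimes> rr i | w i. True} A" by (rule word_subgroup) auto
  have "\<pi> w = \<pi> w \<otimes> rr 0" "r = \<pi> [] \<otimes> rr 1" for w by simp_all
  then have "N \<union> {r} \<subseteq> {\<pi> w \<otimes> rr i | w i. True}" using pi_range by blast
  then have "h \<in> {\<pi> w \<otimes> rr i | w i. True}" using assms sg generate_subgroup_incl by blast
  then obtain w i where h: "h = \<pi> w \<otimes> rr i" by blast
  let ?g = "(shift ^^ (2 * i)) w"
  have "(shift ^^ i) ?g = (shift ^^ (3 * i)) w" by (simp add: funpow_add[symmetric, THEN fun_cong, simplified])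
  then have "rr i \<otimes> \<pi> ?g = h" unfolding h by (simp add: r_pow_pi shift_funpow_3)
  moreover have "conjg A r (rr i) = r"
    using nat_pow_Suc2[of r i] by (intro conj_commuting) simp_all
  ultimately have "conjg A r h = conjg A r (\<pi> ?g)" using conjg_conjg[of r "rr i" "\<pi> ?g"] by simp
  then show ?thesis by blast
qed

theorem alpha_r:
  assumes pr: "\<And>u v :: 'f vec. nrm u = - 1 \<Longrightarrow> nrm v = - 1 \<Longrightarrow> pair_reducible u v"
    and o5: "triv (wpow (w5 :: 'f letter list) 5)" "\<not> triv w5"
    and gen: "N \<subseteq> generate A {r, conjg A r (\<pi> g), conjg A r (\<pi> h)}"
  shows "alphaN r = 3"
  unfolding alphaN_def
proof (rule Least_equality)
  let ?H = "generate A (N \<union> {r})"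
  have "\<one> \<in> ?H" "\<pi> g \<in> ?H" "\<pi> h \<in> ?H" by (auto intro: generate.intros)
  moreover have "r = conjg A r \<one>" by (simp add: conjg_def)
  ultimately have "\<forall>y\<in>set [r, conjg A r (\<pi> g), conjg A r (\<pi> h)]. \<exists>h\<in>?H. y = conjg A r h" by auto
  then show "\<exists>ys. length ys = 3 \<and> (\<forall>y\<in>set ys. \<exists>h\<in>?H. y = conjg A r h) \<and> N \<subseteq> generate A (set ys)"
    using gen by (intro exI[of _ "[r, conjg A r (\<pi> g), conjg A r (\<pi> h)]"]) auto
next
  fix k assume "\<exists>ys. length ys = k \<and> (\<forall>y\<in>set ys. \<exists>h\<in>generate A (N \<union> {r}). y = conjg A r h) \<and> N \<subseteq> generate A (set ys)"
  then obtain ys where ys: "length ys = k" "\<forall>y\<in>set ys. \<exists>h\<in>generate A (N \<union> {r}). y = conjg A r h" "N \<subseteq> generate A (set ys)" by auto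
  show "3 \<le> k"
  proof (rule ccontr)
    assume "\<not> 3 \<le> k"
    have y: "\<exists>g. y = conjg A r (\<pi> g)" if "y \<in> set ys" for y
    proof -
      from that ys(2) obtain k1 where "k1 \<in> generate A (N \<union> {r})" "y = conjg A r k1" by auto
      then show ?thesis using conj_r_by_extension[of k1] by auto
    qed
    have "\<exists>g1 g2. set ys \<subseteq> {conjg A r (\<pi> g1), conjg A r (\<pi> g2)}"
    proof (cases ys)
      case (Cons a l)
      note c1 = this
      obtain g1 where g1: "a = conjg A r (\<pi> g1)" using y c1 by auto
      show ?thesis
      proof (cases l)
        case Nil then show ?thesis using c1 g1 by auto
      next
        case (Cons b l')
        then have "l' = []" using \<open>\<not> 3 \<le> k\<close> ys(1) c1 by (cases l') auto
        moreover obtain g2 where "b = conjg A r (\<pi> g2)" using y c1 Cons by auto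
        ultimately show ?thesis using c1 Cons g1 by auto
      qed
    qed auto
    then obtain g1 g2 where "set ys \<subseteq> {conjg A r (\<pi> g1), conjg A r (\<pi> g2)}" by blast
    then have "generate A (set ys) \<subseteq> generate A {conjg A r (\<pi> g1), conjg A r (\<pi> g2)}" by (rule mono_generate)
    then have "\<pi> w5 \<in> generate A {conjg A r (\<pi> g1), conjg A r (\<pi> g2)}" using ys(3) pi_in_N by blast
    then have e: "\<pi> w5 [^] (864::nat) = \<one>" by (rule pair_exponent[rotated]) (rule pr)
    have f: "\<pi> w5 [^] (5::nat) = \<one>" using o5 by (simp add: pi_wpow[symmetric] pi_one_iff)
    have d: "ord (\<pi> w5) dvd 864" "ord (\<pi> w5) dvd 5" using e f pow_eq_id by auto
    \<comment> \<open>865 is the multiple of 5 next to 864, so the order divides their difference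
      1.\<close>
    have "ord (\<pi> w5) dvd 865" using d(2) by (rule dvd_trans) simp
    then have "ord (\<pi> w5) dvd 865 - 864" using d(1) by (rule dvd_diff_nat)
    then have "ord (\<pi> w5) = 1" by simp
    then show False using o5(2) ord_eq_1[of "\<pi> w5"] pi_one_iff by simp
  qed
qed

end

section \<open>Certificates that explicit conjugates generate\<close>

fun mult3 :: "'b list \<Rightarrow> bool" where
  "mult3 [] = True" | "mult3 (_ # _ # _ # xs) = mult3 xs" | "mult3 _ = False"

text \<open>Words in elements s r (s in S), with r of order 3, so that (s r) (s r) is the inverse of s r.\<close>

definition reaches :: "'a::comm_ring_1 letter list set \<Rightarrow> 'a letter list \<Rightarrow> bool" where
  "reaches S w \<longleftrightarrow> (\<exists>ss. set ss \<subseteq> S \<and> mult3 ss \<and> same (twist ss) w)"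

text \<open>A compressed notation for long products: each entry of the path conjugates the product
  so far by g r or by its inverse, the inverse being spelled as a double occurrence of g.\<close>

fun conj_path :: "'b list \<Rightarrow> ('b \<times> bool) list \<Rightarrow> 'b list" where
  "conj_path xs [] = xs"
| "conj_path xs ((g, b) # ps) = conj_path (if b then g # xs @ [g, g] else [g, g] @ xs @ [g]) ps"

lemma set_conj_path: "set (conj_path xs ps) \<subseteq> set xs \<union> fst ` set ps"
  by (induction xs ps rule: conj_path.induct) (auto split: if_splits)

lemma triv_same: "triv w \<Longrightarrow> same [] w"
  by (auto simp: triv_def same_def)

definition path_certificate :: "'a::comm_ring_1 letter list list \<Rightarrow> ('a letter list \<times> bool) list \<Rightarrow> 'a letter list \<Rightarrow> bool" where
  "path_certificate xs ps w \<longleftrightarrow> mult3 (conj_path xs ps) \<and> same (twist (conj_path xs ps)) w"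

lemma reachesI:
  assumes "path_certificate xs ps w" "set xs \<subseteq> S" "fst ` set ps \<subseteq> S"
  shows "reaches S w"
proof -
  have "set (conj_path xs ps) \<subseteq> S" using set_conj_path[of xs ps] assms(2,3) by (meson Un_least subset_trans)
  then show ?thesis using assms(1) unfolding reaches_def path_certificate_def by (intro exI[of _ "conj_path xs ps"]) simp
qed

definition full_reach :: "'a::comm_ring_1 letter list set \<Rightarrow> bool" where
  "full_reach S \<longleftrightarrow> (\<forall>k. reaches S [Pos k 1] \<and> reaches S [Neg k 1])"

lemma order_5_f2: "triv (wpow [Neg A1 1, Pos A2 1, Pos A1 1, Pos A3 1, Neg A2 1, Neg A3 1] 5 :: f2 letter list)" "\<not> triv ([Neg A1 1, Pos A2 1, Pos A1 1, Pos A3 1, Neg A2 1, Neg A3 1] :: f2 letter list)"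
proof -
  have "same [] (wpow [Neg A1 1, Pos A2 1, Pos A1 1, Pos A3 1, Neg A2 1, Neg A3 1] 5 :: f2 letter list)" by code_simp
  from same_triv[OF this] show "triv (wpow [Neg A1 1, Pos A2 1, Pos A1 1, Pos A3 1, Neg A2 1, Neg A3 1] 5 :: f2 letter list)" by simp
  have "\<not> same [] ([Neg A1 1, Pos A2 1, Pos A1 1, Pos A3 1, Neg A2 1, Neg A3 1] :: f2 letter list)" by code_simp
  then show "\<not> triv ([Neg A1 1, Pos A2 1, Pos A1 1, Pos A3 1, Neg A2 1, Neg A3 1] :: f2 letter list)" using triv_same by blast
qed

text \<open>The names give the number of generators and the field size. \<open>two2a\<close> is an
  element of order 3 of the SL2(2) at the central node, whose letters triality fixes; its product
  with r represents the class of part (ii) over two elements. \<open>three2a\<close> is empty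
  because it stands for r itself.\<close>

definition two2a :: "f2 letter list" where "two2a = [Pos A2 1, Neg A2 1]"
definition two2b :: "f2 letter list" where "two2b = [Neg A2 1, Neg A4 1, Pos A3 1, Pos A2 1, Neg A2 1, Pos A4 1, Neg A1 1, Neg A2 1]"
definition three2a :: "f2 letter list" where "three2a = []"
definition three2b :: "f2 letter list" where "three2b = [Pos A3 1, Pos A2 1, Neg A1 1, Neg A3 1, Pos A2 1, Pos A4 1]"
definition three2c :: "f2 letter list" where "three2c = [Neg A2 1, Neg A3 1, Pos A1 1, Pos A2 1, Pos A4 1, Pos A1 1, Pos A2 1, Pos A3 1, Neg A4 1, Neg A2 1]"

lemma two2b_conj: "two2b = winv [Pos A3 1, Neg A4 1, Neg A2 1] @ two2a @ shift [Pos A3 1, Neg A4 1, Neg A2 1]"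
  by code_simp

lemma three2b_conj: "three2b = winv [Neg A1 1, Pos A2 1, Pos A3 1] @ shift [Neg A1 1, Pos A2 1, Pos A3 1]"
  by code_simp

lemma three2c_conj: "three2c = winv [Pos A4 1, Pos A2 1, Pos A1 1, Neg A3 1, Neg A2 1] @ shift [Pos A4 1, Pos A2 1, Pos A1 1, Neg A3 1, Neg A2 1]"
  by code_simp

text \<open>The starting list is the cube of an alternating product of nine factors. It represents a
  conjugate of a root element, and each path leads from it to one of the simple root elements and
  their negatives.\<close>

lemma two2_P1: "reaches {two2a, two2b} [Pos A1 1]"
  by (rule reachesI[where xs = "[two2a, two2b, two2a, two2b, two2a, two2b, two2a, two2b, two2a, two2a, two2b, two2a, two2b, two2a, two2b, two2a, two2b, two2a, two2a, two2b, two2a, two2b, two2a, two2b, two2a, two2b, two2a]" and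
    ps = "[(two2a, True), (two2b, False), (two2a, False), (two2b, False), (two2a, False), (two2b, True), (two2a, True), (two2b, True), (two2a, False), (two2b, False)]"])
    (code_simp, auto)

lemma two2_P2: "reaches {two2a, two2b} [Pos A2 1]"
  by (rule reachesI[where xs = "[two2a, two2b, two2a, two2b, two2a, two2b, two2a, two2b, two2a, two2a, two2b, two2a, two2b, two2a, two2b, two2a, two2b, two2a, two2a, two2b, two2a, two2b, two2a, two2b, two2a, two2b, two2a]" and
    ps = "[(two2a, False), (two2b, True), (two2a, True), (two2b, True), (two2a, False), (two2b, True), (two2a, False), (two2b, False), (two2a, True)]"])
    (code_simp, auto)

lemma two2_P3: "reaches {two2a, two2b} [Pos A3 1]"
  by (rule reachesI[where xs = "[two2a, two2b, two2a, two2b, two2a, two2b, two2a, two2b, two2a, two2a, two2b, two2a, two2b, two2a, two2b, two2a, two2b, two2a, two2a, two2b, two2a, two2b, two2a, two2b, two2a, two2b, two2a]" and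
    ps = "[(two2b, True), (two2a, True), (two2b, False), (two2a, False), (two2b, False), (two2a, True), (two2b, False), (two2a, False), (two2b, False)]"])
    (code_simp, auto)

lemma two2_P4: "reaches {two2a, two2b} [Pos A4 1]"
  by (rule reachesI[where xs = "[two2a, two2b, two2a, two2b, two2a, two2b, two2a, two2b, two2a, two2a, two2b, two2a, two2b, two2a, two2b, two2a, two2b, two2a, two2a, two2b, two2a, two2b, two2a, two2b, two2a, two2b, two2a]" and
    ps = "[(two2a, True), (two2b, False), (two2a, False), (two2b, False), (two2a, False), (two2b, True), (two2a, True), (two2b, True)]"])
    (code_simp, auto)

lemma two2_M1: "reaches {two2a, two2b} [Neg A1 1]"
  by (rule reachesI[where xs = "[two2a, two2b, two2a, two2b, two2a, two2b, two2a, two2b, two2a, two2a, two2b, two2a, two2b, two2a, two2b, two2a, two2b, two2a, two2a, two2b, two2a, two2b, two2a, two2b, two2a, two2b, two2a]" and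
    ps = "[(two2a, True), (two2b, False), (two2a, True), (two2b, True), (two2a, False), (two2b, True), (two2a, True), (two2b, True), (two2a, False), (two2b, True)]"])
    (code_simp, auto)

lemma two2_M2: "reaches {two2a, two2b} [Neg A2 1]"
  by (rule reachesI[where xs = "[two2a, two2b, two2a, two2b, two2a, two2b, two2a, two2b, two2a, two2a, two2b, two2a, two2b, two2a, two2b, two2a, two2b, two2a, two2a, two2b, two2a, two2b, two2a, two2b, two2a, two2b, two2a]" and
    ps = "[(two2a, False), (two2b, True), (two2a, True), (two2b, True), (two2a, False), (two2b, True), (two2a, True), (two2b, True)]"])
    (code_simp, auto)

lemma two2_M3: "reaches {two2a, two2b} [Neg A3 1]"
  by (rule reachesI[where xs = "[two2a, two2b, two2a, two2b, two2a, two2b, two2a, two2b, two2a, two2a, two2b, two2a, two2b, two2a, two2b, two2a, two2b, two2a, two2a, two2b, two2a, two2b, two2a, two2b, two2a, two2b, two2a]" and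
    ps = "[(two2a, False), (two2b, True), (two2a, True), (two2b, True), (two2a, True), (two2b, False), (two2a, False), (two2b, False), (two2a, True), (two2b, True), (two2a, True)]"])
    (code_simp, auto)

lemma two2_M4: "reaches {two2a, two2b} [Neg A4 1]"
  by (rule reachesI[where xs = "[two2a, two2b, two2a, two2b, two2a, two2b, two2a, two2b, two2a, two2a, two2b, two2a, two2b, two2a, two2b, two2a, two2b, two2a, two2a, two2b, two2a, two2b, two2a, two2b, two2a, two2b, two2a]" and
    ps = "[(two2a, False), (two2b, True), (two2a, True), (two2b, True), (two2a, True), (two2b, False), (two2a, False), (two2b, False), (two2a, True)]"])
    (code_simp, auto)

lemma three2_P1: "reaches {three2a, three2b, three2c} [Pos A1 1]"
  by (rule reachesI[where xs = "[three2b, three2c, three2b, three2c, three2b, three2c, three2b, three2c, three2b, three2c, three2b, three2c]" and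
    ps = "[(three2a, False), (three2b, True), (three2a, True), (three2c, False), (three2a, False), (three2c, False), (three2b, False)]"])
    (code_simp, auto)

lemma three2_P2: "reaches {three2a, three2b, three2c} [Pos A2 1]"
  by (rule reachesI[where xs = "[three2b, three2c, three2b, three2c, three2b, three2c, three2b, three2c, three2b, three2c, three2b, three2c]" and
    ps = "[(three2a, True), (three2b, False), (three2c, False), (three2a, False), (three2b, False), (three2c, False)]"])
    (code_simp, auto)

lemma three2_M1: "reaches {three2a, three2b, three2c} [Neg A1 1]"
  by (rule reachesI[where xs = "[three2b, three2c, three2b, three2c, three2b, three2c, three2b, three2c, three2b, three2c, three2b, three2c]" and
    ps = "[(three2a, False), (three2c, True), (three2b, True), (three2a, False), (three2c, True), (three2a, True)]"])
    (code_simp, auto)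

lemma three2_M2: "reaches {three2a, three2b, three2c} [Neg A2 1]"
  by (rule reachesI[where xs = "[three2b, three2c, three2b, three2c, three2b, three2c, three2b, three2c, three2b, three2c, three2b, three2c]" and
    ps = "[(three2a, True), (three2c, True), (three2a, False), (three2b, False), (three2c, True)]"])
    (code_simp, auto)

lemma full_reach_two2: "full_reach {two2a, two2b}"
  unfolding full_reach_def
proof
  fix k show "reaches {two2a, two2b} [Pos k 1] \<and> reaches {two2a, two2b} [Neg k 1]"
    by (cases k) (simp_all add: two2_P1 two2_P2 two2_P3 two2_P4 two2_M1 two2_M2 two2_M3 two2_M4)
qed

lemma order_5_f3: "triv (wpow [Pos A2 1, Neg A2 1, Pos A1 1, Neg A1 1, Pos A3 1, Neg A3 1] 5 :: f3 letter list)" "\<not> triv ([Pos A2 1, Neg A2 1, Pos A1 1, Neg A1 1, Pos A3 1, Neg A3 1] :: f3 letter list)"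
proof -
  have "same [] (wpow [Pos A2 1, Neg A2 1, Pos A1 1, Neg A1 1, Pos A3 1, Neg A3 1] 5 :: f3 letter list)" by code_simp
  from same_triv[OF this] show "triv (wpow [Pos A2 1, Neg A2 1, Pos A1 1, Neg A1 1, Pos A3 1, Neg A3 1] 5 :: f3 letter list)" by simp
  have "\<not> same [] ([Pos A2 1, Neg A2 1, Pos A1 1, Neg A1 1, Pos A3 1, Neg A3 1] :: f3 letter list)" by code_simp
  then show "\<not> triv ([Pos A2 1, Neg A2 1, Pos A1 1, Neg A1 1, Pos A3 1, Neg A3 1] :: f3 letter list)" using triv_same by blast
qed

text \<open>A root element at the central node, commuting with r; its product with r represents the
  class of part (ii) over three elements, as \<open>okubo_table\<close> shows.\<close>

definition two3a :: "f3 letter list" where "two3a = [Pos A2 1]"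
definition two3b :: "f3 letter list" where "two3b = [Neg A2 (- 1), Neg A4 1, Pos A3 (- 1), Pos A2 1, Pos A4 1, Neg A1 (- 1), Neg A2 1]"
definition three3a :: "f3 letter list" where "three3a = []"
definition three3b :: "f3 letter list" where "three3b = [Neg A1 (- 1), Pos A3 (- 1), Neg A2 (- 1), Neg A3 1, Neg A4 (- 1), Neg A2 1, Pos A4 1, Neg A3 1]"
definition three3c :: "f3 letter list" where "three3c = [Pos A1 1, Pos A2 (- 1), Neg A2 1, Pos A3 1, Pos A4 (- 1), Neg A2 (- 1), Pos A2 1, Pos A3 (- 1)]"

lemma two3b_conj: "two3b = winv [Pos A3 1, Neg A4 (- 1), Neg A2 1] @ two3a @ shift [Pos A3 1, Neg A4 (- 1), Neg A2 1]"
  by code_simp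

lemma three3b_conj: "three3b = winv [Neg A3 (- 1), Neg A2 1, Pos A3 1, Neg A1 1] @ shift [Neg A3 (- 1), Neg A2 1, Pos A3 1, Neg A1 1]"
  by code_simp

lemma three3c_conj: "three3c = winv [Pos A3 (- 1), Neg A2 (- 1), Pos A2 1, Pos A1 (- 1)] @ shift [Pos A3 (- 1), Neg A2 (- 1), Pos A2 1, Pos A1 (- 1)]"
  by code_simp

text \<open>As over two elements, a power of an alternating product, here of seven factors,
  represents a conjugate of a root element and serves as the common start of all paths.\<close>

lemma two3_P1: "reaches {two3a, two3b} [Pos A1 1]"
  by (rule reachesI[where xs = "[two3a, two3b, two3a, two3b, two3a, two3b, two3a, two3a, two3b, two3a, two3b, two3a, two3b, two3a, two3a, two3b, two3a, two3b, two3a, two3b, two3a, two3a, two3b, two3a, two3b, two3a, two3b, two3a, two3a, two3b, two3a, two3b, two3a, two3b, two3a, two3a, two3b, two3a, two3b, two3a, two3b, two3a, two3a, two3b, two3a, two3b, two3a, two3b, two3a, two3a, two3b, two3a, two3b, two3a, two3b, two3a, two3a, two3b, two3a, two3b, two3a, two3b, two3a]" and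
    ps = "[(two3b, False), (two3a, True), (two3b, False), (two3a, False), (two3b, True), (two3a, True), (two3b, True), (two3a, False), (two3b, False), (two3a, True), (two3b, False), (two3a, True), (two3b, True), (two3a, False)]"])
    (code_simp, auto)

lemma two3_P2: "reaches {two3a, two3b} [Pos A2 1]"
  by (rule reachesI[where xs = "[two3a, two3b, two3a, two3b, two3a, two3b, two3a, two3a, two3b, two3a, two3b, two3a, two3b, two3a, two3a, two3b, two3a, two3b, two3a, two3b, two3a, two3a, two3b, two3a, two3b, two3a, two3b, two3a, two3a, two3b, two3a, two3b, two3a, two3b, two3a, two3a, two3b, two3a, two3b, two3a, two3b, two3a, two3a, two3b, two3a, two3b, two3a, two3b, two3a, two3a, two3b, two3a, two3b, two3a, two3b, two3a, two3a, two3b, two3a, two3b, two3a, two3b, two3a]" and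
    ps = "[(two3a, False), (two3b, True), (two3a, False), (two3b, False), (two3a, True), (two3b, True), (two3a, False), (two3b, False), (two3a, False), (two3b, True), (two3a, False), (two3b, False), (two3a, False), (two3b, False)]"])
    (code_simp, auto)

lemma two3_P3: "reaches {two3a, two3b} [Pos A3 1]"
  by (rule reachesI[where xs = "[two3a, two3b, two3a, two3b, two3a, two3b, two3a, two3a, two3b, two3a, two3b, two3a, two3b, two3a, two3a, two3b, two3a, two3b, two3a, two3b, two3a, two3a, two3b, two3a, two3b, two3a, two3b, two3a, two3a, two3b, two3a, two3b, two3a, two3b, two3a, two3a, two3b, two3a, two3b, two3a, two3b, two3a, two3a, two3b, two3a, two3b, two3a, two3b, two3a, two3a, two3b, two3a, two3b, two3a, two3b, two3a, two3a, two3b, two3a, two3b, two3a, two3b, two3a]" and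
    ps = "[(two3b, True), (two3a, False), (two3b, False), (two3a, True), (two3b, True), (two3a, False), (two3b, False), (two3a, False), (two3b, False), (two3a, True), (two3b, False), (two3a, True), (two3b, False), (two3a, False)]"])
    (code_simp, auto)

lemma two3_P4: "reaches {two3a, two3b} [Pos A4 1]"
  by (rule reachesI[where xs = "[two3a, two3b, two3a, two3b, two3a, two3b, two3a, two3a, two3b, two3a, two3b, two3a, two3b, two3a, two3a, two3b, two3a, two3b, two3a, two3b, two3a, two3a, two3b, two3a, two3b, two3a, two3b, two3a, two3a, two3b, two3a, two3b, two3a, two3b, two3a, two3a, two3b, two3a, two3b, two3a, two3b, two3a, two3a, two3b, two3a, two3b, two3a, two3b, two3a, two3a, two3b, two3a, two3b, two3a, two3b, two3a, two3a, two3b, two3a, two3b, two3a, two3b, two3a]" and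
    ps = "[(two3a, False), (two3b, False), (two3a, True), (two3b, False), (two3a, True), (two3b, True), (two3a, True), (two3b, True), (two3a, False), (two3b, True), (two3a, True), (two3b, False), (two3a, True), (two3b, True), (two3a, True), (two3b, True)]"])
    (code_simp, auto)

lemma two3_M1: "reaches {two3a, two3b} [Neg A1 1]"
  by (rule reachesI[where xs = "[two3a, two3b, two3a, two3b, two3a, two3b, two3a, two3a, two3b, two3a, two3b, two3a, two3b, two3a, two3a, two3b, two3a, two3b, two3a, two3b, two3a, two3a, two3b, two3a, two3b, two3a, two3b, two3a, two3a, two3b, two3a, two3b, two3a, two3b, two3a, two3a, two3b, two3a, two3b, two3a, two3b, two3a, two3a, two3b, two3a, two3b, two3a, two3b, two3a, two3a, two3b, two3a, two3b, two3a, two3b, two3a, two3a, two3b, two3a, two3b, two3a, two3b, two3a]" and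
    ps = "[(two3b, False), (two3a, False), (two3b, True), (two3a, False), (two3b, False), (two3a, False), (two3b, False), (two3a, False), (two3b, False), (two3a, False), (two3b, True)]"])
    (code_simp, auto)

lemma two3_M2: "reaches {two3a, two3b} [Neg A2 1]"
  by (rule reachesI[where xs = "[two3a, two3b, two3a, two3b, two3a, two3b, two3a, two3a, two3b, two3a, two3b, two3a, two3b, two3a, two3a, two3b, two3a, two3b, two3a, two3b, two3a, two3a, two3b, two3a, two3b, two3a, two3b, two3a, two3a, two3b, two3a, two3b, two3a, two3b, two3a, two3a, two3b, two3a, two3b, two3a, two3b, two3a, two3a, two3b, two3a, two3b, two3a, two3b, two3a, two3a, two3b, two3a, two3b, two3a, two3b, two3a, two3a, two3b, two3a, two3b, two3a, two3b, two3a]" and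
    ps = "[(two3b, True), (two3a, True), (two3b, True), (two3a, False), (two3b, True), (two3a, True), (two3b, False), (two3a, False), (two3b, False), (two3a, False), (two3b, True), (two3a, True)]"])
    (code_simp, auto)

lemma two3_M3: "reaches {two3a, two3b} [Neg A3 1]"
  by (rule reachesI[where xs = "[two3a, two3b, two3a, two3b, two3a, two3b, two3a, two3a, two3b, two3a, two3b, two3a, two3b, two3a, two3a, two3b, two3a, two3b, two3a, two3b, two3a, two3a, two3b, two3a, two3b, two3a, two3b, two3a, two3a, two3b, two3a, two3b, two3a, two3b, two3a, two3a, two3b, two3a, two3b, two3a, two3b, two3a, two3a, two3b, two3a, two3b, two3a, two3b, two3a, two3a, two3b, two3a, two3b, two3a, two3b, two3a, two3a, two3b, two3a, two3b, two3a, two3b, two3a]" and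
    ps = "[(two3b, False), (two3a, False), (two3b, True), (two3a, False), (two3b, False), (two3a, False), (two3b, False), (two3a, False), (two3b, False), (two3a, False), (two3b, True), (two3a, True)]"])
    (code_simp, auto)

lemma two3_M4: "reaches {two3a, two3b} [Neg A4 1]"
  by (rule reachesI[where xs = "[two3a, two3b, two3a, two3b, two3a, two3b, two3a, two3a, two3b, two3a, two3b, two3a, two3b, two3a, two3a, two3b, two3a, two3b, two3a, two3b, two3a, two3a, two3b, two3a, two3b, two3a, two3b, two3a, two3a, two3b, two3a, two3b, two3a, two3b, two3a, two3a, two3b, two3a, two3b, two3a, two3b, two3a, two3a, two3b, two3a, two3b, two3a, two3b, two3a, two3a, two3b, two3a, two3b, two3a, two3b, two3a, two3a, two3b, two3a, two3b, two3a, two3b, two3a]" and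
    ps = "[(two3b, False), (two3a, False), (two3b, True), (two3a, False), (two3b, False), (two3a, False), (two3b, False), (two3a, False), (two3b, False), (two3a, False), (two3b, True), (two3a, False)]"])
    (code_simp, auto)

lemma three3_P1: "reaches {three3a, three3b, three3c} [Pos A1 1]"
  by (rule reachesI[where xs = "[three3a, three3c, three3c, three3a, three3c, three3c, three3a, three3c, three3c]" and
    ps = "[(three3b, False), (three3c, True), (three3a, False), (three3c, False), (three3a, True), (three3b, True), (three3a, False)]"])
    (code_simp, auto)

lemma three3_P2: "reaches {three3a, three3b, three3c} [Pos A2 1]"
  by (rule reachesI[where xs = "[three3a, three3c, three3c, three3a, three3c, three3c, three3a, three3c, three3c]" and
    ps = "[(three3b, False), (three3a, True), (three3c, False), (three3b, True), (three3a, True), (three3c, True), (three3a, False), (three3c, True), (three3b, False), (three3c, True)]"])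
    (code_simp, auto)

lemma three3_M1: "reaches {three3a, three3b, three3c} [Neg A1 1]"
  by (rule reachesI[where xs = "[three3a, three3c, three3c, three3a, three3c, three3c, three3a, three3c, three3c]" and
    ps = "[(three3b, False), (three3a, True), (three3b, True), (three3c, False), (three3a, True), (three3c, True), (three3a, True), (three3c, False)]"])
    (code_simp, auto)

lemma three3_M2: "reaches {three3a, three3b, three3c} [Neg A2 1]"
  by (rule reachesI[where xs = "[three3a, three3c, three3c, three3a, three3c, three3c, three3a, three3c, three3c]" and
    ps = "[(three3b, False), (three3c, True), (three3b, False), (three3a, False), (three3c, False), (three3a, False), (three3c, False), (three3b, True), (three3c, False), (three3b, False)]"])
    (code_simp, auto)

lemma full_reach_two3: "full_reach {two3a, two3b}"
  unfolding full_reach_def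
proof
  fix k show "reaches {two3a, two3b} [Pos k 1] \<and> reaches {two3a, two3b} [Neg k 1]"
    by (cases k) (simp_all add: two3_P1 two3_P2 two3_P3 two3_P4 two3_M1 two3_M2 two3_M3 two3_M4)
qed

context triality_action begin

lemma r_pi_left: "y \<in> carrier A \<Longrightarrow> r \<otimes> (\<pi> w \<otimes> y) = \<pi> (shift w) \<otimes> (r \<otimes> y)"
  by (simp add: m_assoc[symmetric] r_pi)

lemma r_cube': "r \<otimes> (r \<otimes> r) = \<one>"
  using r_cube by (simp add: m_assoc)

lemma pi_twist:
  assumes K: "subgroup K A" and S: "\<And>s. s \<in> set ss \<Longrightarrow> \<pi> s \<otimes> r \<in> K" and "mult3 ss"
  shows "\<pi> (twist ss) \<in> K"
  using assms(2,3)
proof (induction ss rule: mult3.induct)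
  case 1 then show ?case using K by (simp add: subgroup.one_closed)
next
  case (2 a b c ss)
  have "(\<pi> a \<otimes> r) \<otimes> (\<pi> b \<otimes> r) \<otimes> (\<pi> c \<otimes> r) = \<pi> (a @ shift b @ shift (shift c))"
    by (simp add: m_assoc r_pi r_pi_left r_cube' pi_append)
  then have "\<pi> (a @ shift b @ shift (shift c)) \<in> K" using 2(2)[of a] 2(2)[of b] 2(2)[of c] subgroup.m_closed[OF K] by (metis list.set_intros)
  moreover have "\<pi> (twist ss) \<in> K" using 2 by simp
  moreover have "twist (a # b # c # ss) = (a @ shift b @ shift (shift c)) @ twist ss" by simp
  ultimately show ?case using K by (metis pi_append subgroup.m_closed)
qed simp_all

lemma pi_reaches:
  assumes "subgroup K A" "\<And>s. s \<in> S \<Longrightarrow> \<pi> s \<otimes> r \<in> K" "reaches S w"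
  shows "\<pi> w \<in> K"
proof -
  obtain ss where ss: "set ss \<subseteq> S" "mult3 ss" "same (twist ss) w" using assms(3) by (auto simp: reaches_def)
  then have "\<pi> (twist ss) \<in> K" using assms(1,2) by (intro pi_twist) auto
  then show ?thesis using pi_same[OF ss(3)] by simp
qed

lemma generate_two:
  assumes "full_reach {s, winv g @ s @ shift g}"
  shows "N \<subseteq> generate A {\<pi> s \<otimes> r, conjg A (\<pi> s \<otimes> r) (\<pi> g)}"
proof -
  let ?K = "generate A {\<pi> s \<otimes> r, conjg A (\<pi> s \<otimes> r) (\<pi> g)}"
  have K: "subgroup ?K A" by (intro generate_is_subgroup) (auto simp: conjg_r)
  have S: "\<pi> u \<otimes> r \<in> ?K" if "u \<in> {s, winv g @ s @ shift g}" for u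
    using that conjg_r[of s g, symmetric] by (auto intro: generate.incl)
  have "\<pi> w \<in> ?K" if "reaches {s, winv g @ s @ shift g} w" for w by (rule pi_reaches[OF K S that])
  then show ?thesis using assms unfolding full_reach_def by (intro N_subset[OF K]) blast+
qed

text \<open>The nodes \<open>A1\<close> and \<open>A2\<close> suffice because r is itself one of the
  generators: conjugating by it carries the root elements of \<open>A1\<close> to those of
  \<open>A3\<close> and \<open>A4\<close>.\<close>

lemma generate_three:
  assumes "\<And>k. k = A1 \<or> k = A2 \<Longrightarrow> reaches {[], winv g @ shift g, winv h @ shift h} [Pos k 1]"
    "\<And>k. k = A1 \<or> k = A2 \<Longrightarrow> reaches {[], winv g @ shift g, winv h @ shift h} [Neg k 1]"
  shows "N \<subseteq> generate A {r, conjg A r (\<pi> g), conjg A r (\<pi> h)}"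
proof -
  let ?K = "generate A {r, conjg A r (\<pi> g), conjg A r (\<pi> h)}"
  have c: "conjg A r (\<pi> u) = \<pi> (winv u @ shift u) \<otimes> r" for u using conjg_r[of "[]" u] by simp
  have K: "subgroup ?K A" by (intro generate_is_subgroup) (auto simp: c)
  have S: "\<pi> u \<otimes> r \<in> ?K" if "u \<in> {[], winv g @ shift g, winv h @ shift h}" for u
    using that c[symmetric] by (auto intro: generate.incl)
  have r: "r \<in> ?K" by (rule generate.incl) simp
  have sh: "\<pi> (shift w) \<in> ?K" if "\<pi> w \<in> ?K" for w
    unfolding pi_shift using that r K by (simp add: subgroup.m_closed subgroup.m_inv_closed)
  have p: "\<pi> [Pos A1 1] \<in> ?K" "\<pi> [Pos A2 1] \<in> ?K" "\<pi> [Neg A1 1] \<in> ?K" "\<pi> [Neg A2 1] \<in> ?K"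
    by (rule pi_reaches[OF K S], assumption, rule assms, simp)+
  show ?thesis
  proof (rule N_subset[OF K])
    fix k
    show "\<pi> [Pos k 1] \<in> ?K" using p sh[OF p(1)] sh[OF sh[OF p(1)]] by (cases k) auto
    show "\<pi> [Neg k 1] \<in> ?K" using p sh[OF p(3)] sh[OF sh[OF p(3)]] by (cases k) auto
  qed
qed

end

section \<open>Polynomial functions of bounded degree and the Chevalley-Warning argument\<close>

inductive pdeg :: "nat \<Rightarrow> ('a::comm_ring_1 vec \<Rightarrow> 'a) \<Rightarrow> bool" where
  pdeg_mono: "length js \<le> d \<Longrightarrow> set js \<subseteq> {..<8} \<Longrightarrow> pdeg d (\<lambda>x. c * (\<Prod>i\<leftarrow>js. coords x ! i))"
| pdeg_add: "pdeg d f \<Longrightarrow> pdeg d g \<Longrightarrow> pdeg d (\<lambda>x. f x + g x)"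

lemma pdeg_const: "pdeg d (\<lambda>x. c)"
  using pdeg_mono[of "[]" d c] by simp

lemma pdeg_coord: "i < 8 \<Longrightarrow> pdeg 1 (\<lambda>x. coords x ! i)"
  using pdeg_mono[of "[i]" 1 1] by simp

lemma pdeg_mult: "pdeg d f \<Longrightarrow> pdeg e g \<Longrightarrow> pdeg (d + e) (\<lambda>x. f x * g x)"
proof (induction rule: pdeg.induct)
  case (pdeg_mono js d c)
  note js = this(1,2)
  from pdeg_mono(3) show ?case
  proof (induction rule: pdeg.induct)
    case (pdeg_mono ks e c')
    have "pdeg (d + e) (\<lambda>x. (c * c') * (\<Prod>i\<leftarrow>js @ ks. coords x ! i))"
      using js pdeg_mono by (intro pdeg.pdeg_mono) auto
    then show ?case by (simp add: mult_ac)
  next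
    case (pdeg_add e f g)
    then show ?case by (simp add: distrib_left pdeg.pdeg_add)
  qed
next
  case (pdeg_add d f g)
  then show ?case by (simp add: distrib_right pdeg.pdeg_add)
qed

lemma pdeg_cmult: "pdeg d f \<Longrightarrow> pdeg d (\<lambda>x. c * f x)"
  using pdeg_mult[OF pdeg_const[of 0 c], of d f] by simp

lemma pdeg_uminus: "pdeg d f \<Longrightarrow> pdeg d (\<lambda>x. - f x)"
  using pdeg_cmult[of d f "- 1"] by simp

lemma pdeg_diff: "pdeg d f \<Longrightarrow> pdeg d g \<Longrightarrow> pdeg d (\<lambda>x. f x - g x)"
  using pdeg_add[OF _ pdeg_uminus, of d f g] by simp

lemma pdeg_power: "pdeg d f \<Longrightarrow> pdeg (d * k) (\<lambda>x. f x ^ k)"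
proof (induction k)
  case (Suc k)
  then show ?case using pdeg_mult[of d f "d * k" "\<lambda>x. f x ^ k"] by simp
qed (simp add: pdeg_const)

definition vdeg :: "nat \<Rightarrow> ('a::comm_ring_1 vec \<Rightarrow> 'a vec) \<Rightarrow> bool" where
  "vdeg d F \<longleftrightarrow> (\<exists>a b c e f g h i. F = (\<lambda>x. Vec (a x) (b x) (c x) (e x) (f x) (g x) (h x) (i x)) \<and>
     pdeg d a \<and> pdeg d b \<and> pdeg d c \<and> pdeg d e \<and> pdeg d f \<and> pdeg d g \<and> pdeg d h \<and> pdeg d i)"

lemma vdegI: "\<lbrakk>pdeg d a; pdeg d b; pdeg d c; pdeg d e; pdeg d f; pdeg d g; pdeg d h; pdeg d i\<rbrakk>
  \<Longrightarrow> vdeg d (\<lambda>x. Vec (a x) (b x) (c x) (e x) (f x) (g x) (h x) (i x))"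
  unfolding vdeg_def by blast

lemma vdeg_id: "vdeg 1 (\<lambda>x. x)"
proof -
  have eq: "(\<lambda>x :: 'a vec. x) = (\<lambda>x. Vec (coords x ! 0) (coords x ! 1) (coords x ! 2) (coords x ! 3)
     (coords x ! 4) (coords x ! 5) (coords x ! 6) (coords x ! 7))"
  proof
    fix x :: "'a vec" show "x = Vec (coords x ! 0) (coords x ! 1) (coords x ! 2) (coords x ! 3)
     (coords x ! 4) (coords x ! 5) (coords x ! 6) (coords x ! 7)" by (cases x) simp
  qed
  show ?thesis by (subst eq, intro vdegI pdeg_coord) simp_all
qed

lemma vdeg_step: "vdeg d F \<Longrightarrow> vdeg d (\<lambda>x. step l (F x))"
proof -
  assume "vdeg d F"
  then obtain a b c e f g h i where F: "F = (\<lambda>x. Vec (a x) (b x) (c x) (e x) (f x) (g x) (h x) (i x))"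
    and p: "pdeg d a" "pdeg d b" "pdeg d c" "pdeg d e" "pdeg d f" "pdeg d g" "pdeg d h" "pdeg d i"
    unfolding vdeg_def by blast
  show ?thesis
  proof (cases l)
    case (Pos k t)
    then show ?thesis
      by (cases k) (simp_all add: F, (intro vdegI pdeg_add pdeg_diff pdeg_cmult p)+)
  next
    case (Neg k t)
    then show ?thesis
      by (cases k) (simp_all add: F, (intro vdegI pdeg_add pdeg_diff pdeg_cmult p)+)
  qed
qed

lemma vdeg_run: "vdeg d F \<Longrightarrow> vdeg d (\<lambda>x. run w (F x))"
  by (induction w) (auto simp: vdeg_step)

lemma vdeg_prd: "vdeg d F \<Longrightarrow> vdeg e G \<Longrightarrow> vdeg (d + e) (\<lambda>x. prd (F x) (G x))"
proof -
  assume "vdeg d F" "vdeg e G"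
  then obtain a b c q f g h i a' b' c' q' f' g' h' i' where
    F: "F = (\<lambda>x. Vec (a x) (b x) (c x) (q x) (f x) (g x) (h x) (i x))"
    "G = (\<lambda>x. Vec (a' x) (b' x) (c' x) (q' x) (f' x) (g' x) (h' x) (i' x))"
    and p: "pdeg d a" "pdeg d b" "pdeg d c" "pdeg d q" "pdeg d f" "pdeg d g" "pdeg d h" "pdeg d i"
     "pdeg e a'" "pdeg e b'" "pdeg e c'" "pdeg e q'" "pdeg e f'" "pdeg e g'" "pdeg e h'" "pdeg e i'"
    unfolding vdeg_def by blast
  show ?thesis unfolding F prd.simps
    by (intro vdegI pdeg_add pdeg_diff pdeg_mult pdeg_uminus p)
qed

lemma pdeg_bil: "vdeg d F \<Longrightarrow> vdeg e G \<Longrightarrow> pdeg (d + e) (\<lambda>x. bil (F x) (G x))"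
proof -
  assume "vdeg d F" "vdeg e G"
  then obtain a b c q f g h i a' b' c' q' f' g' h' i' where
    F: "F = (\<lambda>x. Vec (a x) (b x) (c x) (q x) (f x) (g x) (h x) (i x))"
    "G = (\<lambda>x. Vec (a' x) (b' x) (c' x) (q' x) (f' x) (g' x) (h' x) (i' x))"
    and p: "pdeg d a" "pdeg d b" "pdeg d c" "pdeg d q" "pdeg d f" "pdeg d g" "pdeg d h" "pdeg d i"
     "pdeg e a'" "pdeg e b'" "pdeg e c'" "pdeg e q'" "pdeg e f'" "pdeg e g'" "pdeg e h'" "pdeg e i'"
    unfolding vdeg_def by blast
  show ?thesis unfolding F bil.simps by (intro pdeg_add pdeg_mult p)
qed

lemma pdeg_nrm: "pdeg 2 nrm"
proof -
  have "pdeg (1 + 1) (\<lambda>x :: 'a vec. coords x ! 0 * coords x ! 4 + coords x ! 1 * coords x ! 5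
    + coords x ! 2 * coords x ! 6 + coords x ! 3 * coords x ! 7)"
    by (intro pdeg_add pdeg_mult pdeg_coord) auto
  moreover have "(\<lambda>x :: 'a vec. coords x ! 0 * coords x ! 4 + coords x ! 1 * coords x ! 5
    + coords x ! 2 * coords x ! 6 + coords x ! 3 * coords x ! 7) = nrm"
  proof
    fix x :: "'a vec" show "coords x ! 0 * coords x ! 4 + coords x ! 1 * coords x ! 5
    + coords x ! 2 * coords x ! 6 + coords x ! 3 * coords x ! 7 = nrm x" by (cases x) simp
  qed
  ultimately show ?thesis by (simp add: numeral_2_eq_2)
qed

lemma sum_vec:
  fixes F :: "'a vec \<Rightarrow> 'b::comm_monoid_add"
  shows "(\<Sum>x\<in>UNIV. F x) = (\<Sum>a\<in>UNIV. \<Sum>b\<in>UNIV. \<Sum>c\<in>UNIV. \<Sum>d\<in>UNIV. \<Sum>e\<in>UNIV. \<Sum>f\<in>UNIV. \<Sum>g\<in>UNIV. \<Sum>h\<in>UNIV.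
    F (Vec a b c d e f g h))"
proof -
  have "(\<Sum>x\<in>UNIV. F x) = (\<Sum>(a, b, c, d, e, f, g, h)\<in>UNIV \<times> UNIV \<times> UNIV \<times> UNIV \<times> UNIV \<times> UNIV \<times> UNIV \<times> UNIV.
      F (Vec a b c d e f g h))"
    by (rule sum.reindex_bij_witness[of _ "\<lambda>(a, b, c, d, e, f, g, h). Vec a b c d e f g h"
         "\<lambda>x. case x of Vec a b c d e f g h \<Rightarrow> (a, b, c, d, e, f, g, h)"]) (auto split: vec.splits)
  then show ?thesis by (simp only: sum.cartesian_product)
qed

lemma prod_list_coords:
  fixes a :: "'a::comm_ring_1"
  assumes "set js \<subseteq> {..<8}"
  shows "(\<Prod>i\<leftarrow>js. coords (Vec a b c d e f g h) ! i) = a ^ count_list js 0 * b ^ count_list js 1 * c ^ count_list js 2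
    * d ^ count_list js 3 * e ^ count_list js 4 * f ^ count_list js 5 * g ^ count_list js 6 * h ^ count_list js 7
    \<and> length js = count_list js 0 + count_list js 1 + count_list js 2 + count_list js 3 + count_list js 4
      + count_list js 5 + count_list js 6 + count_list js 7"
  using assms
proof (induction js)
  case (Cons j js)
  have "j = 0 \<or> j = 1 \<or> j = 2 \<or> j = 3 \<or> j = 4 \<or> j = 5 \<or> j = 6 \<or> j = 7" using Cons.prems by auto
  then show ?case using Cons by (elim disjE) (simp_all add: mult_ac)
qed simp

text \<open>A monomial of degree below 8 m in eight variables has some exponent below m, and the
  power sum belonging to that variable vanishes.\<close>

lemma sum_pdeg_zero:
  fixes f :: "'a::{comm_ring_1,finite} vec \<Rightarrow> 'a"
  assumes "pdeg d f" and pow: "\<And>k. k < m \<Longrightarrow> (\<Sum>t\<in>UNIV. t ^ k) = (0 :: 'a)" and d: "d < 8 * m"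
  shows "(\<Sum>x\<in>UNIV. f x) = 0"
  using assms(1,3)
proof (induction rule: pdeg.induct)
  case (pdeg_mono js d c)
  let ?n = "count_list js"
  let ?S = "\<lambda>k. \<Sum>t\<in>(UNIV :: 'a set). t ^ k"
  have p: "(\<Prod>i\<leftarrow>js. coords (Vec x y z u v w s t) ! i) = x ^ ?n 0 * (y ^ ?n 1 * (z ^ ?n 2 * (u ^ ?n 3
     * (v ^ ?n 4 * (w ^ ?n 5 * (s ^ ?n 6 * t ^ ?n 7))))))" for x y z u v w s t :: 'a
    using conjunct1[OF prod_list_coords[OF pdeg_mono(2)], of x y z u v w s t] by (simp only: mult.assoc)
  have l: "length js = ?n 0 + ?n 1 + ?n 2 + ?n 3 + ?n 4 + ?n 5 + ?n 6 + ?n 7"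
    using prod_list_coords[OF pdeg_mono(2), of "0 :: 'a" 0 0 0 0 0 0 0] by blast
  have "?n 0 < m \<or> ?n 1 < m \<or> ?n 2 < m \<or> ?n 3 < m \<or> ?n 4 < m \<or> ?n 5 < m \<or> ?n 6 < m \<or> ?n 7 < m"
    using l pdeg_mono by linarith
  then have z: "?S (?n 0) * (?S (?n 1) * (?S (?n 2) * (?S (?n 3) * (?S (?n 4) * (?S (?n 5) * (?S (?n 6) * ?S (?n 7))))))) = 0"
    using pow by (elim disjE) simp_all
  have "(\<Sum>x\<in>UNIV. c * (\<Prod>i\<leftarrow>js. coords x ! i))
     = c * (?S (?n 0) * (?S (?n 1) * (?S (?n 2) * (?S (?n 3) * (?S (?n 4) * (?S (?n 5) * (?S (?n 6) * ?S (?n 7))))))))"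
    unfolding sum_vec p by (simp only: sum_distrib_left[symmetric] sum_distrib_right[symmetric])
  then show ?case using z by simp
qed (simp add: sum.distrib)

text \<open>With m = q - 1, the function (1 - f^m)(1 - g^m) is the indicator of the common zeros.
  Were 0 the only one, its sum would be 1, while the degree bound makes the sum 0.\<close>

lemma chevalley_warning:
  fixes f g :: "'a::{small_field,finite} vec \<Rightarrow> 'a"
  assumes f: "pdeg d f" "f 0 = 0" and g: "pdeg e g" "g 0 = 0" and de: "d + e < 8"
    and m: "0 < m" and pow: "\<And>k. k < m \<Longrightarrow> (\<Sum>t\<in>UNIV. t ^ k) = (0 :: 'a)" and inv: "\<And>t :: 'a. t \<noteq> 0 \<Longrightarrow> t ^ m = 1"
  shows "\<exists>x. x \<noteq> 0 \<and> f x = 0 \<and> g x = 0"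
proof (rule ccontr)
  assume neg: "\<not> ?thesis"
  let ?h = "\<lambda>x. (1 - f x ^ m) * (1 - g x ^ m)"
  have h: "?h x = (if x = 0 then 1 else 0)" for x
  proof (cases "x = 0")
    case True then show ?thesis using f(2) g(2) m by (simp add: zero_power)
  next
    case False
    then have "f x \<noteq> 0 \<or> g x \<noteq> 0" using neg by blast
    then show ?thesis using False inv by auto
  qed
  have "pdeg (d * m + e * m) ?h"
    by (intro pdeg_mult pdeg_diff pdeg_const pdeg_power f g)
  moreover have "d * m + e * m < 8 * m" using de m by (simp add: add_mult_distrib[symmetric])
  ultimately have "(\<Sum>x\<in>UNIV. ?h x) = 0" using pow by (intro sum_pdeg_zero) auto
  moreover have "(\<Sum>x\<in>UNIV. ?h x) = 1"
  proof -
    have "finite (UNIV :: 'a vec set)"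
    proof -
      have "(UNIV :: 'a vec set) = (\<lambda>(a, b, c, d, e, f, g, h). Vec a b c d e f g h) ` UNIV"
      proof -
        have "x \<in> (\<lambda>(a, b, c, d, e, f, g, h). Vec a b c d e f g h) ` UNIV" for x :: "'a vec"
          by (cases x) (force simp: image_def)
        then show ?thesis by blast
      qed
      then show ?thesis by (metis finite finite_imageI)
    qed
    then show ?thesis unfolding h by (simp add: sum.delta')
  qed
  ultimately show False by simp
qed

section \<open>Incident triples of singular vectors and the flags fixed by elements of order
  3\<close>

definition E1 :: "'a::comm_ring_1 vec" where "E1 = Vec 1 0 0 0 0 0 0 0"
definition F1 :: "'a::comm_ring_1 vec" where "F1 = Vec 0 0 0 0 1 0 0 0"

text \<open>\<open>E1\<close> and \<open>F1\<close> are the highest and lowest weight vectors in all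
  three actions. Fixing \<open>E1\<close> three times puts a word in the stabilizer of a flag of
  type {1,3,4}; fixing \<open>F1\<close> as well leaves the Levi factor at the central node.\<close>

definition fix3 :: "'a::comm_ring_1 vec \<Rightarrow> 'a letter list \<Rightarrow> bool" where
  "fix3 v w \<longleftrightarrow> run w v = v \<and> run (shift w) v = v \<and> run (shift (shift w)) v = v"

lemma fix3_shift: "fix3 v w \<Longrightarrow> fix3 v (shift w)" by (simp add: fix3_def)
lemma fix3_append: "fix3 v u \<Longrightarrow> fix3 v w \<Longrightarrow> fix3 v (u @ w)" by (simp add: fix3_def)
lemma fix3_winv: "fix3 v w \<Longrightarrow> fix3 v (winv w)" unfolding fix3_def shift_winv by (metis run_winv)
lemma fix3_Nil: "fix3 v []" by (simp add: fix3_def)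

fun pos_letter :: "'a letter \<Rightarrow> bool" where
  "pos_letter (Pos k t) = True" | "pos_letter (Neg k t) = False"

definition posw :: "'a letter list \<Rightarrow> bool" where "posw = list_all pos_letter"

lemma posw_simps: "posw []" "posw (l # w) \<longleftrightarrow> pos_letter l \<and> posw w" "posw (u @ w) \<longleftrightarrow> posw u \<and> posw w"
  by (simp_all add: posw_def)

lemma posw_shift: "posw w \<Longrightarrow> posw (shift w)"
proof -
  have "pos_letter (shl l) = pos_letter l" for l :: "'a letter" by (cases l) auto
  then show "posw w \<Longrightarrow> posw (shift w)" by (auto simp: posw_def shift_def list_all_iff)
qed

lemma posw_winv: "posw w \<Longrightarrow> posw (winv w)"
proof -
  have "pos_letter (linv l) = pos_letter l" for l :: "'a letter" by (cases l) auto
  then show "posw w \<Longrightarrow> posw (winv w)" by (auto simp: posw_def winv_def list_all_iff)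
qed

lemma posw_concat: "\<forall>w\<in>set ws. posw w \<Longrightarrow> posw (concat ws)"
  by (induction ws) (auto simp: posw_simps)

lemma posw_E1: "posw w \<Longrightarrow> run w E1 = E1"
proof (induction w)
  case (Cons l w)
  then obtain k t where "l = Pos k t" by (cases l) (auto simp: posw_simps)
  then show ?case using Cons by (cases k) (auto simp: posw_simps E1_def)
qed simp

lemma posw_fix3: "posw w \<Longrightarrow> fix3 E1 w"
  by (simp add: fix3_def posw_E1 posw_shift)

lemma run_shift_concat: "\<forall>g\<in>set ws. run (shift g) v = v \<Longrightarrow> run (shift (concat ws)) v = v"
  "\<forall>g\<in>set ws. run (shift (shift g)) v = v \<Longrightarrow> run (shift (shift (concat ws))) v = v"
  by (induction ws) auto

text \<open>The compatibility of the product with the actions is cyclic in the three modules, so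
  each of them can take the place of the target.\<close>

lemma prd_slots:
  "prd (run w x) (run (shift w) y) = run (shift (shift w)) (prd x y)"
  "prd (run (shift w) x) (run (shift (shift w)) y) = run w (prd x y)"
  "prd (run (shift (shift w)) x) (run w y) = run (shift w) (prd x y)"
  using prd_run[of w x y] prd_run[of "shift w" x y] prd_run[of "shift (shift w)" x y]
  by (simp_all only: shift_shift_shift)

text \<open>Reading coordinates backwards makes \<open>E1\<close> the least nonzero vector, hence
  the only representative needed. The words of G2 and G3 are written as they act on the second and
  third vector of a triple, so their effect on the vectors already normalised is seen through
  further shifts.\<close>

definition flag_certificate :: "'a::small_field letter list list \<Rightarrow> 'a letter list list \<Rightarrow> 'a letter list list \<Rightarrow> bool" where
  "flag_certificate G1 G2 G3 \<longleftrightarrow>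
    allv (\<lambda>x. if nrm x = 0 then if x = 0 then True else lowered rev_coords [E1] G1 x else True) \<and>
    list_all (\<lambda>g. run (shift (shift g)) E1 = E1) G2 \<and>
    allv (\<lambda>y. if prd E1 y = 0 then if y = 0 then True else lowered rev_coords [E1] G2 y else True) \<and>
    list_all (\<lambda>g. run (shift g) E1 = E1 \<and> run (shift (shift g)) E1 = E1) G3 \<and>
    allv (\<lambda>z. if prd E1 z = 0 then if z = 0 then True else
        if prd z E1 = 0 then lowered rev_coords [E1] G3 z else True else True)"

text \<open>Vanishing of the three cyclic products is the incidence of the triple, preserved by
  \<open>prd_slots\<close>. The vectors are moved to \<open>E1\<close> one at a time, each time by
  words that fix the vectors already placed.\<close>

lemma flag_transitive:
  fixes x y z :: "'a::small_field vec"
  assumes cert: "flag_certificate (G1 :: 'a letter list list) G2 G3" and nz: "x \<noteq> 0" "y \<noteq> 0" "z \<noteq> 0"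
    and n: "nrm x = 0" and p: "prd x y = 0" "prd y z = 0" "prd z x = 0"
  shows "\<exists>h. run h x = E1 \<and> run (shift h) y = E1 \<and> run (shift (shift h)) z = E1"
proof -
  have c: "\<And>x :: 'a vec. nrm x = 0 \<and> x \<noteq> 0 \<Longrightarrow> lowered rev_coords [E1] G1 x"
    "\<And>g. g \<in> set G2 \<Longrightarrow> run (shift (shift g)) E1 = E1"
    "\<And>y :: 'a vec. prd E1 y = 0 \<and> y \<noteq> 0 \<Longrightarrow> lowered rev_coords [E1] G2 y"
    "\<And>g. g \<in> set G3 \<Longrightarrow> run (shift g) E1 = E1 \<and> run (shift (shift g)) E1 = E1"
    "\<And>z :: 'a vec. prd E1 z = 0 \<and> prd z E1 = 0 \<and> z \<noteq> 0 \<Longrightarrow> lowered rev_coords [E1] G3 z"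
    using cert unfolding flag_certificate_def allv_iff list_all_iff by metis+
  obtain ws1 where "run (concat ws1) x \<in> set [E1]"
    using descent[of rev_coords "\<lambda>x. nrm x = 0 \<and> x \<noteq> 0", OF length_coords(2) c(1)] nz n by (auto simp: nrm_run)
  then obtain h1 where h1: "run h1 x = E1" by auto
  let ?y = "run (shift h1) y" and ?z = "run (shift (shift h1)) z"
  have 2: "prd E1 ?y = 0" "prd ?y ?z = 0" "prd ?z E1 = 0"
    unfolding h1[symmetric] using p by (simp_all add: prd_slots)
  have "\<exists>ws. set ws \<subseteq> set G2 \<and> run (concat ws) ?y \<in> set [E1]"
  proof (rule descent[of rev_coords "\<lambda>y. prd E1 y = 0 \<and> y \<noteq> 0", OF length_coords(2) c(3)])
    fix g and v :: "'a vec" assume g: "g \<in> set G2" "prd E1 v = 0 \<and> v \<noteq> 0"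
    then show "prd E1 (run g v) = 0 \<and> run g v \<noteq> 0"
      using prd_slots(1)[of "shift (shift g)" E1 v] c(2) by simp
  qed (use 2 nz in auto)
  then obtain ws2 where ws2: "set ws2 \<subseteq> set G2" "run (concat ws2) ?y = E1" by auto
  let ?h2 = "shift (shift (concat ws2))"
  have h2: "run ?h2 E1 = E1" using run_shift_concat(2)[of ws2] ws2(1) c(2) by blast
  have y2: "run (shift ?h2) ?y = E1" using ws2(2) by simp
  let ?z2 = "run (shift (shift ?h2)) ?z"
  have "prd (run (shift ?h2) ?y) ?z2 = run ?h2 (prd ?y ?z)" by (rule prd_slots(2))
  moreover have "prd ?z2 (run ?h2 E1) = run (shift ?h2) (prd ?z E1)" by (rule prd_slots(3))
  ultimately have "prd (run (shift ?h2) ?y) ?z2 = 0" "prd ?z2 (run ?h2 E1) = 0"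
    unfolding 2 run_zero by auto
  then have 3: "prd E1 ?z2 = 0" "prd ?z2 E1 = 0" unfolding y2 h2 .
  have "\<exists>ws. set ws \<subseteq> set G3 \<and> run (concat ws) ?z2 \<in> set [E1]"
  proof (rule descent[of rev_coords "\<lambda>z. prd E1 z = 0 \<and> prd z E1 = 0 \<and> z \<noteq> 0", OF length_coords(2) c(5)])
    fix g and v :: "'a vec" assume g: "g \<in> set G3" "prd E1 v = 0 \<and> prd v E1 = 0 \<and> v \<noteq> 0"
    then show "prd E1 (run g v) = 0 \<and> prd (run g v) E1 = 0 \<and> run g v \<noteq> 0"
      using prd_slots(1)[of "shift (shift g)" E1 v] prd_slots(1)[of g v E1] c(4) by simp
  qed (use 3 nz in auto)
  then obtain ws3 where ws3: "set ws3 \<subseteq> set G3" "run (concat ws3) ?z2 = E1" by auto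
  let ?h3 = "shift (concat ws3)"
  have h3: "run ?h3 E1 = E1" "run (shift ?h3) E1 = E1"
    using run_shift_concat[of ws3] ws3(1) c(4) by blast+
  have z3: "run (shift (shift ?h3)) ?z2 = E1" using ws3(2) by simp
  show ?thesis
    by (rule exI[of _ "?h3 @ ?h2 @ h1"]) (use h1 h2 h3 y2 z3 in \<open>simp\<close>)
qed

text \<open>A triple cyclically permuted by the twisted action of s and consisting of incident
  singular vectors can be moved to three copies of \<open>E1\<close>; the word moving it conjugates
  s into the flag stabilizer. Such a triple is found from a common zero of the norm and a cubic
  form.\<close>

lemma order_3_flag:
  fixes s :: "'a::{small_field,finite} letter list"
  assumes cert: "flag_certificate (G1 :: 'a letter list list) G2 G3"
    and m: "0 < m" "\<And>k. k < m \<Longrightarrow> (\<Sum>t\<in>UNIV. t ^ k) = (0 :: 'a)" "\<And>t :: 'a. t \<noteq> 0 \<Longrightarrow> t ^ m = 1"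
    and o3: "\<And>x. run s (run (shift s) (run (shift (shift s)) x)) = x"
  shows "\<exists>h. fix3 E1 (h @ s @ winv (shift h))"
proof -
  let ?a = "run s" and ?b = "run (shift s)" and ?c = "run (shift (shift s))"
  have flag: "\<exists>h. fix3 E1 (h @ s @ winv (shift h))"
    if x0: "x \<noteq> 0" and nx: "nrm x = 0" and xy: "?a y = x" "?b z = y" "?c x = z" and xy0: "prd x y = 0" for x y z
  proof -
    have nz: "y \<noteq> 0" "z \<noteq> 0" using x0 xy by auto
    have "?c (prd y z) = prd (?a y) (?b z)" by (simp add: prd_slots)
    then have yz: "prd y z = 0" using xy xy0 by simp
    have "?b (prd x y) = prd (?c x) (?a y)" by (simp add: prd_slots)
    then have zx: "prd z x = 0" using xy xy0 by simp
    obtain h where h: "run h x = E1" "run (shift h) y = E1" "run (shift (shift h)) z = E1"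
      using flag_transitive[OF cert x0 nz nx xy0 yz zx] by blast
    have i: "run (winv (shift h)) E1 = y" "run (winv (shift (shift h))) E1 = z" "run (winv h) E1 = x"
      using h by (metis run_winv)+
    show ?thesis by (rule exI[of _ h]) (use xy h in \<open>simp add: fix3_def shift_winv i\<close>)
  qed
  \<comment> \<open>The trilinear form of the product evaluated on the cycle x, y, z through x: a
    cubic form. Together with the quadratic norm the degree is 5 < 8.\<close>
  let ?g = "\<lambda>x. bil (prd x (?b (?c x))) (?c x)"
  have v1: "vdeg 1 (\<lambda>x. ?c x)" by (intro vdeg_run vdeg_id)
  have v2: "vdeg 1 (\<lambda>x. ?b (?c x))" by (intro vdeg_run vdeg_id)
  have n0: "nrm (0 :: 'a vec) = 0" by (simp add: zero_vec_def)
  have "pdeg (1 + 1 + 1) ?g" by (intro pdeg_bil vdeg_prd vdeg_id v1 v2)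
  then have "\<exists>x. x \<noteq> 0 \<and> nrm x = 0 \<and> ?g x = 0"
    using m n0 by (intro chevalley_warning[OF pdeg_nrm]) auto
  then obtain x where x: "x \<noteq> 0" "nrm x = 0" "?g x = 0" by blast
  define z where "z = ?c x"
  define y where "y = ?b z"
  have r: "?a y = x" "?b z = y" "?c x = z" using o3[of x] by (simp_all add: y_def z_def)
  have T: "bil (prd x y) z = 0" using x(3) by (simp add: y_def z_def)
  show ?thesis
  proof (cases "prd x y = 0")
    case True then show ?thesis using flag x r by blast
  next
    case False
    \<comment> \<open>If the triple is not incident, the triple of its pairwise products is. It is
      permuted in the same way, singular because the norm is multiplicative, and two neighbours
      multiply to 0 by the linearised identity, whose right-hand side vanishes because the cubic
      form does.\<close>
    have c1: "?c (prd y z) = prd x y" using prd_slots(1)[of s y z] r by simp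
    have c2: "?a (prd z x) = prd y z" using prd_slots(2)[of s z x] r by simp
    have c3: "?b (prd x y) = prd z x" using prd_slots(3)[of s x y] r by simp
    have nz: "prd y z \<noteq> 0" using c1 False by auto
    have ny: "nrm z = 0" using x(2) nrm_run by (metis r(3))
    have n: "nrm (prd y z) = 0" by (simp add: nrm_prd ny)
    have "prd (prd y z) (prd z x) + prd (prd (prd z x) z) y = - scale (bil y (prd z x)) z" by (rule prd_prd_linear)
    moreover have "prd (prd z x) z = 0" by (simp add: prd_prd_same ny)
    moreover have "bil y (prd z x) = 0" using T bil_prd_cyclic[of z x y] bil_commute[of y "prd z x"] by simp
    ultimately have "prd (prd y z) (prd z x) = 0" by simp
    then show ?thesis using flag[OF nz n c2 c3 c1] by blast
  qed
qed

text \<open>Positive words act transitively on the vectors that can be the image of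
  \<open>F1\<close> under a word fixing \<open>E1\<close>. These have inner product 1 with
  \<open>E1\<close>, so their fifth coordinate is 1 and \<open>F1\<close> is the least among them in
  the usual order.\<close>

definition elim_certificate :: "'a::small_field letter list list \<Rightarrow> 'a letter list list \<Rightarrow> 'a letter list list \<Rightarrow> bool" where
  "elim_certificate G1 G2 G3 \<longleftrightarrow>
    list_all posw G1 \<and> list_all posw G2 \<and> list_all posw G3 \<and>
    allv (\<lambda>v. if bil v E1 = 1 then if nrm v = 0 then lowered coords [F1] G1 v else True else True) \<and>
    list_all (\<lambda>g. run (shift (shift g)) F1 = F1) G2 \<and>
    allv (\<lambda>v. if bil v E1 = 1 then if prd F1 v = 0 then lowered coords [F1] G2 v else True else True) \<and>
    list_all (\<lambda>g. run (shift g) F1 = F1 \<and> run (shift (shift g)) F1 = F1) G3 \<and>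
    allv (\<lambda>v. if bil v E1 = 1 then if prd F1 v = 0 then
        if prd v F1 = 0 then lowered coords [F1] G3 v else True else True else True)"

lemma prd_F1_F1: "prd F1 F1 = 0" by (simp add: F1_def)

text \<open>The opposite flag is moved back to its standard position by the unipotent group, one
  module after another, while the words used keep what was already restored. This is the
  decomposition of the flag stabilizer into unipotent and Levi parts.\<close>

lemma eliminate:
  fixes s :: "'a::small_field letter list"
  assumes cert: "elim_certificate (G1 :: 'a letter list list) G2 G3" and s: "fix3 E1 s"
  shows "\<exists>u. posw u \<and> fix3 E1 (u @ s) \<and> fix3 F1 (u @ s)"
proof -
  have c0: "\<And>g. g \<in> set G1 \<union> set G2 \<union> set G3 \<Longrightarrow> posw g"
    and c: "\<And>v :: 'a vec. bil v E1 = 1 \<and> nrm v = 0 \<Longrightarrow> lowered coords [F1] G1 v"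
    "\<And>g. g \<in> set G2 \<Longrightarrow> run (shift (shift g)) F1 = F1"
    "\<And>v :: 'a vec. bil v E1 = 1 \<and> prd F1 v = 0 \<Longrightarrow> lowered coords [F1] G2 v"
    "\<And>g. g \<in> set G3 \<Longrightarrow> run (shift g) F1 = F1 \<and> run (shift (shift g)) F1 = F1"
    "\<And>v :: 'a vec. bil v E1 = 1 \<and> prd F1 v = 0 \<and> prd v F1 = 0 \<Longrightarrow> lowered coords [F1] G3 v"
    using cert unfolding elim_certificate_def allv_iff list_all_iff by (blast, metis+)
  have bE: "bil (run w v) E1 = bil v E1" if "run w E1 = E1" for w and v :: "'a vec"
    using bil_run[of w v E1] that by simp
  have bF: "bil F1 E1 = (1 :: 'a)" "nrm F1 = (0 :: 'a)" by (simp_all add: F1_def E1_def)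
  have sE: "run s E1 = E1" "run (shift s) E1 = E1" "run (shift (shift s)) E1 = E1" using s by (auto simp: fix3_def)
  have "\<exists>ws. set ws \<subseteq> set G1 \<and> run (concat ws) (run s F1) \<in> set [F1]"
    by (rule descent[of coords "\<lambda>v. bil v E1 = 1 \<and> nrm v = 0", OF length_coords(1) c(1)])
      (auto simp: nrm_run bE c0 posw_E1 sE bF)
  then obtain ws1 where ws1: "set ws1 \<subseteq> set G1" "run (concat ws1) (run s F1) = F1" by auto
  let ?u1 = "concat ws1"
  have u1: "posw ?u1" using ws1 c0 by (intro posw_concat) blast
  let ?s1 = "?u1 @ s"
  have s1: "fix3 E1 ?s1" using fix3_append posw_fix3 u1 s by blast
  have s1F: "run ?s1 F1 = F1" using ws1 by simp
  have sE1: "run ?s1 E1 = E1" "run (shift ?s1) E1 = E1" "run (shift (shift ?s1)) E1 = E1" using s1 by (auto simp: fix3_def)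
  have p1: "prd F1 (run (shift ?s1) F1) = 0" using prd_slots(1)[of ?s1 F1 F1] s1F by (simp add: prd_F1_F1 del: run_append)
  have "\<exists>ws. set ws \<subseteq> set G2 \<and> run (concat ws) (run (shift ?s1) F1) \<in> set [F1]"
  proof (rule descent[of coords "\<lambda>v. bil v E1 = 1 \<and> prd F1 v = 0", OF length_coords(1) c(3)])
    fix g and v :: "'a vec" assume g: "g \<in> set G2" and v: "bil v E1 = 1 \<and> prd F1 v = 0"
    then show "bil (run g v) E1 = 1 \<and> prd F1 (run g v) = 0"
      using prd_slots(1)[of "shift (shift g)" F1 v] c(2)[OF g] bE[of g v] c0 posw_E1[of g] by simp
  qed (use p1 bE[OF sE1(2), of F1] bF in auto)
  then obtain ws2 where ws2: "set ws2 \<subseteq> set G2" "run (concat ws2) (run (shift ?s1) F1) = F1" by auto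
  let ?u2 = "shift (shift (concat ws2))"
  have u2: "posw ?u2" using ws2 c0 by (intro posw_shift posw_concat) blast
  have u2F: "run ?u2 F1 = F1" using run_shift_concat(2)[of ws2] ws2(1) c(2) by blast
  let ?s2 = "?u2 @ ?s1"
  have s2: "fix3 E1 ?s2" using fix3_append posw_fix3 u2 s1 by blast
  have s2F: "run ?s2 F1 = F1" using u2F s1F by simp
  have s2F': "run (shift ?s2) F1 = F1" using ws2(2) by simp
  have sE2: "run ?s2 E1 = E1" "run (shift ?s2) E1 = E1" "run (shift (shift ?s2)) E1 = E1" using s2 by (auto simp: fix3_def)
  have p2: "prd F1 (run (shift (shift ?s2)) F1) = 0" "prd (run (shift (shift ?s2)) F1) F1 = 0"
    using prd_slots(2)[of ?s2 F1 F1] prd_slots(3)[of ?s2 F1 F1] unfolding s2F s2F' prd_F1_F1 run_zero by auto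
  have "\<exists>ws. set ws \<subseteq> set G3 \<and> run (concat ws) (run (shift (shift ?s2)) F1) \<in> set [F1]"
  proof (rule descent[of coords "\<lambda>v. bil v E1 = 1 \<and> prd F1 v = 0 \<and> prd v F1 = 0", OF length_coords(1) c(5)])
    fix g and v :: "'a vec" assume g: "g \<in> set G3" and v: "bil v E1 = 1 \<and> prd F1 v = 0 \<and> prd v F1 = 0"
    then show "bil (run g v) E1 = 1 \<and> prd F1 (run g v) = 0 \<and> prd (run g v) F1 = 0"
      using prd_slots(1)[of "shift (shift g)" F1 v] prd_slots(1)[of g v F1] c(4)[OF g] bE[of g v] c0 posw_E1[of g] by simp
  qed (use p2 bE[OF sE2(3), of F1] bF in auto)
  then obtain ws3 where ws3: "set ws3 \<subseteq> set G3" "run (concat ws3) (run (shift (shift ?s2)) F1) = F1" by auto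
  let ?u3 = "shift (concat ws3)"
  have u3: "posw ?u3" using ws3 c0 by (intro posw_shift posw_concat) blast
  have u3F: "run ?u3 F1 = F1" "run (shift ?u3) F1 = F1"
    using run_shift_concat[of ws3] ws3(1) c(4) by blast+
  have "fix3 F1 (?u3 @ ?s2)" unfolding fix3_def
  proof (intro conjI)
    show "run (?u3 @ ?s2) F1 = F1" using u3F(1) s2F by (metis run_append)
    show "run (shift (?u3 @ ?s2)) F1 = F1" using u3F(2) s2F' by (metis run_append shift_simps(3))
    show "run (shift (shift (?u3 @ ?s2))) F1 = F1" using ws3(2) by simp
  qed
  moreover have "fix3 E1 (?u3 @ ?s2)" using fix3_append posw_fix3 u3 s2 by blast
  moreover have "posw (?u3 @ ?u2 @ ?u1)" using u1 u2 u3 by (simp add: posw_simps)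
  ultimately show ?thesis by (intro exI[of _ "?u3 @ ?u2 @ ?u1"]) simp
qed

section \<open>The Levi factor SL2 of the flag stabilizer\<close>

abbreviation B2 :: "'a::comm_ring_1 vec" where "B2 \<equiv> Vec 0 1 0 0 0 0 0 0"
abbreviation B3 :: "'a::comm_ring_1 vec" where "B3 \<equiv> Vec 0 0 1 0 0 0 0 0"
abbreviation B4 :: "'a::comm_ring_1 vec" where "B4 \<equiv> Vec 0 0 0 1 0 0 0 0"
abbreviation B8 :: "'a::comm_ring_1 vec" where "B8 \<equiv> Vec 0 0 0 0 0 0 0 1"

text \<open>Up to sign, \<open>B4\<close> and \<open>B8\<close> are the products of
  \<open>E1\<close> and \<open>F1\<close> in the two orders, and those factors are fixed in the
  other two actions.\<close>

lemma fix_zero_weight: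
  fixes w :: "'a::comm_ring_1 letter list"
  assumes "fix3 E1 w" "fix3 F1 w"
  shows "run w B4 = B4" "run w B8 = B8"
proof -
  have "prd (run (shift w) E1) (run (shift (shift w)) F1) = run w (prd E1 F1)" by (rule prd_slots)
  then have "run w (prd E1 F1) = prd E1 F1" using assms by (simp add: fix3_def)
  then have a: "run w (- prd E1 F1) = - prd E1 F1" by (simp add: run_uminus)
  have "prd (run (shift w) F1) (run (shift (shift w)) E1) = run w (prd F1 E1)" by (rule prd_slots)
  then have "run w (prd F1 E1) = prd F1 E1" using assms by (simp add: fix3_def)
  then have b: "run w (- prd F1 E1) = - prd F1 E1" by (simp add: run_uminus)
  have "run w (prd E1 F1) = prd E1 F1" "run w (prd F1 E1) = prd F1 E1" using a b by (simp_all add: run_uminus)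
  then show "run w B4 = B4" "run w B8 = B8" using a b by (simp_all add: E1_def F1_def)
qed

lemma levi_image:
  fixes w :: "'a::comm_ring_1 letter list"
  assumes w: "fix3 E1 w" "fix3 F1 w" and v: "v = B2 \<or> v = B3"
  shows "\<exists>s t. run w v = Vec 0 s t 0 0 0 0 0"
proof -
  obtain a b c d e f g h where r: "run w v = Vec a b c d e f g h" by (cases "run w v")
  have fx: "run w E1 = E1" "run w F1 = F1" "run (shift w) E1 = E1" using w by (auto simp: fix3_def)
  have "bil (run w v) (run w E1) = bil v E1" "bil (run w v) (run w F1) = bil v F1"
    "bil (run w v) (run w B4) = bil v B4" "bil (run w v) (run w B8) = bil v B8" by (rule bil_run)+
  then have z: "e = 0" "a = 0" "h = 0" "d = 0"
    unfolding fx fix_zero_weight[OF w] r using v by (auto simp: E1_def F1_def)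
  have "prd (run w v) (run (shift w) E1) = run (shift (shift w)) (prd v E1)" by (rule prd_slots)
  moreover have "prd v E1 = 0" using v by (auto simp: E1_def)
  ultimately have "prd (Vec a b c d e f g h) E1 = 0" unfolding fx r by simp
  then have "f = 0" "g = 0" by (auto simp: E1_def)
  then show ?thesis using r z by auto
qed

text \<open>The products of \<open>B2\<close> and \<open>B3\<close> are 0 or plus or minus
  \<open>E1\<close>, which is fixed. This makes the first column in each action the determinant
  times the first column in the next one, and the product of consecutive determinants 1. Going once
  round the three actions gives back the same column multiplied by the determinant, which is
  therefore 1.\<close>

lemma levi_det:
  fixes w :: "'a::field letter list"
  assumes w: "fix3 E1 w" "fix3 F1 w"
  shows "\<exists>\<alpha> \<beta> \<gamma> \<delta>. \<alpha> * \<delta> - \<beta> * \<gamma> = 1 \<and> run w B2 = Vec 0 \<alpha> \<gamma> 0 0 0 0 0 \<and> run w B3 = Vec 0 \<beta> \<delta> 0 0 0 0 0"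
proof -
  have w1: "fix3 E1 (shift w)" "fix3 F1 (shift w)" using w fix3_shift by auto
  have w2: "fix3 E1 (shift (shift w))" "fix3 F1 (shift (shift w))" using w1 fix3_shift by auto
  have d: "\<alpha> = (\<alpha> * \<delta> - \<beta> * \<gamma>) * \<alpha>' \<and> \<gamma> = (\<alpha> * \<delta> - \<beta> * \<gamma>) * \<gamma>' \<and>
     (\<alpha> * \<delta> - \<beta> * \<gamma>) * (\<alpha>' * \<delta>' - \<beta>' * \<gamma>') = 1"
    if u: "fix3 E1 u" "fix3 F1 u" and r: "run u B2 = Vec 0 \<alpha> \<gamma> 0 0 0 0 0" "run u B3 = Vec 0 \<beta> \<delta> 0 0 0 0 0"
      "run (shift u) B2 = Vec 0 \<alpha>' \<gamma>' 0 0 0 0 0" "run (shift u) B3 = Vec 0 \<beta>' \<delta>' 0 0 0 0 0"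
    for u :: "'a letter list" and \<alpha> \<beta> \<gamma> \<delta> \<alpha>' \<beta>' \<gamma>' \<delta>'
  proof -
    have e: "run (shift (shift u)) E1 = E1" "run (shift (shift u)) (- E1) = - E1"
      using u by (auto simp: fix3_def run_uminus)
    have p: "prd B2 B2 = (0 :: 'a vec)" "prd B3 B3 = (0 :: 'a vec)" "prd B2 B3 = (E1 :: 'a vec)" "prd B3 B2 = (- E1 :: 'a vec)"
      by (simp_all add: E1_def)
    have "prd (run u B2) (run (shift u) B3) = E1" "prd (run u B2) (run (shift u) B2) = 0"
      "prd (run u B3) (run (shift u) B3) = 0" "prd (run u B3) (run (shift u) B2) = - E1"
      unfolding prd_slots(1) p e by simp_all
    then have q: "\<alpha> * \<delta>' - \<gamma> * \<beta>' = 1" "\<alpha> * \<gamma>' = \<gamma> * \<alpha>'" "\<beta> * \<delta>' = \<delta> * \<beta>'" "\<beta> * \<gamma>' - \<delta> * \<alpha>' = - 1"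
      unfolding r by (simp_all add: E1_def)
    have q4: "\<delta> * \<alpha>' - \<beta> * \<gamma>' = 1"
    proof -
      have "\<delta> * \<alpha>' - \<beta> * \<gamma>' = - (\<beta> * \<gamma>' - \<delta> * \<alpha>')" by simp
      then show ?thesis unfolding q(4) by simp
    qed
    have "(\<alpha> * \<delta> - \<beta> * \<gamma>) * \<alpha>' = \<alpha> * (\<delta> * \<alpha>') - \<beta> * (\<gamma> * \<alpha>')" by (simp add: algebra_simps)
    also have "\<dots> = \<alpha> * (\<delta> * \<alpha>' - \<beta> * \<gamma>')" unfolding q(2)[symmetric] by (simp add: algebra_simps)
    finally have a: "\<alpha> = (\<alpha> * \<delta> - \<beta> * \<gamma>) * \<alpha>'" unfolding q4 by simp
    have "(\<alpha> * \<delta> - \<beta> * \<gamma>) * \<gamma>' = \<delta> * (\<alpha> * \<gamma>') - \<gamma> * (\<beta> * \<gamma>')" by (simp add: algebra_simps)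
    also have "\<dots> = \<gamma> * (\<delta> * \<alpha>' - \<beta> * \<gamma>')" unfolding q(2) by (simp add: algebra_simps)
    finally have g: "\<gamma> = (\<alpha> * \<delta> - \<beta> * \<gamma>) * \<gamma>'" unfolding q4 by simp
    have "(\<alpha> * \<delta> - \<beta> * \<gamma>) * (\<alpha>' * \<delta>' - \<beta>' * \<gamma>')
      = ((\<alpha> * \<delta> - \<beta> * \<gamma>) * \<alpha>') * \<delta>' - ((\<alpha> * \<delta> - \<beta> * \<gamma>) * \<gamma>') * \<beta>'"
      by (simp add: algebra_simps)
    then have "(\<alpha> * \<delta> - \<beta> * \<gamma>) * (\<alpha>' * \<delta>' - \<beta>' * \<gamma>') = 1"
      unfolding a[symmetric] g[symmetric] q(1) .
    then show ?thesis using a g by blast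
  qed
  obtain \<alpha> \<gamma> where r1: "run w B2 = Vec 0 \<alpha> \<gamma> 0 0 0 0 0" using levi_image[OF w] by blast
  obtain \<beta> \<delta> where r2: "run w B3 = Vec 0 \<beta> \<delta> 0 0 0 0 0" using levi_image[OF w] by blast
  obtain \<alpha>1 \<gamma>1 where r3: "run (shift w) B2 = Vec 0 \<alpha>1 \<gamma>1 0 0 0 0 0" using levi_image[OF w1] by blast
  obtain \<beta>1 \<delta>1 where r4: "run (shift w) B3 = Vec 0 \<beta>1 \<delta>1 0 0 0 0 0" using levi_image[OF w1] by blast
  obtain \<alpha>2 \<gamma>2 where r5: "run (shift (shift w)) B2 = Vec 0 \<alpha>2 \<gamma>2 0 0 0 0 0" using levi_image[OF w2] by blast
  obtain \<beta>2 \<delta>2 where r6: "run (shift (shift w)) B3 = Vec 0 \<beta>2 \<delta>2 0 0 0 0 0" using levi_image[OF w2] by blast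
  let ?d = "\<alpha> * \<delta> - \<beta> * \<gamma>" and ?d1 = "\<alpha>1 * \<delta>1 - \<beta>1 * \<gamma>1" and ?d2 = "\<alpha>2 * \<delta>2 - \<beta>2 * \<gamma>2"
  have x1: "\<alpha> = ?d * \<alpha>1" "\<gamma> = ?d * \<gamma>1" "?d * ?d1 = 1" using d[OF w r1 r2 r3 r4] by blast+
  have x2: "\<alpha>1 = ?d1 * \<alpha>2" "\<gamma>1 = ?d1 * \<gamma>2" "?d1 * ?d2 = 1" using d[OF w1 r3 r4 r5 r6] by blast+
  have x3: "\<alpha>2 = ?d2 * \<alpha>" "\<gamma>2 = ?d2 * \<gamma>"
    using d[OF w2 r5 r6, of \<alpha> \<gamma> \<beta> \<delta>] r1 r2 by auto
  have "\<alpha>1 = ?d1 * (?d2 * \<alpha>)" "\<gamma>1 = ?d1 * (?d2 * \<gamma>)" using x2 x3 by metis+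
  then have "\<alpha>1 = \<alpha>" "\<gamma>1 = \<gamma>" using x2(3) by (simp_all add: mult.assoc[symmetric])
  then have y: "\<alpha> = ?d * \<alpha>" "\<gamma> = ?d * \<gamma>" using x1 by metis+
  have "\<alpha> \<noteq> 0 \<or> \<gamma> \<noteq> 0" using x1(3) by auto
  then have "?d = 1" using y by (metis mult_cancel_right1)
  then show ?thesis using r1 r2 by blast
qed

text \<open>The remaining basis vectors are dual to the fixed \<open>B2\<close> and
  \<open>B3\<close>: the bilinear form determines their images up to the span of \<open>B2\<close>
  and \<open>B3\<close>, and multiplication by \<open>F1\<close> excludes that part.\<close>

lemma levi_trivial:
  fixes w :: "'a::comm_ring_1 letter list"
  assumes w: "fix3 E1 w" "fix3 F1 w" and r: "run w B2 = B2" "run w B3 = B3"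
  shows "run w x = x"
proof -
  have fx: "run w E1 = E1" "run w F1 = F1" "run (shift w) F1 = F1" using w by (auto simp: fix3_def)
  note z = fix_zero_weight[OF w]
  have q: "run w v = v" if v: "v = Vec 0 0 0 0 0 1 0 0 \<or> v = Vec 0 0 0 0 0 0 1 0" for v
  proof -
    obtain a b c d e f g h where rv: "run w v = Vec a b c d e f g h" by (cases "run w v")
    have "bil (run w v) (run w E1) = bil v E1" "bil (run w v) (run w F1) = bil v F1"
      "bil (run w v) (run w B4) = bil v B4" "bil (run w v) (run w B8) = bil v B8"
      "bil (run w v) (run w B2) = bil v B2" "bil (run w v) (run w B3) = bil v B3" by (rule bil_run)+
    note b = this[unfolded fx z r rv]
    have "prd (run w v) (run (shift w) F1) = run (shift (shift w)) (prd v F1)" by (rule prd_slots)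
    moreover have "prd v F1 = 0" using v by (auto simp: F1_def)
    ultimately have "prd (Vec a b c d e f g h) F1 = 0" unfolding fx rv by simp
    then show ?thesis using b v unfolding rv by (auto simp: E1_def F1_def)
  qed
  have "agree w []"
    using fx z r q unfolding agree_def basis_def by (simp add: E1_def F1_def)
  then show ?thesis by (simp add: agree_iff)
qed

lemma central_fix3:
  assumes "\<forall>l\<in>set w. lnode l = A2"
  shows "fix3 E1 w" "fix3 F1 w"
proof -
  have 1: "run w E1 = E1 \<and> run w F1 = F1 \<and> shift w = w" using assms
  proof (induction w)
    case (Cons l w)
    then show ?case by (cases l) (auto simp: E1_def F1_def)
  qed simp
  then show "fix3 E1 w" "fix3 F1 w" by (simp_all add: fix3_def)
qed

text \<open>Lists SL2(q) as root group times transversal, each matrix given by its two columns. The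
  root element is kept apart so that it can be absorbed into the unipotent part.\<close>

definition levi_certificate :: "('a::small_field \<times> 'a letter list) list \<Rightarrow> bool" where
  "levi_certificate tab \<longleftrightarrow>
     list_all (\<lambda>(t, q). list_all (\<lambda>l. lnode l = A2) q) tab \<and>
     allf (\<lambda>\<alpha>. allf (\<lambda>\<beta>. allf (\<lambda>\<gamma>. allf (\<lambda>\<delta>. if \<alpha> * \<delta> - \<beta> * \<gamma> = 1 then
       list_ex (\<lambda>(t, q). run (Pos A2 t # q) B2 = Vec 0 \<alpha> \<gamma> 0 0 0 0 0 \<and>
          run (Pos A2 t # q) B3 = Vec 0 \<beta> \<delta> 0 0 0 0 0) tab else True))))"

lemma levi_word:
  fixes w :: "'a::small_field letter list"
  assumes levi: "levi_certificate tab" and w: "fix3 E1 w" "fix3 F1 w"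
  shows "\<exists>t q. (t, q) \<in> set tab \<and> (\<forall>l\<in>set q. lnode l = A2) \<and> (\<forall>x. run w x = run (Pos A2 t # q) x)"
proof -
  obtain \<alpha> \<beta> \<gamma> \<delta> where m: "\<alpha> * \<delta> - \<beta> * \<gamma> = 1" "run w B2 = Vec 0 \<alpha> \<gamma> 0 0 0 0 0"
    "run w B3 = Vec 0 \<beta> \<delta> 0 0 0 0 0"
    using levi_det[OF w] by blast
  have "list_ex (\<lambda>(t, q). run (Pos A2 t # q) B2 = Vec 0 \<alpha> \<gamma> 0 0 0 0 0 \<and>
          run (Pos A2 t # q) B3 = Vec 0 \<beta> \<delta> 0 0 0 0 0) tab"
    using levi m(1) unfolding levi_certificate_def allf_iff by presburger
  then obtain t q where tq: "(t, q) \<in> set tab" "run (Pos A2 t # q) B2 = Vec 0 \<alpha> \<gamma> 0 0 0 0 0"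
     "run (Pos A2 t # q) B3 = Vec 0 \<beta> \<delta> 0 0 0 0 0" unfolding list_ex_iff by auto
  let ?l = "Pos A2 t # q"
  have q: "\<forall>l\<in>set q. lnode l = A2" using levi tq(1) unfolding levi_certificate_def list_all_iff by auto
  then have l: "fix3 E1 ?l" "fix3 F1 ?l" using central_fix3[of ?l] by auto
  let ?w = "winv ?l @ w"
  have w': "fix3 E1 ?w" "fix3 F1 ?w" using fix3_append fix3_winv l w by blast+
  have "run ?w B2 = run (winv ?l) (run ?l B2)" "run ?w B3 = run (winv ?l) (run ?l B3)"
    using m(2,3) tq(2,3) by (metis run_append)+
  then have "run ?w B2 = B2" "run ?w B3 = B3" unfolding run_winv by auto
  then have t: "run ?w x = x" for x by (rule levi_trivial[OF w'])
  have "run w x = run ?l x" for x using t[of x] by (metis run_append run_winv')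
  then show ?thesis using tq(1) q by blast
qed

text \<open>Combines the elimination with the list of SL2(q); the letter \<open>Pos A2 t\<close>
  joins the positive word, which leaves only the transversal on the right.\<close>

lemma flag_stabilizer:
  fixes s :: "'a::small_field letter list"
  assumes elim: "elim_certificate (G1 :: 'a letter list list) G2 G3" and levi: "levi_certificate tab" and s: "fix3 E1 s"
  shows "\<exists>u q. posw u \<and> q \<in> snd ` set tab \<and> (\<forall>l\<in>set q. lnode l = A2) \<and> (\<forall>x. run s x = run (u @ q) x)"
proof -
  obtain u where u: "posw u" "fix3 E1 (u @ s)" "fix3 F1 (u @ s)" using eliminate[OF elim s] by blast
  obtain t q where tq: "(t, q) \<in> set tab" "\<forall>l\<in>set q. lnode l = A2"
    "\<And>x. run (u @ s) x = run (Pos A2 t # q) x" using levi_word[OF levi u(2,3)] by blast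
  have "run s x = run ((winv u @ [Pos A2 t]) @ q) x" for x
  proof -
    have "run (winv u) (run u (run s x)) = run (winv u) (run (Pos A2 t # q) x)" using tq(3)[of x] by simp
    then show ?thesis by simp
  qed
  moreover have "posw (winv u @ [Pos A2 t])" using posw_winv[OF u(1)] by (simp add: posw_simps)
  moreover have "q \<in> snd ` set tab" using tq(1) by force
  ultimately show ?thesis using tq(2) by blast
qed

text \<open>The unipotent radical of the parabolic subgroup of the central node: the first argument lists
  the block mapping the middle layer of the filtration to the bottom one.\<close>

fun qmap :: "'a::comm_ring_1 vec \<Rightarrow> 'a \<Rightarrow> 'a vec \<Rightarrow> 'a vec" where
  "qmap (Vec A B C D E F G H) z (Vec a b c d e f g h) = Vec
     (a + A * c + B * d + C * g + D * h - (A * C + B * D) * e + z * f)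
     (b + E * c + F * d + G * g + H * h - (E * G + F * H) * f - (A * G + C * E + B * H + D * F + z) * e)
     (c - C * e - G * f) (d - D * e - H * f) e f (g - A * e - E * f) (h - B * e - F * f)"

text \<open>The cocycle in the Heisenberg-type multiplication \<open>qmap_mult\<close>, where the
  first arguments add and z is a central coordinate, belonging to the highest root.\<close>

fun qform :: "'a::comm_ring_1 vec \<Rightarrow> 'a vec \<Rightarrow> 'a" where
  "qform (Vec A B C D E F G H) (Vec A' B' C' D' E' F' G' H') = A * G' + B * H' + C * E' + D * F'"

text \<open>Triality on the eight root coordinates of the radical modulo its centre. The coordinates
  C and E, for the roots \<alpha>_1 + \<alpha>_2 + \<alpha>_3 + \<alpha>_4 and \<alpha>_2, are
  fixed; the other six form two 3-cycles, one of them with signs.\<close>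

fun qrot :: "'a::comm_ring_1 vec \<Rightarrow> 'a vec" where
  "qrot (Vec A B C D E F G H) = Vec (- H) D C G E (- A) B F"

fun qact :: "node \<Rightarrow> 'a::comm_ring_1 \<Rightarrow> 'a vec \<Rightarrow> 'a vec" where
  "qact A1 t (Vec A B C D E F G H) = Vec (A + t * E) (B + t * F) (C + t * G) (D + t * H) E F G H"
| "qact A3 t (Vec A B C D E F G H) = Vec A (B - t * A) (C + t * D) D E (F - t * E) (G + t * H) H"
| "qact A4 t (Vec A B C D E F G H) = Vec A B (C + t * B) (D - t * A) E F (G + t * F) (H - t * E)"
| "qact A2 t m = m"

lemma qmap_mult: "qmap m z (qmap m' z' x) = qmap (m + m') (z + z' - qform m m') x"
  by (cases m; cases m'; cases x) (simp add: algebra_simps)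

lemma qmap_zero: "qmap 0 0 x = x"
  by (cases x) (simp add: zero_vec_def)

lemma qmap_inj: "(\<And>x. qmap m z x = qmap m' z' x) \<Longrightarrow> m = m'"
proof -
  assume a: "\<And>x. qmap m z x = qmap m' z' x"
  show ?thesis using a[of B3] a[of B4] a[of "Vec 0 0 0 0 0 0 1 0"] a[of B8] by (cases m; cases m') simp
qed

lemma step_qmap: "k \<noteq> A2 \<Longrightarrow> \<exists>z'. \<forall>x. step (Pos k t) (qmap m z x) = qmap (qact k t m) z' (step (Pos k t) x)"
proof -
  assume k: "k \<noteq> A2"
  obtain A B C D E F G H where m: "m = Vec A B C D E F G H" by (cases m)
  show ?thesis
  proof (cases k)
    case A1
    have "step (Pos A1 t) (qmap m z x) = qmap (qact A1 t m) (z - t * (E * G + F * H)) (step (Pos A1 t) x)" for x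
      by (cases x) (simp add: m algebra_simps)
    then show ?thesis using A1 by blast
  next
    case A3
    have "step (Pos A3 t) (qmap m z x) = qmap (qact A3 t m) z (step (Pos A3 t) x)" for x
      by (cases x) (simp add: m algebra_simps)
    then show ?thesis using A3 by blast
  next
    case A4
    have "step (Pos A4 t) (qmap m z x) = qmap (qact A4 t m) z (step (Pos A4 t) x)" for x
      by (cases x) (simp add: m algebra_simps)
    then show ?thesis using A4 by blast
  qed (use k in simp)
qed

lemma step_central: "step (Pos A2 t) x = qmap (Vec 0 0 0 0 t 0 0 0) 0 x"
  by (cases x) simp

lemma qrot_qact: "k \<noteq> A2 \<Longrightarrow> qrot (qact k t m) = qact (tri k) t (qrot m)"
  by (cases k; cases m) (simp_all add: algebra_simps)

lemma qrot_add: "qrot (m + m') = qrot m + qrot m'" by (cases m; cases m') simp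

fun chi :: "node \<Rightarrow> 'a::comm_ring_1 letter list \<Rightarrow> 'a" where
  "chi k [] = 0"
| "chi k (Pos j t # w) = (if j = k then t + chi k w else chi k w)"
| "chi k (Neg j t # w) = chi k w"

lemma chi_append: "chi k (u @ w) = chi k u + chi k w"
  by (induction k u rule: chi.induct) auto

lemma chi_winv: "chi k (winv w) = - chi k w"
  by (induction k w rule: chi.induct) (auto simp: chi_append)

lemma chi_shift: "chi A1 (shift w) = chi A4 w" "chi A3 (shift w) = chi A1 w" "chi A4 (shift w) = chi A3 w"
proof -
  have "chi A1 (shift w) = chi A4 w \<and> chi A3 (shift w) = chi A1 w \<and> chi A4 (shift w) = chi A3 w"
  proof (induction w)
    case (Cons l w)
    show ?case
    proof (cases l)
      case (Pos k t) then show ?thesis using Cons by (cases k) auto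
    next
      case (Neg k t) then show ?thesis using Cons by (cases k) auto
    qed
  qed simp
  then show "chi A1 (shift w) = chi A4 w" "chi A3 (shift w) = chi A1 w" "chi A4 (shift w) = chi A3 w" by auto
qed

definition nword :: "'a \<Rightarrow> 'a \<Rightarrow> 'a \<Rightarrow> 'a::comm_ring_1 letter list" where
  "nword a b c = [Pos A1 a, Pos A3 b, Pos A4 c]"

lemma nword_step:
  "step (Pos A1 t) (run (nword a b c) x) = run (nword (t + a) b c) x"
  "step (Pos A3 t) (run (nword a b c) x) = run (nword a (t + b) c) x"
  "step (Pos A4 t) (run (nword a b c) x) = run (nword a b (t + c)) x"
  by (cases x; simp add: nword_def algebra_simps)+

lemma nword_zero: "run (nword 0 0 0) x = x" by (cases x) (simp add: nword_def)

text \<open>Letters at the central node go into the radical, the others are collected in one root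
  element for each outer node. Both a word and its shift are followed, since the induction is what
  shows that shifting acts on the radical as \<open>qrot\<close>; only the central coordinates are
  left undetermined.\<close>

lemma posw_normal_form:
  assumes "posw u"
  shows "\<exists>m z z'. (\<forall>x. run u x = qmap m z (run (nword (chi A1 u) (chi A3 u) (chi A4 u)) x)) \<and>
     (\<forall>x. run (shift u) x = qmap (qrot m) z' (run (nword (chi A4 u) (chi A1 u) (chi A3 u)) x))"
  using assms
proof (induction u)
  case Nil
  have z: "qrot (0 :: 'a vec) = 0" by (simp add: zero_vec_def)
  show ?case by (intro exI[of _ 0]) (simp add: nword_zero z qmap_zero)
next
  case (Cons l u)
  then obtain m z z' where u: "\<And>x. run u x = qmap m z (run (nword (chi A1 u) (chi A3 u) (chi A4 u)) x)"
    "\<And>x. run (shift u) x = qmap (qrot m) z' (run (nword (chi A4 u) (chi A1 u) (chi A3 u)) x)"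
    by (auto simp: posw_simps)
  obtain k t where l: "l = Pos k t" using Cons.prems by (cases l) (auto simp: posw_simps)
  show ?case
  proof (cases "k = A2")
    case True
    have e: "qrot (Vec 0 0 0 0 t 0 0 0 + m) = Vec 0 0 0 0 t 0 0 0 + qrot m" unfolding qrot_add by simp
    show ?thesis
      by (rule exI[of _ "Vec 0 0 0 0 t 0 0 0 + m"]) (simp add: l True u step_central qmap_mult e, blast)
  next
    case False
    have False': "tri k \<noteq> A2" using False by (cases k) auto
    obtain y where y: "\<And>x. step (Pos k t) (qmap m z x) = qmap (qact k t m) y (step (Pos k t) x)"
      using step_qmap[OF False] by blast
    obtain y' where y': "\<And>x. step (Pos (tri k) t) (qmap (qrot m) z' x) = qmap (qact (tri k) t (qrot m)) y' (step (Pos (tri k) t) x)"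
      using step_qmap[OF False'] by blast
    have N: "step (Pos k t) (run (nword (chi A1 u) (chi A3 u) (chi A4 u)) x)
        = run (nword (chi A1 (l # u)) (chi A3 (l # u)) (chi A4 (l # u))) x"
      "step (Pos (tri k) t) (run (nword (chi A4 u) (chi A1 u) (chi A3 u)) x)
        = run (nword (chi A4 (l # u)) (chi A1 (l # u)) (chi A3 (l # u))) x" for x
      using False by (cases k; simp add: l nword_step)+
    have "run (l # u) x = qmap (qact k t m) y (step (Pos k t) (run (nword (chi A1 u) (chi A3 u) (chi A4 u)) x))" for x
      by (simp add: l u y)
    moreover have "run (shift (l # u)) x = qmap (qrot (qact k t m)) y'
       (step (Pos (tri k) t) (run (nword (chi A4 u) (chi A1 u) (chi A3 u)) x))" for x
      by (simp add: l u y' qrot_qact[OF False])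
    ultimately show ?thesis unfolding N by blast
  qed
qed

section \<open>Normalising positive words of order 3 in the triality coset\<close>

definition order3 :: "'a::comm_ring_1 letter list \<Rightarrow> bool" where
  "order3 s \<longleftrightarrow> (\<forall>x. run s (run (shift s) (run (shift (shift s)) x)) = x)"

lemma order3_conj: "order3 s \<Longrightarrow> order3 (winv v @ s @ shift v)"
  by (simp add: order3_def shift_winv)

definition comm :: "'a::comm_ring_1 letter list \<Rightarrow> 'a letter list \<Rightarrow> 'a letter list" where
  "comm u w = winv u @ winv w @ u @ w"

text \<open>Commutator words for the roots \<alpha>_1 + \<alpha>_2, \<alpha>_2 + \<alpha>_3,
  \<alpha>_1 + \<alpha>_2 + \<alpha>_3 and \<alpha>_2 + \<alpha>_3 + \<alpha>_4, two out of each of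
  the 3-cycles of \<open>qrot\<close>.\<close>

definition r1w :: "'a::comm_ring_1 \<Rightarrow> 'a letter list" where "r1w t = comm [Pos A1 1] [Pos A2 t]"
definition r3w :: "'a::comm_ring_1 \<Rightarrow> 'a letter list" where "r3w t = comm [Pos A3 1] [Pos A2 t]"
definition r13w :: "'a::comm_ring_1 \<Rightarrow> 'a letter list" where "r13w t = comm [Pos A3 1] (r1w t)"
definition r34w :: "'a::comm_ring_1 \<Rightarrow> 'a letter list" where "r34w t = comm [Pos A4 1] (r3w t)"

lemma root_words:
  "run (r1w t) x = qmap (Vec t 0 0 0 0 0 0 0) 0 x"
  "run (r3w t) x = qmap (Vec 0 0 0 0 0 (- t) 0 0) 0 x"
  "run (r13w t) x = qmap (Vec 0 (- t) 0 0 0 0 0 0) 0 x"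
  "run (r34w t) x = qmap (Vec 0 0 0 0 0 0 (- t) 0) 0 x"
  by (cases x; simp add: r13w_def r34w_def r1w_def r3w_def comm_def algebra_simps)+

text \<open>An additive Hilbert 90 argument: the outer node parameters are permuted cyclically,
  order 3 forces their sum to be 0, and a triple of sum 0 is a difference of a triple and its
  rotation. The word ?v realises that triple.\<close>

lemma conj_to_radical:
  fixes s :: "'a::comm_ring_1 letter list"
  assumes s: "posw s" and o: "order3 s"
  shows "\<exists>v. posw v \<and> chi A1 (winv v @ s @ shift v) = 0 \<and> chi A3 (winv v @ s @ shift v) = 0 \<and>
    chi A4 (winv v @ s @ shift v) = 0"
proof -
  let ?W = "s @ shift s @ shift (shift s)" and ?S = "chi A1 s + chi A3 s + chi A4 s"
  have W: "posw ?W" using s posw_shift by (auto simp: posw_simps)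
  have c: "chi A1 ?W = ?S" "chi A3 ?W = ?S" "chi A4 ?W = ?S" by (simp_all add: chi_append chi_shift)
  obtain m z where "\<And>x. run ?W x = qmap m z (run (nword ?S ?S ?S) x)"
    using posw_normal_form[OF W] unfolding c by blast
  \<comment> \<open>The first coordinate of the left-hand side is the sum ?S, since the radical does
    not affect the bottom layer of the filtration.\<close>
  then have "qmap m z (run (nword ?S ?S ?S) B2) = (B2 :: 'a vec)" using o by (simp add: order3_def)
  then have S: "?S = 0" by (cases m) (simp add: nword_def)
  let ?v = "nword (chi A1 s) (chi A3 s + chi A1 s) 0"
  have "chi A4 s = - (chi A1 s + chi A3 s)" using minus_unique[OF S] by simp
  then have "posw ?v \<and> chi A1 (winv ?v @ s @ shift ?v) = 0 \<and> chi A3 (winv ?v @ s @ shift ?v) = 0 \<and>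
    chi A4 (winv ?v @ s @ shift ?v) = 0"
    by (simp add: chi_append chi_winv chi_shift nword_def posw_simps del: winv_simps)
  then show ?thesis by blast
qed

lemma radical_form:
  assumes "posw s" "chi A1 s = 0" "chi A3 s = 0" "chi A4 s = 0"
  shows "\<exists>m z z'. (\<forall>x. run s x = qmap m z x) \<and> (\<forall>x. run (shift s) x = qmap (qrot m) z' x)"
  using posw_normal_form[OF assms(1)] unfolding assms(2-4) nword_zero .

text \<open>The same argument on the two 3-cycles of \<open>qrot\<close>. The rotation sum of m is
  0, so conjugating by suitable root elements clears these six coordinates; the fixed coordinates C
  and E and a central one remain.\<close>

lemma conj_in_radical:
  fixes s :: "'a::comm_ring_1 letter list"
  assumes s: "posw s" "chi A1 s = 0" "chi A3 s = 0" "chi A4 s = 0" and o: "order3 s"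
  shows "\<exists>v b c z. posw v \<and> (\<forall>x. run (winv v @ s @ shift v) x = qmap (Vec 0 0 c 0 b 0 0 0) z x)"
proof -
  obtain m z z' where m: "\<And>x. run s x = qmap m z x" "\<And>x. run (shift s) x = qmap (qrot m) z' x"
    using radical_form[OF s] by blast
  have s1: "posw (shift s)" "chi A1 (shift s) = 0" "chi A3 (shift s) = 0" "chi A4 (shift s) = 0"
    using s by (simp_all add: posw_shift chi_shift)
  obtain m1 z1 z2 where m1: "\<And>x. run (shift s) x = qmap m1 z1 x" "\<And>x. run (shift (shift s)) x = qmap (qrot m1) z2 x"
    using radical_form[OF s1] by blast
  have "m1 = qrot m" using m(2) m1(1) qmap_inj[of m1 z1 "qrot m" z'] by metis
  then have m2: "\<And>x. run (shift (shift s)) x = qmap (qrot (qrot m)) z2 x" using m1 by simp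
  have "qmap m z (qmap (qrot m) z' (qmap (qrot (qrot m)) z2 x)) = qmap 0 0 x" for x
    using o unfolding order3_def m m2 qmap_zero by blast
  then have sum0: "m + (qrot m + qrot (qrot m)) = 0" unfolding qmap_mult by (rule qmap_inj)
  obtain A B C D E F G H where mm: "m = Vec A B C D E F G H" by (cases m)
  let ?v = "r1w A @ r3w (A - F) @ r13w (- B) @ r34w (- (G + B))"
  let ?mv = "Vec A B 0 0 0 (F - A) (G + B) 0"
  have v: "posw ?v" "chi A1 ?v = 0" "chi A3 ?v = 0" "chi A4 ?v = 0"
    by (simp_all add: r13w_def r34w_def r1w_def r3w_def comm_def posw_simps)
  define y where "y = - (A * (G + B))"
  have y: "run ?v x = qmap ?mv y x" for x
    by (simp add: y_def root_words qmap_mult add.commute)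
  obtain n y1 y2 where n: "\<And>x. run ?v x = qmap n y1 x" "\<And>x. run (shift ?v) x = qmap (qrot n) y2 x"
    using radical_form[OF v] by blast
  have "n = ?mv" using n(1) y qmap_inj[of n y1 ?mv y] by metis
  then have v': "\<And>x. run (shift ?v) x = qmap (qrot ?mv) y2 x" using n by simp
  have vi: "run (winv ?v) x = qmap (- ?mv) (- y + qform (- ?mv) ?mv) x" for x
  proof -
    have "qmap (- ?mv) (- y + qform (- ?mv) ?mv) (run ?v (run (winv ?v) x)) = qmap 0 0 (run (winv ?v) x)"
      unfolding y qmap_mult by (simp add: zero_vec_def)
    then show ?thesis by (simp only: run_winv' qmap_zero)
  qed
  have s4: "D + (G + B) = 0" and s8: "H + (F - A) = 0" using sum0 unfolding mm by simp_all
  have e: "- ?mv + (m + qrot ?mv) = Vec 0 0 C 0 E 0 0 0"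
    using s4 s8 unfolding mm by simp
  define V where "V = ?v"
  define M where "M = ?mv"
  have 1: "run (winv V) x = qmap (- M) (- y + qform (- M) M) x" for x unfolding V_def M_def by (rule vi)
  have 2: "run (shift V) x = qmap (qrot M) y2 x" for x unfolding V_def M_def by (rule v')
  have "run (winv V @ s @ shift V) x = run (winv V) (run s (run (shift V) x))" for x by (simp only: run_append)
  then have "run (winv V @ s @ shift V) x = qmap (- M) (- y + qform (- M) M) (qmap m z (qmap (qrot M) y2 x))" for x
    unfolding 1 2 m(1) .
  then have "\<forall>x. run (winv V @ s @ shift V) x = qmap (- M + (m + qrot M))
     (- y + qform (- M) M + (z + y2 - qform m (qrot M)) - qform (- M) (m + qrot M)) x"
    unfolding qmap_mult by blast
  then have "\<forall>x. run (winv V @ s @ shift V) x = qmap (Vec 0 0 C 0 E 0 0 0)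
     (- y + qform (- M) M + (z + y2 - qform m (qrot M)) - qform (- M) (m + qrot M)) x"
    unfolding e[folded M_def] .
  then show ?thesis using v(1)[folded V_def] by blast
qed

lemma conj_order3_posw:
  fixes s :: "'a::comm_ring_1 letter list"
  assumes "posw s" "order3 s"
  shows "\<exists>v b c z. \<forall>x. run (winv v @ s @ shift v) x = qmap (Vec 0 0 c 0 b 0 0 0) z x"
proof -
  obtain v where v: "posw v" "chi A1 (winv v @ s @ shift v) = 0" "chi A3 (winv v @ s @ shift v) = 0"
    "chi A4 (winv v @ s @ shift v) = 0" using conj_to_radical[OF assms] by blast
  have p: "posw (winv v @ s @ shift v)" using v(1) assms(1) by (simp add: posw_simps posw_winv posw_shift)
  obtain v' b c z where "\<And>x. run (winv v' @ (winv v @ s @ shift v) @ shift v') x = qmap (Vec 0 0 c 0 b 0 0 0) z x"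
    using conj_in_radical[OF p v(2-4) order3_conj[OF assms(2)]] by blast
  then have "\<forall>x. run (winv (v @ v') @ s @ shift (v @ v')) x = qmap (Vec 0 0 c 0 b 0 0 0) z x" by simp
  then show ?thesis by blast
qed

section \<open>Evaluated certificates for flags, Levi factors and the final normal forms\<close>

lemma flag_certificate_f2: "flag_certificate
    ([[Pos A2 1, Pos A1 1],
     [Pos A3 1, Neg A3 1],
     [Pos A1 1, Neg A1 1, Pos A1 1],
     [Pos A2 1, Neg A2 1, Pos A2 1],
     [Neg A3 1, Pos A3 1],
     [Pos A2 1],
     [Pos A4 1, Neg A4 1, Pos A4 1, Pos A2 1, Neg A2 1, Pos A2 1, Pos A1 1, Neg A1 1, Pos A1 1]] :: f2 letter list list)
    [[Neg A2 1, Pos A2 1],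
     [Neg A4 1, Pos A4 1],
     [Neg A1 1, Pos A1 1]]
    [[Neg A2 1, Pos A2 1],
     [Neg A1 1, Pos A1 1]]"
  by code_simp

lemma elim_certificate_f2: "elim_certificate
    ([[Pos A1 1],
     [Pos A2 1, Pos A3 1],
     [Pos A1 1, Pos A2 1, Pos A1 1, Pos A2 1],
     [Pos A2 1, Pos A4 1],
     [Pos A3 1, Pos A2 1, Pos A4 1, Pos A2 1, Pos A4 1, Pos A1 1, Pos A4 1, Pos A2 1, Pos A4 1, Pos A2 1, Pos A1 1],
     [Pos A2 1, Pos A1 1, Pos A2 1, Pos A1 1, Pos A3 1, Pos A1 1, Pos A2 1, Pos A1 1, Pos A2 1, Pos A3 1],
     [Pos A4 1, Pos A3 1, Pos A2 1, Pos A1 1, Pos A2 1, Pos A1 1, Pos A3 1, Pos A1 1, Pos A2 1, Pos A1 1, Pos A2 1, Pos A4 1, Pos A2 1, Pos A1 1, Pos A2 1, Pos A1 1, Pos A3 1, Pos A1 1, Pos A2 1, Pos A1 1, Pos A2 1, Pos A3 1, Pos A2 1, Pos A3 1, Pos A2 1, Pos A1 1, Pos A2 1, Pos A1 1, Pos A3 1, Pos A1 1, Pos A2 1, Pos A1 1, Pos A2 1, Pos A4 1, Pos A2 1, Pos A1 1, Pos A2 1, Pos A1 1, Pos A3 1, Pos A1 1, Pos A2 1, Pos A1 1, Pos A2 1, Pos A3 1, Pos A4 1, Pos A2 1]] :: f2 letter list list)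
    [[Pos A1 1],
     [Pos A4 1, Pos A1 1, Pos A2 1, Pos A1 1, Pos A2 1]]
    [[Pos A1 1],
     [Pos A1 1, Pos A2 1, Pos A1 1, Pos A2 1]]"
  by code_simp

lemma flag_certificate_f3: "flag_certificate
    ([[Pos A2 1, Pos A1 1],
     [Pos A3 (- 1), Neg A3 1],
     [Pos A1 1, Neg A1 (- 1)],
     [Pos A2 1, Neg A2 (- 1)],
     [Neg A3 1, Pos A3 (- 1)],
     [Neg A2 (- 1), Pos A2 1],
     [Pos A4 1, Neg A4 (- 1), Pos A4 1, Pos A2 1, Neg A2 (- 1), Pos A2 1, Pos A1 1, Neg A1 (- 1), Pos A1 1],
     [Pos A1 1, Neg A1 (- 1), Pos A1 (- 1), Neg A1 (- 1), Pos A1 1]] :: f3 letter list list)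
    [[Neg A2 1, Pos A2 1],
     [Neg A4 1, Pos A4 (- 1)],
     [Neg A1 1, Pos A1 1],
     [Neg A2 1, Pos A2 (- 1)],
     [Neg A1 1, Pos A1 (- 1)],
     [Pos A1 1, Neg A1 (- 1), Pos A1 (- 1), Neg A1 (- 1), Pos A1 1]]
    [[Neg A2 1, Pos A2 1],
     [Neg A1 1, Pos A1 1],
     [Neg A2 1, Pos A2 (- 1)],
     [Neg A1 1, Pos A1 (- 1)],
     [Pos A1 1, Neg A1 (- 1), Pos A1 (- 1), Neg A1 (- 1), Pos A1 1]]"
  by code_simp

lemma elim_certificate_f3: "elim_certificate
    ([[Pos A1 1],
     [Pos A2 (- 1), Pos A3 1],
     [Pos A3 (- 1)],
     [Pos A2 1, Pos A3 1],
     [Pos A1 (- 1), Pos A2 (- 1), Pos A1 1, Pos A2 1],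
     [Pos A2 1, Pos A4 1],
     [Pos A2 1, Pos A4 (- 1)],
     [Pos A1 (- 1), Pos A3 (- 1), Pos A2 (- 1), Pos A3 1, Pos A2 1],
     [Pos A4 1, Pos A2 (- 1), Pos A1 (- 1), Pos A2 1, Pos A1 1],
     [Pos A4 (- 1), Pos A3 (- 1), Pos A2 (- 1), Pos A1 (- 1), Pos A2 1, Pos A1 1, Pos A3 1, Pos A1 (- 1), Pos A2 (- 1), Pos A1 1, Pos A2 1],
     [Pos A2 (- 1), Pos A1 (- 1), Pos A2 1, Pos A1 1, Pos A3 (- 1), Pos A1 (- 1), Pos A2 (- 1), Pos A1 1, Pos A2 1, Pos A3 1],
     [Pos A4 (- 1), Pos A3 (- 1), Pos A2 (- 1), Pos A1 (- 1), Pos A2 1, Pos A1 1, Pos A3 1, Pos A1 (- 1), Pos A2 (- 1), Pos A1 1, Pos A2 1, Pos A4 1, Pos A2 (- 1), Pos A1 (- 1), Pos A2 1, Pos A1 1, Pos A3 (- 1), Pos A1 (- 1), Pos A2 (- 1), Pos A1 1, Pos A2 1, Pos A3 1, Pos A2 (- 1), Pos A3 (- 1), Pos A2 (- 1), Pos A1 (- 1), Pos A2 1, Pos A1 1, Pos A3 1, Pos A1 (- 1), Pos A2 (- 1), Pos A1 1, Pos A2 1, Pos A4 (- 1), Pos A2 (- 1), Pos A1 (- 1), Pos A2 1, Pos A1 1, Pos A3 (- 1), Pos A1 (- 1), Pos A2 (- 1), Pos A1 1, Pos A2 1, Pos A3 1, Pos A4 1, Pos A2 1]] :: f3 letter list 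list)
    [[Pos A1 1],
     [Pos A1 (- 1), Pos A2 (- 1), Pos A1 1, Pos A2 1],
     [Pos A4 1, Pos A2 (- 1), Pos A1 (- 1), Pos A2 1, Pos A1 1]]
    [[Pos A1 1],
     [Pos A1 (- 1), Pos A2 (- 1), Pos A1 1, Pos A2 1]]"
  by code_simp

text \<open>The subgroup of order 3 of SL2(2), a transversal to the root group of order 2.\<close>

definition levi2 :: "f2 letter list list" where "levi2 =
    [[],
     [Pos A2 1, Neg A2 1],
     [Neg A2 1, Pos A2 1]]"

lemma levi_certificate_f2: "levi_certificate (map (Pair 0) levi2 @ map (Pair 1) levi2)"
  by code_simp

text \<open>The quaternion group of order 8 in SL2(3). That the words form a group up to their
  action is \<open>levi3_closed\<close>; this is what makes them usable as the factor of order prime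
  to 3.\<close>

definition levi3 :: "f3 letter list list" where "levi3 =
    [[],
     [Pos A2 1, Neg A2 (- 1), Pos A2 1],
     [Pos A2 1, Neg A2 (- 1), Pos A2 (- 1), Neg A2 (- 1), Pos A2 1],
     [Pos A2 (- 1), Neg A2 1, Pos A2 (- 1)],
     [Pos A2 (- 1), Neg A2 (- 1)],
     [Neg A2 1, Pos A2 1],
     [Pos A2 1, Neg A2 1],
     [Neg A2 (- 1), Pos A2 (- 1)]]"

lemma levi_certificate_f3: "levi_certificate (map (Pair 0) levi3 @ map (Pair 1) levi3 @ map (Pair (- 1)) levi3)"
  by code_simp

text \<open>The triple (b, c, z) gives the coordinates at the three positive roots fixed by
  triality: \<alpha>_2, \<alpha>_1 + \<alpha>_2 + \<alpha>_3 + \<alpha>_4 and their sum, the highest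
  root. For each of the 26 nonzero triples the word g conjugates \<open>[Pos A2 1]\<close> times r
  to the corresponding element, so all of them lie in a single class.\<close>

definition okubo_table :: "((f3 \<times> f3 \<times> f3) \<times> f3 letter list) list" where "okubo_table =
    [((0, 0, 1), [Pos A1 1, Neg A1 (- 1), Pos A1 1, Pos A3 1, Neg A3 (- 1), Pos A3 1, Pos A4 1, Neg A4 (- 1), Pos A4 1, Pos A2 (- 1), Neg A2 1]),
     ((0, 0, - 1), [Pos A1 1, Neg A1 (- 1), Pos A1 1, Pos A3 1, Neg A3 (- 1), Pos A3 1, Pos A4 1, Neg A4 (- 1), Pos A4 1, Pos A2 1, Neg A2 (- 1)]),
     ((0, 1, 0), [Pos A1 1, Neg A1 (- 1), Pos A1 1, Pos A3 1, Neg A3 (- 1), Pos A3 1, Pos A4 1, Neg A4 (- 1), Pos A4 1]),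
     ((0, 1, 1), [Pos A1 1, Neg A1 (- 1), Pos A1 1, Pos A3 1, Neg A3 (- 1), Pos A3 1, Pos A4 1, Neg A4 (- 1), Pos A4 1, Pos A2 (- 1)]),
     ((0, 1, - 1), [Pos A1 1, Neg A1 (- 1), Pos A1 1, Pos A3 1, Neg A3 (- 1), Pos A3 1, Pos A4 1, Neg A4 (- 1), Pos A4 1, Pos A2 1]),
     ((0, - 1, 0), [Pos A1 1, Neg A1 (- 1), Pos A1 1, Pos A3 1, Neg A3 (- 1), Pos A3 1, Pos A4 1, Neg A4 (- 1), Pos A4 1, Pos A2 1, Neg A2 1, Pos A2 1]),
     ((0, - 1, 1), [Pos A1 1, Neg A1 (- 1), Pos A1 1, Pos A3 1, Neg A3 (- 1), Pos A3 1, Pos A4 1, Neg A4 (- 1), Pos A4 1, Pos A2 (- 1), Neg A2 (- 1)]),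
     ((0, - 1, - 1), [Pos A1 1, Neg A1 (- 1), Pos A1 1, Pos A3 1, Neg A3 (- 1), Pos A3 1, Pos A4 1, Neg A4 (- 1), Pos A4 1, Pos A2 1, Neg A2 1]),
     ((1, 0, 0), []),
     ((1, 0, 1), [Pos A1 1, Pos A3 1, Pos A4 1, Pos A2 (- 1), Pos A1 (- 1), Pos A3 (- 1), Pos A4 (- 1)]),
     ((1, 0, - 1), [Pos A1 1, Pos A3 1, Pos A4 1, Pos A2 1, Pos A1 (- 1), Pos A3 (- 1), Pos A4 (- 1)]),
     ((1, 1, 0), [Pos A1 1, Pos A2 (- 1), Pos A3 (- 1), Pos A2 1, Pos A4 (- 1), Pos A2 (- 1), Pos A1 1, Pos A2 1, Neg A2 (- 1), Pos A2 (- 1), Neg A2 (- 1), Pos A2 1]),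
     ((1, 1, 1), [Pos A1 1, Pos A2 1, Pos A4 (- 1), Pos A2 (- 1), Pos A3 (- 1), Pos A2 1, Pos A1 1, Pos A2 1, Neg A2 (- 1), Pos A2 (- 1), Neg A2 (- 1), Pos A2 (- 1)]),
     ((1, 1, - 1), [Pos A1 1, Pos A2 1, Pos A4 (- 1), Pos A2 (- 1), Pos A3 (- 1), Pos A2 1, Pos A1 1, Pos A2 1, Neg A2 (- 1), Pos A2 (- 1), Neg A2 (- 1), Pos A2 1]),
     ((1, - 1, 0), [Pos A1 1, Pos A2 (- 1), Pos A3 (- 1), Pos A2 1, Pos A4 (- 1), Pos A2 (- 1), Pos A1 1]),
     ((1, - 1, 1), [Pos A1 1, Pos A2 1, Pos A4 (- 1), Pos A2 (- 1), Pos A3 (- 1), Pos A2 1, Pos A1 1]),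
     ((1, - 1, - 1), [Pos A1 1, Pos A2 1, Pos A4 (- 1), Pos A2 (- 1), Pos A3 (- 1), Pos A2 1, Pos A1 1, Pos A2 1]),
     ((- 1, 0, 0), [Pos A1 1, Neg A1 (- 1), Pos A1 1, Pos A3 1, Neg A3 (- 1), Pos A3 1, Pos A4 1, Neg A4 (- 1), Pos A4 1, Pos A1 1, Neg A1 (- 1), Pos A1 1, Pos A3 1, Neg A3 (- 1), Pos A3 1, Pos A4 1, Neg A4 (- 1), Pos A4 1]),
     ((- 1, 0, 1), [Pos A1 1, Neg A1 (- 1), Pos A1 1, Pos A3 1, Neg A3 (- 1), Pos A3 1, Pos A4 1, Neg A4 (- 1), Pos A4 1, Pos A1 1, Neg A1 (- 1), Pos A1 1, Pos A3 1, Neg A3 (- 1), Pos A3 1, Pos A4 1, Neg A4 (- 1), Pos A4 1, Pos A1 1, Pos A3 1, Pos A4 1, Pos A2 1, Pos A1 (- 1), Pos A3 (- 1), Pos A4 (- 1)]),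
     ((- 1, 0, - 1), [Pos A1 1, Neg A1 (- 1), Pos A1 1, Pos A3 1, Neg A3 (- 1), Pos A3 1, Pos A4 1, Neg A4 (- 1), Pos A4 1, Pos A1 1, Neg A1 (- 1), Pos A1 1, Pos A3 1, Neg A3 (- 1), Pos A3 1, Pos A4 1, Neg A4 (- 1), Pos A4 1, Pos A1 1, Pos A3 1, Pos A4 1, Pos A2 (- 1), Pos A1 (- 1), Pos A3 (- 1), Pos A4 (- 1)]),
     ((- 1, 1, 0), [Pos A1 1, Neg A1 (- 1), Pos A1 1, Pos A3 1, Neg A3 (- 1), Pos A3 1, Pos A4 1, Neg A4 (- 1), Pos A4 1, Pos A1 1, Neg A1 (- 1), Pos A1 1, Pos A3 1, Neg A3 (- 1), Pos A3 1, Pos A4 1, Neg A4 (- 1), Pos A4 1, Pos A1 1, Pos A2 1, Pos A3 (- 1), Pos A2 (- 1), Pos A4 (- 1), Pos A2 1, Pos A1 1]),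
     ((- 1, 1, 1), [Pos A1 1, Neg A1 (- 1), Pos A1 1, Pos A3 1, Neg A3 (- 1), Pos A3 1, Pos A4 1, Neg A4 (- 1), Pos A4 1, Pos A1 1, Neg A1 (- 1), Pos A1 1, Pos A3 1, Neg A3 (- 1), Pos A3 1, Pos A4 1, Neg A4 (- 1), Pos A4 1, Pos A1 1, Pos A2 (- 1), Pos A4 (- 1), Pos A2 1, Pos A3 (- 1), Pos A2 (- 1), Pos A1 1]),
     ((- 1, 1, - 1), [Pos A1 1, Neg A1 (- 1), Pos A1 1, Pos A3 1, Neg A3 (- 1), Pos A3 1, Pos A4 1, Neg A4 (- 1), Pos A4 1, Pos A1 1, Neg A1 (- 1), Pos A1 1, Pos A3 1, Neg A3 (- 1), Pos A3 1, Pos A4 1, Neg A4 (- 1), Pos A4 1, Pos A1 1, Pos A2 1, Pos A3 (- 1), Pos A2 (- 1), Pos A4 (- 1), Pos A2 1, Pos A1 1, Pos A2 1]),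
     ((- 1, - 1, 0), [Pos A1 1, Pos A2 (- 1), Pos A3 (- 1), Pos A2 1, Pos A4 (- 1), Pos A2 (- 1), Pos A1 1, Pos A2 1, Neg A2 (- 1), Pos A2 (- 1), Neg A2 (- 1), Pos A2 1, Pos A1 1, Neg A1 (- 1), Pos A1 1, Pos A3 1, Neg A3 (- 1), Pos A3 1, Pos A4 1, Neg A4 (- 1), Pos A4 1, Pos A1 1, Neg A1 (- 1), Pos A1 1, Pos A3 1, Neg A3 (- 1), Pos A3 1, Pos A4 1, Neg A4 (- 1), Pos A4 1]),
     ((- 1, - 1, 1), [Pos A1 1, Pos A2 1, Pos A4 (- 1), Pos A2 (- 1), Pos A3 (- 1), Pos A2 1, Pos A1 1, Pos A2 1, Neg A2 (- 1), Pos A2 (- 1), Neg A2 (- 1), Pos A2 1, Pos A1 1, Neg A1 (- 1), Pos A1 1, Pos A3 1, Neg A3 (- 1), Pos A3 1, Pos A4 1, Neg A4 (- 1), Pos A4 1, Pos A1 1, Neg A1 (- 1), Pos A1 1, Pos A3 1, Neg A3 (- 1), Pos A3 1, Pos A4 1, Neg A4 (- 1), Pos A4 1, Pos A2 (- 1)]),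
     ((- 1, - 1, - 1), [Pos A1 1, Pos A2 1, Pos A4 (- 1), Pos A2 (- 1), Pos A3 (- 1), Pos A2 1, Pos A1 1, Pos A2 1, Neg A2 (- 1), Pos A2 (- 1), Neg A2 (- 1), Pos A2 1, Pos A1 1, Neg A1 (- 1), Pos A1 1, Pos A3 1, Neg A3 (- 1), Pos A3 1, Pos A4 1, Neg A4 (- 1), Pos A4 1, Pos A1 1, Neg A1 (- 1), Pos A1 1, Pos A3 1, Neg A3 (- 1), Pos A3 1, Pos A4 1, Neg A4 (- 1), Pos A4 1])]"

lemma okubo_table:
  "list_all (\<lambda>((b, c, z), g). map (run (winv g @ [Pos A2 1] @ shift g)) basis = map (qmap (Vec 0 0 c 0 b 0 0 0) z) basis) okubo_table"
  by code_simp

lemma okubo_table_complete: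
  "allf (\<lambda>b. allf (\<lambda>c. allf (\<lambda>z. if b = 0 \<and> c = 0 \<and> z = 0 then True else (b, c, z) \<in> fst ` set okubo_table)))"
  by code_simp

lemma levi3_closed: "list_all (\<lambda>u. list_all (\<lambda>w. list_ex (agree (u @ w)) levi3) levi3) levi3"
  by code_simp

lemma levi3_exponent: "list_all (\<lambda>u. agree (u @ u @ u @ u) []) levi3"
  by code_simp

lemma levi2_order3: "list_all (\<lambda>(t, q). if agree ((Pos A2 t # q) @ (Pos A2 t # q) @ (Pos A2 t # q)) []
    then agree (Pos A2 t # q) [] \<or> agree (Pos A2 t # q) [Pos A2 1, Neg A2 1] \<or> agree (Pos A2 t # q) [Neg A2 1, Pos A2 1]
    else True) (map (Pair 0) levi2 @ map (Pair 1) levi2)"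
  by code_simp

lemma levi2_conj: "agree (winv [Pos A2 1] @ [Neg A2 1, Pos A2 1] @ [Pos A2 1]) ([Pos A2 1, Neg A2 1] :: f2 letter list)"
  by code_simp

section \<open>Conjugating elements of order 3 of the triality coset into a complement\<close>

context triality_action begin

definition conjN :: "'g \<Rightarrow> 'g \<Rightarrow> bool" where "conjN x y \<longleftrightarrow> (\<exists>g. y = conjg A x (\<pi> g))"

lemma conjN_twist: "conjN (\<pi> s \<otimes> r) (\<pi> (winv g @ s @ shift g) \<otimes> r)"
  unfolding conjN_def by (rule exI[of _ g]) (simp only: conjg_r)

lemma conjN_sym: "x \<in> carrier A \<Longrightarrow> conjN x y \<Longrightarrow> conjN y x"
proof -
  assume x: "x \<in> carrier A" and "conjN x y"
  then obtain g where g: "y = conjg A x (\<pi> g)" by (auto simp: conjN_def)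
  have "conjg A y (\<pi> (winv g)) = conjg A x (\<pi> g \<otimes> \<pi> (winv g))" unfolding g using x by (simp add: conjg_conjg)
  also have "\<dots> = x" using x by (simp add: pi_winv conjg_def)
  finally show ?thesis unfolding conjN_def by metis
qed

lemma conjN_trans: "x \<in> carrier A \<Longrightarrow> conjN x y \<Longrightarrow> conjN y z \<Longrightarrow> conjN x z"
  unfolding conjN_def by (metis conjg_conjg pi_append pi_closed)

lemma alphaN_conj:
  assumes x: "x \<in> carrier A" and gen: "N \<subseteq> generate A {x, conjg A x (\<pi> g)}" and y: "conjN x y"
  shows "alphaN y = 2"
proof -
  obtain h where h: "y = conjg A x (\<pi> h)" using y by (auto simp: conjN_def)
  have "N \<subseteq> generate A ((\<lambda>z. conjg A z (\<pi> h)) ` {x, conjg A x (\<pi> g)})"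
    using x by (intro N_conj[OF gen]) (simp add: conjg_in_carrier[OF is_group])
  moreover have "conjg A (conjg A x (\<pi> g)) (\<pi> h) = conjg A y (\<pi> (winv h @ g @ h))"
  proof -
    have "\<pi> h \<otimes> \<pi> (winv h @ g @ h) = \<pi> g \<otimes> \<pi> h" by (simp add: pi_append pi_winv m_assoc[symmetric])
    then show ?thesis unfolding h using x by (simp add: conjg_conjg)
  qed
  ultimately have "N \<subseteq> generate A {y, conjg A y (\<pi> (winv h @ g @ h))}" by (simp add: h)
  then show ?thesis using x by (intro alphaN_eq_2) (simp_all add: h conjg_in_carrier[OF is_group])
qed

text \<open>The words of the nodes 3, 4 and of the nodes 4, 1 have fixed spaces of different types: only the
  former contains a hyperbolic pair.\<close>

lemma r_not_in_N: "r \<notin> N"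
proof
  assume "r \<in> N"
  then obtain w where w: "r = \<pi> w" using pi_range by auto
  let ?s = "[Pos A3 1, Pos A4 1] :: 'f letter list"
  have e: "\<pi> (w @ ?s) = \<pi> (shift ?s @ w)" using r_pi[of ?s] unfolding w by (simp only: pi_append)
  have "\<pi> (winv (w @ ?s) @ shift ?s @ w) = inv (\<pi> (w @ ?s)) \<otimes> \<pi> (shift ?s @ w)"
    by (simp only: pi_append[of "winv (w @ ?s)"] pi_winv)
  also have "\<dots> = \<one>" unfolding e by (rule l_inv[OF pi_closed])
  finally have t: "(\<forall>x. run (shift ?s @ w) x = run (w @ ?s) x) \<or> (\<forall>x. run (shift ?s @ w) x = - run (w @ ?s) x)"
    unfolding pi_one_iff triv_winv_append .
  have s: "run ?s E1 = E1" "run ?s F1 = F1" by (simp_all add: E1_def F1_def)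
  obtain a b c d e f g h where p: "run w E1 = Vec a b c d e f g h" by (cases "run w E1")
  obtain a' b' c' d' e' f' g' h' where q: "run w F1 = Vec a' b' c' d' e' f' g' h'" by (cases "run w F1")
  have bl: "bil (run w E1) (run w F1) = (1 :: 'f)" unfolding bil_run by (simp add: E1_def F1_def)
  have fixed: False if "run (shift ?s) (run w E1) = run w E1" "run (shift ?s) (run w F1) = run w F1"
  proof -
    have "b = 0 \<and> e = 0 \<and> g = 0 \<and> h = 0 \<and> b' = 0 \<and> e' = 0 \<and> g' = 0 \<and> h' = 0" using that unfolding p q by simp
    then show False using bl unfolding p q by simp
  qed
  from t show False
  proof
    assume "\<forall>x. run (shift ?s @ w) x = run (w @ ?s) x"
    then have "run (shift ?s) (run w x) = run w (run ?s x)" for x by (simp only: run_append)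
    from this[of E1] this[of F1] show False unfolding s by (rule fixed)
  next
    assume "\<forall>x. run (shift ?s @ w) x = - run (w @ ?s) x"
    then have n0: "run (shift ?s) (run w x) = - run w (run ?s x)" for x by (simp only: run_append)
    note n = n0[of E1, unfolded s] n0[of F1, unfolded s]
    show False
    proof (cases "(1 :: 'f) = - 1")
      case True
      have m: "- t = t" for t :: 'f using True mult_minus_left[of 1 t] by simp
      have "- x = x" for x :: "'f vec" by (cases x) (simp add: m)
      then show False using n fixed by simp
    next
      case False
      have z: "x = 0" if "x = - x" for x :: 'f
      proof -
        consider "x = 0" | "x = 1" | "x = - 1" using small[of x] by blast
        then show ?thesis using that False by cases (assumption, metis, metis minus_minus)
      qed
      have "b = - b" "e = - e" "g = - g" "h = - h" "b' = - b'" "e' = - e'" "g' = - g'" "h' = - h'"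
        using n unfolding p q by simp_all
      then have "b = 0 \<and> e = 0 \<and> g = 0 \<and> h = 0 \<and> b' = 0 \<and> e' = 0 \<and> g' = 0 \<and> h' = 0"
        by (intro conjI z)
      then show False using bl unfolding p q by simp
    qed
  qed
qed

text \<open>Since neither r nor its square lies in N, the exponent i must be 1 modulo 3.\<close>

lemma coset_cancel:
  assumes "\<pi> u \<otimes> rr i = \<pi> z \<otimes> r"
  shows "\<pi> u = \<pi> z"
proof -
  have "rr i = rr (i mod 3)"
  proof -
    have "rr i = rr (3 * (i div 3)) \<otimes> rr (i mod 3)" by (simp add: nat_pow_mult)
    then show ?thesis by (simp add: r_pow_3)
  qed
  moreover have "i mod 3 = 0 \<or> i mod 3 = 1 \<or> i mod 3 = 2" by auto
  ultimately consider "rr i = \<one>" | "rr i = r" | "rr i = r \<otimes> r" by (auto simp: numeral_2_eq_2)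
  then show ?thesis
  proof cases
    case 1
    then have "r = \<pi> (winv z @ u)" using assms by (simp add: pi_append pi_winv inv_solve_left)
    then show ?thesis using r_not_in_N pi_in_N by metis
  next
    case 2 then show ?thesis using assms by simp
  next
    case 3
    then have "\<pi> u \<otimes> r = \<pi> z" using assms by (simp add: m_assoc[symmetric])
    then have "r = \<pi> (winv u @ z)" by (simp add: pi_append pi_winv inv_solve_left)
    then show ?thesis using r_not_in_N pi_in_N by metis
  qed
qed

lemma elem_cube_1: "(\<pi> s \<otimes> r) \<otimes> (\<pi> s \<otimes> r) \<otimes> (\<pi> s \<otimes> r) = \<pi> (s @ shift s @ shift (shift s))"
  by (simp add: m_assoc r_pi r_pi_left r_cube' pi_append)

text \<open>In A the word product is known only up to sign. If it were -1 then, by conjugation, it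
  would be -1 in all three actions, and the product of two sign changes is no sign change; so -1 = 1
  and the sign is harmless.\<close>

lemma order3_word:
  assumes "(\<pi> s \<otimes> r) \<otimes> (\<pi> s \<otimes> r) \<otimes> (\<pi> s \<otimes> r) = \<one>"
  shows "order3 s"
proof -
  let ?W = "s @ shift s @ shift (shift s)"
  have "triv ?W" using assms unfolding elem_cube_1 pi_one_iff .
  then have "(\<forall>x. run ?W x = x) \<or> (\<forall>x. run ?W x = - x)" by (simp only: triv_def)
  then show ?thesis
  proof
    assume "\<forall>x. run ?W x = x" then show ?thesis by (simp add: order3_def)
  next
    assume n: "\<forall>x. run ?W x = - x"
    have n1: "run (shift ?W) x = - x" for x
    proof -
      have "run s (run (shift ?W) x) = run ?W (run s x)" by simp
      also have "\<dots> = run s (- x)" using n by (simp only: run_uminus)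
      finally show ?thesis by (simp only: run_inj)
    qed
    have n2: "run (shift (shift ?W)) x = - x" for x
    proof -
      have "run (shift s) (run (shift (shift ?W)) x) = run (shift ?W) (run (shift s) x)" by simp
      also have "\<dots> = run (shift s) (- x)" by (simp only: n1 run_uminus)
      finally show ?thesis by (simp only: run_inj)
    qed
    have "prd (run ?W unit_vec) (run (shift ?W) unit_vec) = run (shift (shift ?W)) (prd unit_vec unit_vec)" by (rule prd_slots)
    then have "prd unit_vec unit_vec = - prd unit_vec (unit_vec :: 'f vec)" unfolding n1 n2 n[rule_format] by simp
    then have "(1 :: 'f) = - 1" unfolding prd_unit_unit by (simp add: unit_vec_def)
    then have m: "- t = t" for t :: 'f using mult_minus_left[of 1 t] by simp
    have "- x = x" for x :: "'f vec" by (cases x) (simp add: m)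
    then show ?thesis using n by (simp add: order3_def)
  qed
qed

lemma flag_subgroup: "subgroup {\<pi> w \<otimes> rr i | w i. fix3 E1 w} A"
  by (rule word_subgroup) (auto intro: fix3_append fix3_shift fix3_winv fix3_Nil)

lemma conj_into_flag_stabilizer:
  assumes cert: "flag_certificate (G1 :: 'f letter list list) G2 G3"
    and m: "0 < m" "\<And>k. k < m \<Longrightarrow> (\<Sum>t\<in>UNIV. t ^ k) = (0 :: 'f)" "\<And>t :: 'f. t \<noteq> 0 \<Longrightarrow> t ^ m = 1"
    and o: "order3 s"
  shows "\<exists>s1. fix3 E1 s1 \<and> order3 s1 \<and> conjN (\<pi> s \<otimes> r) (\<pi> s1 \<otimes> r)"
proof -
  obtain h where h: "fix3 E1 (h @ s @ winv (shift h))"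
    using order_3_flag[OF cert m(1) m(2) m(3), of s] o unfolding order3_def by blast
  have e: "winv (winv h) @ s @ shift (winv h) = h @ s @ winv (shift h)" by (simp add: shift_winv)
  have "order3 (h @ s @ winv (shift h))" using order3_conj[OF o, of "winv h"] unfolding e .
  moreover have "conjN (\<pi> s \<otimes> r) (\<pi> (h @ s @ winv (shift h)) \<otimes> r)"
    using conjN_twist[of s "winv h"] unfolding e .
  ultimately show ?thesis using h by blast
qed

lemma order3_elem: "order3 s \<Longrightarrow> (\<pi> s \<otimes> r) \<otimes> (\<pi> s \<otimes> r) \<otimes> (\<pi> s \<otimes> r) = \<one>"
  unfolding elem_cube_1 pi_one_iff by (simp add: triv_def order3_def)

text \<open>Instance of the coset counting with H the flag stabilizer extended by r and M the words
  satisfying Q extended by r. The conjugating element lies in N, so the result stays in the coset of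
  r, and \<open>coset_cancel\<close> turns it into a word times r itself.\<close>

lemma conj_into_complement:
  assumes R: "subgroup R A" "\<And>x. x \<in> R \<Longrightarrow> x [^] (2 ^ k :: nat) = \<one>" "R \<subseteq> {\<pi> w | w. fix3 E1 w}"
    and Q: "subgroup {\<pi> w \<otimes> rr i | w i. Q w} A"
    and RQ: "\<And>s. fix3 E1 s \<Longrightarrow> \<exists>x\<in>R. \<exists>w. Q w \<and> \<pi> s = x \<otimes> \<pi> w"
    and s: "fix3 E1 s" "order3 s"
  shows "\<exists>w. Q w \<and> order3 w \<and> conjN (\<pi> s \<otimes> r) (\<pi> w \<otimes> r)"
proof -
  let ?H = "{\<pi> w \<otimes> rr i | w i. fix3 E1 w}" and ?M = "{\<pi> w \<otimes> rr i | w i. Q w}"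
  have "\<exists>x\<in>R. inv x \<otimes> (\<pi> s \<otimes> r) \<otimes> x \<in> ?M"
  proof (rule order_3_conj_into_complement[OF fin flag_subgroup R(1) Q])
    have "\<pi> w = \<pi> w \<otimes> rr 0" for w by simp
    then show "R \<subseteq> ?H" using R(3) by blast
    show "\<not> 3 dvd card R" by (rule order_pow_2_not_3_dvd[OF fin R(1,2)])
    have "\<pi> s \<otimes> r = \<pi> s \<otimes> rr 1" by simp
    then show "\<pi> s \<otimes> r \<in> ?H" using s(1) by blast
    show "(\<pi> s \<otimes> r) \<otimes> (\<pi> s \<otimes> r) \<otimes> (\<pi> s \<otimes> r) = \<one>" by (rule order3_elem[OF s(2)])
    fix y assume "y \<in> ?H"
    then obtain w i where w: "y = \<pi> w \<otimes> rr i" "fix3 E1 w" by blast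
    obtain x v where x: "x \<in> R" "Q v" "\<pi> w = x \<otimes> \<pi> v" using RQ[OF w(2)] by blast
    have "x \<in> carrier A" using x R(1) subgroup.subset by blast
    then have "y = x \<otimes> (\<pi> v \<otimes> rr i)" unfolding w x(3) by (simp add: m_assoc)
    then show "\<exists>x\<in>R. \<exists>m\<in>?M. y = x \<otimes> m" using x by blast
  qed
  then obtain x w i where x: "x \<in> R" "Q w" "inv x \<otimes> (\<pi> s \<otimes> r) \<otimes> x = \<pi> w \<otimes> rr i" by blast
  obtain g where g: "x = \<pi> g" using x(1) R(3) by blast
  have c: "conjg A (\<pi> s \<otimes> r) (\<pi> g) = \<pi> w \<otimes> rr i" using x(3) unfolding g conjg_def .
  have "\<pi> w = \<pi> (winv g @ s @ shift g)" using c unfolding conjg_r by (metis coset_cancel)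
  then have e: "\<pi> w \<otimes> r = conjg A (\<pi> s \<otimes> r) (\<pi> g)" by (simp add: conjg_r)
  have "order3 w"
    using order3_elem[OF order3_conj[OF s(2)], of g] unfolding conjg_r[symmetric] e[symmetric] by (rule order3_word)
  then show ?thesis using x(2) e unfolding conjN_def by blast
qed

end

lemma posw_parab: "posw w \<Longrightarrow> parab w"
proof -
  have "pos_letter l \<Longrightarrow> parab_letter l" for l :: "'a letter" by (cases l) auto
  then show "posw w \<Longrightarrow> parab w" by (auto simp: posw_def parab_def list_all_iff)
qed

lemma posw_levi: "posw w \<Longrightarrow> run (levi w) x = run (nword (chi A1 w) (chi A3 w) (chi A4 w)) x"
proof (induction w)
  case (Cons l w)
  obtain k t where l: "l = Pos k t" using Cons.prems by (cases l) (auto simp: posw_simps)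
  have IH: "run (levi w) x = run (nword (chi A1 w) (chi A3 w) (chi A4 w)) x" using Cons by (simp add: posw_simps)
  show ?case
  proof (cases "k = A2")
    case True
    then have "levi (l # w) = levi w" by (simp add: l levi_def)
    then show ?thesis using IH True by (simp add: l)
  next
    case False
    then have "levi (l # w) = l # levi w" by (simp add: l levi_def)
    then show ?thesis using IH False by (cases k) (simp_all add: l nword_step)
  qed
qed (simp add: levi_def nword_zero)

section \<open>The class of elements of order 3 other than that of r, over each of the two
  fields\<close>

lemma sum_powers_f2: "k < 1 \<Longrightarrow> (\<Sum>t\<in>UNIV. t ^ k) = (0 :: f2)"
proof -
  assume "k < 1"
  then have "(\<Sum>t\<in>UNIV. t ^ k) = 1 + (1 :: f2)" by (simp add: UNIV_f2)
  then show ?thesis by (simp add: one_f2_def zero_f2_def)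
qed

lemma sum_powers_f3: "k < 2 \<Longrightarrow> (\<Sum>t\<in>UNIV. t ^ k) = (0 :: f3)"
proof -
  assume "k < 2"
  then have "k = 0 \<or> k = 1" by auto
  then show ?thesis
  proof
    assume "k = 0"
    then have "(\<Sum>t\<in>UNIV. t ^ k) = 1 + (1 + (1 :: f3))" by (simp add: UNIV_f3)
    then show ?thesis by (simp add: one_f3_def zero_f3_def)
  next
    assume "k = 1"
    then have "(\<Sum>t\<in>UNIV. t ^ k) = Z3 + (I3 + J3)" by (simp add: UNIV_f3)
    then show ?thesis by (simp add: zero_f3_def)
  qed
qed

lemma powers_f2: "t \<noteq> 0 \<Longrightarrow> t ^ 1 = (1 :: f2)" by (cases t) (simp_all add: zero_f2_def one_f2_def)
lemma powers_f3: "t \<noteq> 0 \<Longrightarrow> t ^ 2 = (1 :: f3)"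
  by (cases t) (simp_all add: zero_f3_def one_f3_def power2_eq_square)

locale triality_f2 = triality_action A N \<pi> r
  for A :: "('g, 'm) monoid_scheme" (structure) and N and \<pi> :: "f2 letter list \<Rightarrow> 'g" and r
begin

text \<open>Squaring kills the parameters at the outer nodes, and then the fourth power is trivial
  because 4 and its binomial coefficient 6 are even: 8 = 2 * 4.\<close>

lemma posw_exponent:
  assumes "posw w"
  shows "\<pi> w [^] (2 ^ 3 :: nat) = \<one>"
proof -
  have d: "t + t = 0" for t :: f2 by (cases t) (simp_all add: zero_f2_def)
  have l: "run (levi (wpow w 2)) x = x" for x
  proof -
    let ?n = "nword (chi A1 w) (chi A3 w) (chi A4 w)"
    have "run (levi (wpow w 2)) x = (run (levi w) ^^ 2) x" by (simp only: levi_wpow run_wpow)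
    also have "\<dots> = run ?n (run ?n x)" by (simp add: numeral_2_eq_2 posw_levi[OF assms])
    also have "run ?n (run ?n x) = x"
    proof -
      have "run ?n y = step (Pos A1 (chi A1 w)) (step (Pos A3 (chi A3 w)) (step (Pos A4 (chi A4 w)) y))" for y
        by (simp add: nword_def)
      then have "run ?n (run ?n x) = step (Pos A1 (chi A1 w)) (step (Pos A3 (chi A3 w)) (step (Pos A4 (chi A4 w)) (run ?n x)))" .
      also have "\<dots> = run (nword (chi A1 w + chi A1 w) (chi A3 w + chi A3 w) (chi A4 w + chi A4 w)) x"
        by (simp only: nword_step)
      also have "\<dots> = x" by (simp only: d nword_zero)
      finally show ?thesis .
    qed
    finally show ?thesis .
  qed
  have "(run (wpow w 2) ^^ 4) x = x" for x
  proof (rule parab_unipotent_pow[OF parab_wpow[OF posw_parab[OF assms]] l])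
    have "of_nat 4 = (1 + 1) + ((1 :: f2) + 1)" by (simp add: numeral_eq_Suc)
    then show "of_nat 4 = (0 :: f2)" by (simp only: d)
    have "(4 :: nat) choose 2 = 6" by (simp add: numeral_eq_Suc)
    moreover have "of_nat 6 = (1 + 1) + ((1 + 1) + ((1 :: f2) + 1))" by (simp add: numeral_eq_Suc)
    ultimately show "of_nat (4 choose 2) = (0 :: f2)" by (simp only: d)
  qed
  then have "\<pi> (wpow (wpow w 2) 4) = \<one>" by (simp add: pi_one_iff triv_def run_wpow)
  then show ?thesis by (simp add: pi_wpow nat_pow_pow)
qed

text \<open>Over two elements the positive words form the 2-group R, and an element of order 3 is
  moved into SL2(2) times the group of r. There its N-part is trivial, which is the class of r, or
  one of two mutually inverse elements of order 3 that are conjugate in SL2(2).\<close>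

theorem alpha_other:
  assumes s: "(\<pi> s \<otimes> r) \<otimes> (\<pi> s \<otimes> r) \<otimes> (\<pi> s \<otimes> r) = \<one>" and nc: "\<not> conjN r (\<pi> s \<otimes> r)"
  shows "alphaN (\<pi> s \<otimes> r) = 2"
proof -
  obtain s1 where s1: "fix3 E1 s1" "order3 s1" "conjN (\<pi> s \<otimes> r) (\<pi> s1 \<otimes> r)"
  proof -
    have "\<exists>s1. fix3 E1 s1 \<and> order3 s1 \<and> conjN (\<pi> s \<otimes> r) (\<pi> s1 \<otimes> r)"
      by (rule conj_into_flag_stabilizer[OF flag_certificate_f2, of 1], simp, erule sum_powers_f2,
        erule powers_f2, rule order3_word[OF s])
    then show thesis using that by blast
  qed
  let ?Q = "\<lambda>w :: f2 letter list. \<forall>l\<in>set w. lnode l = A2"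
  let ?R = "{\<pi> w | w. posw w}"
  have "\<exists>w. ?Q w \<and> order3 w \<and> conjN (\<pi> s1 \<otimes> r) (\<pi> w \<otimes> r)"
  proof (rule conj_into_complement[of ?R 3])
    show "subgroup ?R A"
    proof (rule subgroupI)
      show "?R \<noteq> {}" using posw_simps(1) by blast
      show "inv a \<in> ?R" if a: "a \<in> ?R" for a
      proof -
        obtain w where "a = \<pi> w" "posw w" using a by blast
        then have "inv a = \<pi> (winv w)" "posw (winv w)" by (simp_all add: pi_winv posw_winv)
        then show ?thesis by blast
      qed
      show "a \<otimes> b \<in> ?R" if ab: "a \<in> ?R" "b \<in> ?R" for a b
      proof -
        obtain u w where "a = \<pi> u" "b = \<pi> w" "posw u" "posw w" using ab by blast
        then have "a \<otimes> b = \<pi> (u @ w)" "posw (u @ w)" by (simp_all add: pi_append posw_simps)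
        then show ?thesis by blast
      qed
    qed auto
    show "x [^] (2 ^ 3 :: nat) = \<one>" if "x \<in> ?R" for x using that posw_exponent by blast
    show "?R \<subseteq> {\<pi> w | w. fix3 E1 w}" using posw_fix3 by blast
    show "subgroup {\<pi> w \<otimes> rr i | w i. ?Q w} A"
    proof (rule word_subgroup)
      have "lnode (shl l) = tri (lnode l)" "lnode (linv l) = lnode l" for l :: "f2 letter" by (cases l; simp)+
      then show "?Q w \<Longrightarrow> ?Q (shift w)" "?Q w \<Longrightarrow> ?Q (winv w)" for w
        by (auto simp: shift_def winv_def)
    qed auto
    show "\<exists>x\<in>?R. \<exists>w. ?Q w \<and> \<pi> t = x \<otimes> \<pi> w" if t: "fix3 E1 t" for t
    proof -
      obtain u q where "posw u" "?Q q" "\<And>x. run t x = run (u @ q) x"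
        using flag_stabilizer[OF elim_certificate_f2 levi_certificate_f2 t] by blast
      then have "\<pi> t = \<pi> u \<otimes> \<pi> q" using pi_cong[of t "u @ q"] by (simp add: pi_append)
      then show ?thesis using \<open>posw u\<close> \<open>?Q q\<close> by blast
    qed
  qed (rule s1)+
  then obtain w where w: "?Q w" "order3 w" "conjN (\<pi> s1 \<otimes> r) (\<pi> w \<otimes> r)" by blast
  \<comment> \<open>Words at the central node are unchanged by triality, so the twisted order
    condition becomes that w has trivial cube.\<close>
  have sh: "shift w = w" using w(1)
  proof (induction w)
    case (Cons l w) then show ?case by (cases l) auto
  qed simp
  obtain t q where tq: "(t, q) \<in> set (map (Pair 0) levi2 @ map (Pair 1) levi2)" "\<And>x. run w x = run (Pos A2 t # q) x"
    using levi_word[OF levi_certificate_f2 central_fix3[OF w(1)]] by blast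
  let ?v = "Pos A2 t # q"
  have "agree (?v @ ?v @ ?v) []"
    using w(2) unfolding order3_def sh tq(2) agree_iff by simp
  then have "agree ?v [] \<or> agree ?v two2a \<or> agree ?v [Neg A2 1, Pos A2 1]"
    using bspec[OF levi2_order3[unfolded list_all_iff] tq(1)] unfolding two2a_def prod.case by presburger
  moreover have "\<pi> w = \<pi> u" if "agree ?v u" for u
    using that unfolding agree_iff tq(2)[symmetric] by (intro pi_cong) blast
  ultimately have "\<pi> w = \<one> \<or> \<pi> w = \<pi> two2a \<or> \<pi> w = \<pi> [Neg A2 1, Pos A2 1]"
    using pi_Nil by metis
  moreover have "conjN (\<pi> s \<otimes> r) (\<pi> w \<otimes> r)" using conjN_trans[OF _ s1(3) w(3)] by simp
  then have cw: "conjN (\<pi> w \<otimes> r) (\<pi> s \<otimes> r)" by (rule conjN_sym[rotated]) simp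
  moreover have "conjN (\<pi> two2a \<otimes> r) (\<pi> [Neg A2 1, Pos A2 1] \<otimes> r)"
  proof -
    have sh: "shift [Pos A2 1] = [Pos A2 1 :: f2 letter]" by simp
    have "\<pi> (winv [Pos A2 1] @ [Neg A2 1, Pos A2 1] @ shift [Pos A2 1]) = \<pi> two2a"
      unfolding two2a_def sh by (rule pi_cong) (rule spec[OF levi2_conj[unfolded agree_iff]])
    then have "conjN (\<pi> [Neg A2 1, Pos A2 1] \<otimes> r) (\<pi> two2a \<otimes> r)"
      using conjN_twist[of "[Neg A2 1, Pos A2 1]" "[Pos A2 1]"] by (simp only: )
    then show ?thesis by (rule conjN_sym[rotated]) simp
  qed
  ultimately have "conjN (\<pi> two2a \<otimes> r) (\<pi> s \<otimes> r)"
  proof (elim disjE)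
    assume "\<pi> w = \<one>" then show ?thesis using cw nc by simp
  next
    assume "\<pi> w = \<pi> two2a" then show ?thesis using cw by simp
  next
    assume 1: "conjN (\<pi> two2a \<otimes> r) (\<pi> [Neg A2 1, Pos A2 1] \<otimes> r)" and "\<pi> w = \<pi> [Neg A2 1, Pos A2 1]"
    then have "conjN (\<pi> [Neg A2 1, Pos A2 1] \<otimes> r) (\<pi> s \<otimes> r)" using cw by simp
    then show ?thesis using conjN_trans[OF _ 1] by simp
  qed
  then show ?thesis
    using alphaN_conj[OF _ generate_two[OF full_reach_two2[unfolded two2b_conj]]] by simp
qed

end

locale triality_f3 = triality_action A N \<pi> r
  for A :: "('g, 'm) monoid_scheme" (structure) and N and \<pi> :: "f3 letter list \<Rightarrow> 'g" and r
begin

text \<open>Over three elements the roles are exchanged: R is the quaternion group and the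
  complement consists of positive words with powers of r. The normal form leaves a triple (b, c, z);
  the zero triple gives the class of r, and \<open>okubo_table\<close> collects all others in one
  class.\<close>

theorem alpha_other:
  assumes s: "(\<pi> s \<otimes> r) \<otimes> (\<pi> s \<otimes> r) \<otimes> (\<pi> s \<otimes> r) = \<one>" and nc: "\<not> conjN r (\<pi> s \<otimes> r)"
  shows "alphaN (\<pi> s \<otimes> r) = 2"
proof -
  obtain s1 where s1: "fix3 E1 s1" "order3 s1" "conjN (\<pi> s \<otimes> r) (\<pi> s1 \<otimes> r)"
  proof -
    have "\<exists>s1. fix3 E1 s1 \<and> order3 s1 \<and> conjN (\<pi> s \<otimes> r) (\<pi> s1 \<otimes> r)"
      by (rule conj_into_flag_stabilizer[OF flag_certificate_f3, of 2], simp, erule sum_powers_f3,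
        erule powers_f3, rule order3_word[OF s])
    then show thesis using that by blast
  qed
  let ?R = "{\<pi> w | w. w \<in> set levi3}"
  have cl: "\<exists>q\<in>set levi3. \<forall>x. run (u @ w) x = run q x" if "u \<in> set levi3" "w \<in> set levi3" for u w
    using levi3_closed that unfolding list_all_iff list_ex_iff agree_iff by blast
  have ex: "\<pi> w [^] (2 ^ 2 :: nat) = \<one>" if "w \<in> set levi3" for w
  proof -
    have "\<pi> (w @ w @ w @ w) = \<pi> []" using levi3_exponent that unfolding list_all_iff agree_iff by (intro pi_cong) blast
    then show ?thesis by (simp add: pi_append numeral_eq_Suc m_assoc)
  qed
  have R: "subgroup ?R A"
  proof (rule subgroupI)
    show "?R \<noteq> {}" by (auto simp: levi3_def)
    show m: "a \<otimes> b \<in> ?R" if ab: "a \<in> ?R" "b \<in> ?R" for a b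
    proof -
      obtain u w where u: "a = \<pi> u" "b = \<pi> w" "u \<in> set levi3" "w \<in> set levi3" using ab by auto
      then obtain q where "q \<in> set levi3" "\<forall>x. run (u @ w) x = run q x" using cl by blast
      then show ?thesis using u pi_cong[of "u @ w" q] pi_append by auto
    qed
    show "inv a \<in> ?R" if "a \<in> ?R" for a
    proof -
      have ac: "a \<in> carrier A" using that by auto
      have "a [^] (2 ^ 2 :: nat) = \<one>" using that ex by blast
      then have "(a \<otimes> a \<otimes> a) \<otimes> a = \<one>" using ac by (simp add: numeral_eq_Suc m_assoc)
      then have "inv a = a \<otimes> a \<otimes> a" using ac by (simp add: inv_equality)
      then show ?thesis using m[OF m[OF that that] that] by simp
    qed
  qed auto
  have tabs: "snd ` set (map (Pair 0) levi3 @ map (Pair 1) levi3 @ map (Pair (- 1)) levi3) = set levi3"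
    by (auto simp: image_Un image_image)
  have a2: "\<forall>l\<in>set q. lnode l = A2" if "q \<in> set levi3" for q
    using levi_certificate_f3 that unfolding levi_certificate_def list_all_iff by auto
  have "\<exists>w. posw w \<and> order3 w \<and> conjN (\<pi> s1 \<otimes> r) (\<pi> w \<otimes> r)"
  proof (rule conj_into_complement[of ?R 2])
    show "subgroup ?R A" by (rule R)
    show "x [^] (2 ^ 2 :: nat) = \<one>" if "x \<in> ?R" for x using that ex by blast
    show "?R \<subseteq> {\<pi> w | w. fix3 E1 w}" using a2 central_fix3 by blast
    show "subgroup {\<pi> w \<otimes> rr i | w i. posw w} A"
      by (rule word_subgroup) (auto simp: posw_simps posw_shift posw_winv)
    show "\<exists>x\<in>?R. \<exists>w. posw w \<and> \<pi> t = x \<otimes> \<pi> w" if t: "fix3 E1 t" for t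
    proof -
      \<comment> \<open>Factoring the inverse and inverting back puts the quaternion factor on the
        left, where the coset argument requires it.\<close>
      obtain u q where uq: "posw u" "q \<in> set levi3" "\<And>x. run (winv t) x = run (u @ q) x"
        using flag_stabilizer[OF elim_certificate_f3 levi_certificate_f3 fix3_winv[OF t]] unfolding tabs by blast
      have "inv (\<pi> t) = \<pi> u \<otimes> \<pi> q" using pi_cong[of "winv t" "u @ q"] uq(3) by (simp add: pi_append pi_winv)
      then have "inv (inv (\<pi> t)) = inv (\<pi> u \<otimes> \<pi> q)" by simp
      then have e: "\<pi> t = inv (\<pi> q) \<otimes> \<pi> (winv u)" by (simp add: inv_mult_group pi_winv)
      have "\<pi> q \<in> ?R" using uq(2) by blast
      then have i: "inv (\<pi> q) \<in> ?R" by (rule subgroup.m_inv_closed[OF R])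
      show ?thesis by (rule bexI[OF _ i]) (rule exI[of _ "winv u"], rule conjI[OF posw_winv[OF uq(1)] e])
    qed
  qed (rule s1)+
  then obtain w where w: "posw w" "order3 w" "conjN (\<pi> s1 \<otimes> r) (\<pi> w \<otimes> r)" by blast
  obtain v b c z where v: "\<And>x. run (winv v @ w @ shift v) x = qmap (Vec 0 0 c 0 b 0 0 0) z x"
    using conj_order3_posw[OF w(1,2)] by blast
  let ?w = "winv v @ w @ shift v"
  have "conjN (\<pi> s \<otimes> r) (\<pi> w \<otimes> r)" using conjN_trans[OF _ s1(3) w(3)] by simp
  then have "conjN (\<pi> s \<otimes> r) (\<pi> ?w \<otimes> r)" using conjN_trans[OF _ _ conjN_twist] by simp
  then have cw: "conjN (\<pi> ?w \<otimes> r) (\<pi> s \<otimes> r)" by (rule conjN_sym[rotated]) simp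
  have nz: "\<not> (b = 0 \<and> c = 0 \<and> z = 0)"
  proof
    assume "b = 0 \<and> c = 0 \<and> z = 0"
    then have "run ?w x = x" for x unfolding v using qmap_zero[of x] by (simp add: zero_vec_def)
    then have "\<pi> ?w = \<one>" using pi_cong[of ?w "[]"] by simp
    then show False using cw nc by simp
  qed
  then have "(b, c, z) \<in> fst ` set okubo_table"
    using okubo_table_complete unfolding allf_iff by presburger
  then obtain g where "((b, c, z), g) \<in> set okubo_table" by force
  then have g: "map (run (winv g @ [Pos A2 1] @ shift g)) basis = map (qmap (Vec 0 0 c 0 b 0 0 0) z) basis"
    using okubo_table unfolding list_all_iff by fast
  have "map (run (winv g @ [Pos A2 1] @ shift g)) basis = map (run ?w) basis"
    unfolding g by (rule map_cong[OF refl]) (simp only: v)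
  then have "\<pi> (winv g @ [Pos A2 1] @ shift g) = \<pi> ?w" by (intro pi_same) (simp only: same_def simp_thms)
  with conjN_twist[of "[Pos A2 1]" g] have "conjN (\<pi> [Pos A2 1] \<otimes> r) (\<pi> ?w \<otimes> r)" by (simp only:)
  then have "conjN (\<pi> two3a \<otimes> r) (\<pi> s \<otimes> r)" unfolding two3a_def using conjN_trans[OF _ _ cw] by simp
  then show ?thesis
    using alphaN_conj[OF _ generate_two[OF full_reach_two3[unfolded two3b_conj]]] by simp
qed

end

section \<open>From words to the integer matrices modulo p and their projective group\<close>

locale prime_field =
  fixes p :: nat and val :: "'f::small_field \<Rightarrow> int"
  assumes p: "p = 2 \<or> p = 3"
    and of_int_val [simp]: "of_int (val t) = t"
    and val_of_int: "val (of_int n) = n mod int p"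
begin

lemma val_eq_iff: "val s = val t \<longleftrightarrow> s = t" by (metis of_int_val)

lemma val_range [simp]: "0 \<le> val t" "val t < int p"
  using val_of_int[of "val t"] p by auto

lemma val_mod [simp]: "val t mod int p = val t" by simp

end

fun coord :: "nat \<Rightarrow> 'a vec \<Rightarrow> 'a" where
  "coord i (Vec a b c d e f g h) = [a, b, c, d, e, f, g, h] ! i"

lemma lessThan_8: "{..<8} = {0, 1, 2, 3, 4, 5, 6, 7 :: nat}" by auto

lemma less_8_cases: "(i::nat) < 8 \<longleftrightarrow> i = 0 \<or> i = 1 \<or> i = 2 \<or> i = 3 \<or> i = 4 \<or> i = 5 \<or> i = 6 \<or> i = 7" by auto

lemma coord_add: "i < 8 \<Longrightarrow> coord i (x + y) = coord i x + coord i y"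
  unfolding less_8_cases by (cases x; cases y) auto

lemma coord_scale: "i < 8 \<Longrightarrow> coord i (scale s x) = s * coord i x"
  unfolding less_8_cases by (cases x) auto

lemma vec_eqI: "(\<And>i. i < 8 \<Longrightarrow> coord i x = coord i y) \<Longrightarrow> x = y"
proof -
  assume *: "\<And>i. i < 8 \<Longrightarrow> coord i x = coord i y"
  show ?thesis using *[of 0] *[of 1] *[of 2] *[of 3] *[of 4] *[of 5] *[of 6] *[of 7] by (cases x; cases y) simp
qed

lemma coord_run_expand:
  assumes "i < 8" shows "coord i (run w x) = (\<Sum>k<8. coord i (run w (basis ! k)) * coord k x)"
proof -
  obtain a b c d e f g h where x: "x = Vec a b c d e f g h" by (cases x)
  show ?thesis
    unfolding x vec_basis_expand[of a b c d e f g h] run_add run_scale coord_add[OF assms] coord_scale[OF assms]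
    by (simp add: lessThan_8 basis_def mult.commute)
qed

lemma run_eq_basisI: "(\<And>j. j < 8 \<Longrightarrow> run u (basis ! j) = run w (basis ! j)) \<Longrightarrow> run u x = run w x"
  by (rule vec_eqI) (simp add: coord_run_expand[of _ u] coord_run_expand[of _ w])

lemma coord_basis: "i < 8 \<Longrightarrow> j < 8 \<Longrightarrow> coord i (basis ! j) = of_bool (i = j)"
  unfolding less_8_cases[of j] unfolding less_8_cases[of i] by (elim disjE) (simp_all add: basis_def)

fun num :: "node \<Rightarrow> nat" where "num A1 = 1" | "num A2 = 2" | "num A3 = 3" | "num A4 = 4"

fun Xlet :: "'a letter \<Rightarrow> nat \<Rightarrow> nat \<Rightarrow> int" where
  "Xlet (Pos k t) = Xpos (num k)" | "Xlet (Neg k t) = Xneg (num k)"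

fun param :: "'a letter \<Rightarrow> 'a" where "param (Pos k t) = t" | "param (Neg k t) = t"

lemma coord_step_basis:
  "i < 8 \<Longrightarrow> j < 8 \<Longrightarrow> coord i (step l (basis ! j)) = of_bool (i = j) + param l * of_int (Xlet l i j)"
proof -
  have c: "coord i (step l (basis ! j)) = of_bool (i = j) + param l * of_int (Xlet l i j)"
    if j: "j \<in> {0,1,2,3,4,5,6,7}" and i: "i \<in> {0,1,2,3,4,5,6,7}" for i j
  proof (cases l)
    case (Pos k t)
    show ?thesis using j i unfolding Pos
      by (cases k) (elim insertE emptyE; simp add: basis_def Xpos_def Emat_def)+
  next
    case (Neg k t)
    show ?thesis using j i unfolding Neg
      by (cases k) (elim insertE emptyE; simp add: basis_def Xneg_def Emat_def)+
  qed
  assume "i < 8" "j < 8" then show ?thesis by (intro c) auto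
qed

context prime_field
begin

definition mat :: "'f letter list \<Rightarrow> nat \<Rightarrow> nat \<Rightarrow> int" where
  "mat w = (\<lambda>i j. if i < 8 \<and> j < 8 then val (coord i (run w (basis ! j))) else 0)"

lemma mat_eq_iff: "mat u = mat w \<longleftrightarrow> (\<forall>x. run u x = run w x)"
proof
  assume eq: "mat u = mat w"
  have "coord i (run u (basis ! j)) = coord i (run w (basis ! j))" if "i < 8" "j < 8" for i j
    using fun_cong[OF fun_cong[OF eq, of i], of j] that by (simp add: mat_def val_eq_iff)
  then have "run u (basis ! j) = run w (basis ! j)" if "j < 8" for j using that by (intro vec_eqI) blast
  then show "\<forall>x. run u x = run w x" using run_eq_basisI by blast
next
  assume "\<forall>x. run u x = run w x"
  then have "run u = run w" by blast
  then show "mat u = mat w" by (simp add: mat_def cong: if_cong)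
qed

lemma mat_in_carrier: "mat w \<in> mat_carrier p"
  using p by (auto simp: mat_carrier_def mat_def)

lemma mat_Nil: "mat [] = mat_one"
proof -
  have "val 0 = 0" "val 1 = 1" using val_of_int[of 0] val_of_int[of 1] p by auto
  then show ?thesis by (intro ext) (simp add: mat_def mat_one_def coord_basis)
qed

lemma mat_append: "mat (u @ w) = mat_mult p (mat u) (mat w)"
proof (intro ext)
  fix i j
  show "mat (u @ w) i j = mat_mult p (mat u) (mat w) i j"
  proof (cases "i < 8 \<and> j < 8")
    case True
    have "(\<Sum>k<8. mat u i k * mat w k j) mod int p = val (of_int (\<Sum>k<8. mat u i k * mat w k j))"
      by (simp only: val_of_int)
    also have "of_int (\<Sum>k<8. mat u i k * mat w k j) =
        (\<Sum>k<8. coord i (run u (basis ! k)) * coord k (run w (basis ! j)))"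
      using True by (simp add: mat_def)
    also have "\<dots> = coord i (run u (run w (basis ! j)))" using coord_run_expand True by metis
    finally show ?thesis using True by (simp add: mat_def mat_mult_def)
  qed (auto simp: mat_def mat_mult_def)
qed

lemma root_elt_letter: "root_elt p (Xlet l) (val (param l)) = mat [l]"
proof (intro ext)
  fix i j
  show "root_elt p (Xlet l) (val (param l)) i j = mat [l] i j"
  proof (cases "i < 8 \<and> j < 8")
    case True
    have "(mat_one i j + val (param l) * Xlet l i j) mod int p = val (of_int (mat_one i j + val (param l) * Xlet l i j))"
      by (simp only: val_of_int)
    also have "of_int (mat_one i j + val (param l) * Xlet l i j) = coord i (step l (basis ! j))"
      using True by (simp add: coord_step_basis mat_one_def)
    finally show ?thesis using True by (simp add: root_elt_def mat_def)
  qed (auto simp: root_elt_def mat_def)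
qed

lemma mat_monoid: "monoid (Mat_monoid p)"
proof (rule monoidI)
  fix A B C assume "A \<in> carrier (Mat_monoid p)" "B \<in> carrier (Mat_monoid p)" "C \<in> carrier (Mat_monoid p)"
  have "(\<Sum>k<8. ((\<Sum>l<8. A i l * B l k) mod int p) * C k j) mod int p
      = (\<Sum>k<8. A i k * ((\<Sum>l<8. B k l * C l j) mod int p)) mod int p" for i j
  proof -
    have "(\<Sum>k<8. ((\<Sum>l<8. A i l * B l k) mod int p) * C k j) mod int p
        = (\<Sum>k<8. (\<Sum>l<8. A i l * B l k) * C k j) mod int p"
      by (subst (1 2) mod_sum_eq[symmetric]) (simp only: mod_mult_left_eq)
    also have "(\<Sum>k<8. (\<Sum>l<8. A i l * B l k) * C k j) = (\<Sum>l<8. \<Sum>k<8. A i l * B l k * C k j)"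
      by (subst sum.swap) (simp only: sum_distrib_right)
    also have "\<dots> = (\<Sum>k<8. A i k * (\<Sum>l<8. B k l * C l j))"
      by (simp only: sum_distrib_left mult.assoc)
    also have "\<dots> mod int p = (\<Sum>k<8. A i k * ((\<Sum>l<8. B k l * C l j) mod int p)) mod int p"
      by (subst (1 2) mod_sum_eq[symmetric]) (simp only: mod_mult_right_eq)
    finally show ?thesis .
  qed
  then show "A \<otimes>\<^bsub>Mat_monoid p\<^esub> B \<otimes>\<^bsub>Mat_monoid p\<^esub> C = A \<otimes>\<^bsub>Mat_monoid p\<^esub> (B \<otimes>\<^bsub>Mat_monoid p\<^esub> C)"
    by (intro ext) (simp add: Mat_monoid_def mat_mult_def)
next
  fix A assume "A \<in> carrier (Mat_monoid p)"
  then have A: "A \<in> mat_carrier p" by (simp add: Mat_monoid_def)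
  have m: "A i j mod int p = A i j" if "i < 8" "j < 8" for i j
    using A that by (simp add: mat_carrier_def)
  have z: "A i j = 0" if "\<not> (i < 8 \<and> j < 8)" for i j using A that by (simp add: mat_carrier_def)
  have "(\<Sum>k<8. mat_one i k * A k j) = A i j" if "i < 8" for i j
    using that by (simp add: mat_one_def sum.delta if_distrib[of "\<lambda>x. x * _"] cong: if_cong)
  moreover have "(\<Sum>k<8. A i k * mat_one k j) = A i j" if "j < 8" for i j
    using that by (simp add: mat_one_def sum.delta if_distrib[of "\<lambda>x. _ * x"] cong: if_cong)
  ultimately show "\<one>\<^bsub>Mat_monoid p\<^esub> \<otimes>\<^bsub>Mat_monoid p\<^esub> A = A" "A \<otimes>\<^bsub>Mat_monoid p\<^esub> \<one>\<^bsub>Mat_monoid p\<^esub> = A"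
    by (intro ext, auto simp add: Mat_monoid_def mat_mult_def m z)+
qed (use p in \<open>auto simp: Mat_monoid_def mat_carrier_def mat_mult_def mat_one_def\<close>)

lemma mat_Units: "mat w \<in> Units (Mat_monoid p)"
proof -
  have "mat (w @ winv w) = mat_one" "mat (winv w @ w) = mat_one" unfolding mat_Nil[symmetric] mat_eq_iff by simp_all
  then show ?thesis using mat_in_carrier[of w] mat_in_carrier[of "winv w"]
    by (auto simp: Units_def Mat_monoid_def mat_append intro!: bexI[of _ "mat (winv w)"])
qed

lemma GL8_group: "group (GL8 p)" unfolding GL8_def by (rule monoid.units_group[OF mat_monoid])

lemma GL8_simps: "carrier (GL8 p) = Units (Mat_monoid p)" "monoid.mult (GL8 p) = mat_mult p" "one (GL8 p) = mat_one"
  by (simp_all add: GL8_def units_of_def Mat_monoid_def)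

lemma GL8_inv_mat: "inv\<^bsub>GL8 p\<^esub> (mat w) = mat (winv w)"
proof (rule group.inv_equality[OF GL8_group])
  show "mat (winv w) \<otimes>\<^bsub>GL8 p\<^esub> mat w = \<one>\<^bsub>GL8 p\<^esub>"
    unfolding GL8_simps mat_append[symmetric] mat_Nil[symmetric] mat_eq_iff by simp
qed (simp_all add: GL8_simps mat_Units)

lemma simple_root_gens_eq: "simple_root_gens p = range (\<lambda>l. mat [l])"
proof -
  have v: "\<exists>s::'f. t = val s" if "t \<in> {0..<int p}" for t
    using val_of_int[of t] that by (intro exI[of _ "of_int t"]) simp
  have n: "\<exists>q. k = num q" if "k \<in> {1..4}" for k
  proof -
    have "k = num A1 \<or> k = num A2 \<or> k = num A3 \<or> k = num A4" using that by auto
    then show ?thesis by blast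
  qed
  have P: "root_elt p (Xpos (num q)) (val s) = mat [Pos q s]" "root_elt p (Xneg (num q)) (val s) = mat [Neg q s]" for q s
    using root_elt_letter[of "Pos q s"] root_elt_letter[of "Neg q s"] by simp_all
  have nr: "num q \<in> {1..4}" for q by (cases q) auto
  show ?thesis
  proof (intro equalityI subsetI)
    fix M assume "M \<in> simple_root_gens p"
    then consider k t where "k \<in> {1..4}" "t \<in> {0..<int p}" "M = root_elt p (Xpos k) t"
      | k t where "k \<in> {1..4}" "t \<in> {0..<int p}" "M = root_elt p (Xneg k) t"
      unfolding simple_root_gens_def by blast
    then show "M \<in> range (\<lambda>l. mat [l])"
    proof cases
      case 1
      obtain q s where "k = num q" "t = val s" using n[OF 1(1)] v[OF 1(2)] by blast
      then show ?thesis using 1(3) P by blast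
    next
      case 2
      obtain q s where "k = num q" "t = val s" using n[OF 2(1)] v[OF 2(2)] by blast
      then show ?thesis using 2(3) P by blast
    qed
  next
    fix M assume "M \<in> range (\<lambda>l. mat [l])"
    then obtain l where l: "M = mat [l]" by blast
    have vr: "val s \<in> {0..<int p}" for s by simp
    show "M \<in> simple_root_gens p"
    proof (cases l)
      case (Pos q s)
      show ?thesis unfolding l Pos P(1)[symmetric] simple_root_gens_def
        by (intro UnI1 CollectI exI conjI) (rule refl nr vr)+
    next
      case (Neg q s)
      show ?thesis unfolding l Neg P(2)[symmetric] simple_root_gens_def
        by (intro UnI2 CollectI exI conjI) (rule refl nr vr)+
    qed
  qed
qed

lemma generate_mat: "generate (GL8 p) (simple_root_gens p) = range mat"
proof (intro equalityI subsetI)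
  fix M assume "M \<in> generate (GL8 p) (simple_root_gens p)"
  then show "M \<in> range mat"
  proof (induction rule: generate.induct)
    case one show ?case unfolding GL8_simps mat_Nil[symmetric] by blast
  next
    case (incl h) then show ?case by (auto simp: simple_root_gens_eq)
  next
    case (inv h) then show ?case by (auto simp: simple_root_gens_eq GL8_inv_mat simp del: winv_simps)
  next
    case (eng h k)
    then obtain u w where "h = mat u" "k = mat w" by blast
    then have "h \<otimes>\<^bsub>GL8 p\<^esub> k = mat (u @ w)" by (simp only: GL8_simps mat_append)
    then show ?case by blast
  qed
next
  fix M assume "M \<in> range mat"
  then obtain w where w: "M = mat w" by blast
  have "mat w \<in> generate (GL8 p) (simple_root_gens p)"
  proof (induction w)
    case Nil show ?case using generate.one[of "GL8 p"] by (simp add: mat_Nil GL8_simps)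
  next
    case (Cons l w)
    have "mat [l] \<in> generate (GL8 p) (simple_root_gens p)" by (intro generate.incl) (simp add: simple_root_gens_eq)
    from generate.eng[OF this Cons] show ?case using mat_append[of "[l]" w] by (simp add: GL8_simps)
  qed
  then show "M \<in> generate (GL8 p) (simple_root_gens p)" by (simp add: w)
qed

lemma Omega8_simps: "carrier (Omega8 p) = range mat" "monoid.mult (Omega8 p) = mat_mult p" "one (Omega8 p) = mat_one"
  by (simp_all add: Omega8_def generate_mat GL8_simps)

lemma Omega8_group: "group (Omega8 p)"
proof -
  interpret G: group "GL8 p" by (rule GL8_group)
  have "subgroup (generate (GL8 p) (simple_root_gens p)) (GL8 p)"
    by (rule G.generate_is_subgroup) (auto simp: simple_root_gens_eq GL8_simps mat_Units)
  then show ?thesis unfolding Omega8_def by (rule G.subgroup_imp_group)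
qed

lemma Omega8_inv: "inv\<^bsub>Omega8 p\<^esub> (mat w) = mat (winv w)"
proof (rule group.inv_equality[OF Omega8_group])
  show "mat (winv w) \<otimes>\<^bsub>Omega8 p\<^esub> mat w = \<one>\<^bsub>Omega8 p\<^esub>"
    unfolding Omega8_simps mat_append[symmetric] mat_Nil[symmetric] mat_eq_iff by simp
qed (simp_all add: Omega8_simps)

end

text \<open>A linear map commuting with all simple root elements is determined by its value on the lowest
  weight vector, since the product of the lowering operators along the path from the highest to the
  lowest weight has rank one.\<close>

lemma triv_if_commutes:
  fixes w :: "'a::small_field letter list"
  assumes P: "\<And>k x. run w (step (Pos k 1) x) = step (Pos k 1) (run w x)"
    and Q: "\<And>k x. run w (step (Neg k 1) x) = step (Neg k 1) (run w x)"
  shows "triv w"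
proof -
  define D where "D l x = step l x - x" for l :: "'a letter" and x
  define T where "T = run w"
  have DP: "T (D (Pos k 1) x) = D (Pos k 1) (T x)" for k x unfolding T_def D_def run_diff P ..
  have DN: "T (D (Neg k 1) x) = D (Neg k 1) (T x)" for k x unfolding T_def D_def run_diff Q ..
  define L where "L x = D (Neg A1 1) (D (Neg A2 1) (D (Neg A4 1) (D (Neg A3 1) (D (Neg A2 1) (D (Neg A1 1) x)))))" for x :: "'a vec"
  have L: "L (Vec a b c d e f g h) = - Vec 0 0 0 0 a 0 0 0" for a b c d e f g h :: 'a
    by (simp add: L_def D_def)
  have TL: "T (L x) = L (T x)" for x by (simp only: L_def DN)
  have um: "T (- x) = - T x" for x unfolding T_def by (rule run_uminus)
  let ?f1 = "Vec 0 0 0 0 1 0 0 0 :: 'a vec"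
  obtain s where f1: "T ?f1 = scale s ?f1"
  proof -
    obtain a b c d e f g h where x: "T (Vec 1 0 0 0 0 0 0 0) = Vec a b c d e f g h" by (cases "T (Vec 1 0 0 0 0 0 0 0)")
    have "- T ?f1 = - scale a ?f1"
      using TL[of "Vec 1 0 0 0 0 0 0 0"] unfolding x L um by simp
    then show ?thesis using that[of a] by (simp del: scale.simps)
  qed
  have DS: "D l (scale s x) = scale s (D l x)" for l x
    by (simp add: D_def step_scale scale_add diff_conv_add_uminus del: add_uminus_conv_diff)
  have up: "T (D (Pos k 1) x) = scale s (D (Pos k 1) x)" if "T x = scale s x" for k x
    unfolding DP that DS ..
  have mi: "T x = scale s x" if "T (- x) = scale s (- x)" for x using that by (simp add: um)
  have f2: "T (Vec 0 0 0 0 0 1 0 0) = scale s (Vec 0 0 0 0 0 1 0 0)"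
    by (rule mi) (use up[OF f1, of A1] in \<open>simp add: D_def\<close>)
  have f3: "T (Vec 0 0 0 0 0 0 1 0) = scale s (Vec 0 0 0 0 0 0 1 0)"
    by (rule mi) (use up[OF f2, of A2] in \<open>simp add: D_def\<close>)
  have f4: "T (Vec 0 0 0 0 0 0 0 1) = scale s (Vec 0 0 0 0 0 0 0 1)"
    by (rule mi) (use up[OF f3, of A3] in \<open>simp add: D_def\<close>)
  have e4: "T (Vec 0 0 0 1 0 0 0 0) = scale s (Vec 0 0 0 1 0 0 0 0)"
    by (rule mi) (use up[OF f3, of A4] in \<open>simp add: D_def\<close>)
  have e3: "T (Vec 0 0 1 0 0 0 0 0) = scale s (Vec 0 0 1 0 0 0 0 0)"
    using up[OF e4, of A3] by (simp add: D_def)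
  have e2: "T (Vec 0 1 0 0 0 0 0 0) = scale s (Vec 0 1 0 0 0 0 0 0)"
    using up[OF e3, of A2] by (simp add: D_def)
  have e1: "T (Vec 1 0 0 0 0 0 0 0) = scale s (Vec 1 0 0 0 0 0 0 0)"
    using up[OF e2, of A1] by (simp add: D_def)
  have T: "T x = scale s x" for x
  proof -
    obtain a b c d e f g h where x: "x = Vec a b c d e f g h" by (cases x)
    show ?thesis
      unfolding x vec_basis_expand[of a b c d e f g h]
      unfolding T_def run_add run_scale
      unfolding T_def[symmetric] f1 f2 f3 f4 e1 e2 e3 e4
      by (simp add: mult.commute)
  qed
  have "s \<noteq> 0" using T[of ?f1] run_eq_zero_iff[of w ?f1] by (auto simp: T_def)
  then have "s = 1 \<or> s = - 1" using small[of s] by blast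
  then show ?thesis unfolding triv_def using T by (auto simp: T_def)
qed

context prime_field
begin

lemma center_Omega8: "group_center (Omega8 p) = {mat w | w. triv w}"
proof (intro equalityI subsetI)
  fix z assume z: "z \<in> group_center (Omega8 p)"
  then obtain w where w: "z = mat w" by (auto simp: group_center_def Omega8_simps)
  have "run (w @ u) x = run (u @ w) x" for u x
  proof -
    have "mat w \<otimes>\<^bsub>Omega8 p\<^esub> mat u = mat u \<otimes>\<^bsub>Omega8 p\<^esub> mat w"
      using z unfolding w group_center_def Omega8_simps by blast
    then show ?thesis unfolding Omega8_simps mat_append[symmetric] mat_eq_iff by blast
  qed
  from this[of "[_]"] have "triv w" by (intro triv_if_commutes) simp_all
  then show "z \<in> {mat w | w. triv w}" using w by blast
next
  fix z assume "z \<in> {mat w | w. triv w}"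
  then obtain w where w: "z = mat w" "triv w" by blast
  have "run (w @ u) x = run (u @ w) x" for u x
    using w(2) by (auto simp: triv_def run_uminus)
  then have "mat w \<otimes>\<^bsub>Omega8 p\<^esub> mat u = mat u \<otimes>\<^bsub>Omega8 p\<^esub> mat w" for u
    unfolding Omega8_simps mat_append[symmetric] mat_eq_iff by blast
  then show "z \<in> group_center (Omega8 p)" unfolding w group_center_def Omega8_simps by blast
qed

lemma center_normal: "group_center (Omega8 p) \<lhd> Omega8 p"
proof -
  interpret G: group "Omega8 p" by (rule Omega8_group)
  show ?thesis unfolding G.normal_inv_iff
  proof (intro conjI ballI)
    show "subgroup (group_center (Omega8 p)) (Omega8 p)"
    proof (rule G.subgroupI)
      show "group_center (Omega8 p) \<subseteq> carrier (Omega8 p)" by (auto simp: group_center_def)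
      show "group_center (Omega8 p) \<noteq> {}" unfolding center_Omega8 using triv_Nil by blast
      fix a b assume "a \<in> group_center (Omega8 p)" "b \<in> group_center (Omega8 p)"
      then obtain u w where uw: "a = mat u" "b = mat w" "triv u" "triv w" unfolding center_Omega8 by blast
      have "run (winv u) x = run u x" for x
        using uw(3) run_winv[of u x] run_winv[of u "- x"] unfolding triv_def by (metis minus_minus)
      then have "triv (winv u)" using uw(3) unfolding triv_def by simp
      then show "inv\<^bsub>Omega8 p\<^esub> a \<in> group_center (Omega8 p)"
        unfolding center_Omega8 uw Omega8_inv by blast
      have "triv (u @ w)" using uw(3,4) by (auto simp: triv_def)
      then show "a \<otimes>\<^bsub>Omega8 p\<^esub> b \<in> group_center (Omega8 p)"
        unfolding center_Omega8 uw Omega8_simps mat_append[symmetric] by blast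
    qed
    fix x h assume x: "x \<in> carrier (Omega8 p)" and h: "h \<in> group_center (Omega8 p)"
    then have "x \<otimes>\<^bsub>Omega8 p\<^esub> h \<otimes>\<^bsub>Omega8 p\<^esub> inv\<^bsub>Omega8 p\<^esub> x = h \<otimes>\<^bsub>Omega8 p\<^esub> x \<otimes>\<^bsub>Omega8 p\<^esub> inv\<^bsub>Omega8 p\<^esub> x"
      by (simp add: group_center_def)
    also have "\<dots> = h"
    proof -
      have hc: "h \<in> carrier (Omega8 p)" using h by (simp add: group_center_def)
      show ?thesis unfolding G.m_assoc[OF hc x G.inv_closed[OF x]] by (simp add: x hc)
    qed
    finally show "x \<otimes>\<^bsub>Omega8 p\<^esub> h \<otimes>\<^bsub>Omega8 p\<^esub> inv\<^bsub>Omega8 p\<^esub> x \<in> group_center (Omega8 p)" using h by simp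
  qed
qed

definition cls :: "'f letter list \<Rightarrow> (nat \<Rightarrow> nat \<Rightarrow> int) set" where
  "cls w = group_center (Omega8 p) #>\<^bsub>Omega8 p\<^esub> mat w"

lemma carrier_POmega8: "carrier (POmega8 p) = range cls"
  by (auto simp: POmega8_def FactGroup_def RCOSETS_def Omega8_simps cls_def)

lemma POmega8_group: "group (POmega8 p)"
  unfolding POmega8_def by (rule normal.factorgroup_is_group[OF center_normal])

lemma cls_append: "cls (u @ w) = cls u \<otimes>\<^bsub>POmega8 p\<^esub> cls w"
  unfolding POmega8_def FactGroup_def cls_def monoid.simps
  using normal.rcos_sum[OF center_normal, of "mat u" "mat w"] by (simp add: Omega8_simps mat_append)

lemma cls_eq_iff: "cls u = cls w \<longleftrightarrow> triv (winv w @ u)"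
proof -
  have c: "cls w = {mat (v @ w) | v. triv v}" for w
    unfolding cls_def r_coset_def center_Omega8 Omega8_simps mat_append by blast
  have "cls u \<subseteq> cls w" if t: "triv (winv w @ u)" for u w
  proof
    fix z assume "z \<in> cls u"
    then obtain v where v: "z = mat (v @ u)" "triv v" unfolding c by blast
    have "(\<forall>x. run u x = run w x) \<or> (\<forall>x. run u x = - run w x)" using t unfolding triv_winv_append .
    then have "triv (v @ u @ winv w)" using v(2) unfolding triv_def by auto
    moreover have "mat (v @ u) = mat ((v @ u @ winv w) @ w)" unfolding mat_eq_iff by simp
    ultimately show "z \<in> cls w" unfolding c v by blast
  qed
  note sub = this
  have sym: "triv (winv u @ w) \<longleftrightarrow> triv (winv w @ u)"
  proof -
    have "(\<forall>x. run u x = - run w x) \<longleftrightarrow> (\<forall>x. run w x = - run u x)" using minus_minus by metis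
    then show ?thesis unfolding triv_winv_append by auto
  qed
  show ?thesis
  proof
    assume eq: "cls u = cls w"
    have "mat ([] @ u) \<in> cls u" unfolding c using triv_Nil by blast
    then obtain v where v: "mat u = mat (v @ w)" "triv v" unfolding eq unfolding c append_Nil by blast
    then have "\<forall>x. run u x = run v (run w x)" unfolding mat_eq_iff by simp
    then show "triv (winv w @ u)" unfolding triv_winv_append using v(2) unfolding triv_def by auto
  next
    assume "triv (winv w @ u)" then show "cls u = cls w" using sub[of w u] sub[of u w] sym by blast
  qed
qed

lemma cls_cong: "(\<And>x. run u x = run w x) \<Longrightarrow> cls u = cls w"
  unfolding cls_eq_iff triv_winv_append by blast

lemma cls_inv: "inv\<^bsub>POmega8 p\<^esub> (cls w) = cls (winv w)"
proof (rule group.inv_equality[OF POmega8_group])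
  have "cls [] \<otimes>\<^bsub>POmega8 p\<^esub> cls [] = cls []" using cls_append[of "[]" "[]"] by simp
  moreover have "cls w \<in> carrier (POmega8 p)" for w by (simp add: carrier_POmega8)
  ultimately have "cls [] = \<one>\<^bsub>POmega8 p\<^esub>"
    using group.l_cancel_one'[OF POmega8_group] group.r_cancel_one[OF POmega8_group] by metis
  moreover have "cls (winv w @ w) = cls []" by (rule cls_cong) simp
  ultimately show "cls (winv w) \<otimes>\<^bsub>POmega8 p\<^esub> cls w = \<one>\<^bsub>POmega8 p\<^esub>" unfolding cls_append by simp
qed (simp_all add: carrier_POmega8)

lemma finite_POmega8: "finite (carrier (POmega8 p))"
proof -
  let ?V = "\<lambda>(a, b, c, d, e, f, g, h). Vec a b c d e f g (h :: 'f)"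
  have "v \<in> range ?V" for v
  proof (cases v)
    case (Vec a b c d e f g h)
    then have "v = ?V (a, b, c, d, e, f, g, h)" by simp
    then show ?thesis by (rule range_eqI)
  qed
  then have "(UNIV :: 'f vec set) = range ?V" by blast
  then have fv: "finite (UNIV :: 'f vec set)" by (metis finite finite_imageI)
  let ?M = "\<lambda>vs i j. if i < 8 \<and> j < (8::nat) then val (coord i (vs ! j)) else 0"
  have "mat w = ?M (map (run w) basis)" for w
    by (intro ext) (auto simp: mat_def basis_def less_8_cases)
  then have "range mat \<subseteq> ?M ` {vs. set vs \<subseteq> UNIV \<and> length vs = 8}" by (auto simp: basis_def)
  then have "finite (range mat)" using finite_lists_length_eq[OF fv, of 8] by (meson finite_imageI finite_subset)
  moreover have "carrier (POmega8 p) \<subseteq> Pow (range mat)"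
    using group.rcosets_subset_PowG[OF Omega8_group normal_imp_subgroup[OF center_normal]]
    by (auto simp: POmega8_def FactGroup_def Omega8_simps)
  ultimately show ?thesis by (meson finite_Pow_iff finite_subset)
qed

lemma cls_root: "xbar p (Xlet l) (val (param l)) = cls [l]"
  by (simp add: xbar_def root_elt_letter cls_def)

end

section \<open>Automorphisms, and the triality action on the concrete group\<close>

lemma AutoGroup_simps:
  "carrier (AutoGroup G) = auto G" "\<one>\<^bsub>AutoGroup G\<^esub> = (\<lambda>x\<in>carrier G. x)"
  "\<lbrakk>f \<in> auto G; g \<in> auto G\<rbrakk> \<Longrightarrow> f \<otimes>\<^bsub>AutoGroup G\<^esub> g = compose (carrier G) f g"
  by (simp_all add: AutoGroup_def BijGroup_def auto_def)

lemma auto_ext: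
  assumes "f \<in> auto G" "g \<in> auto G" "\<And>x. x \<in> carrier G \<Longrightarrow> f x = g x" shows "f = g"
  using assms by (auto intro!: extensionalityI[of _ "carrier G"] simp: auto_def Bij_def)

lemma auto_closed: "f \<in> auto G \<Longrightarrow> x \<in> carrier G \<Longrightarrow> f x \<in> carrier G"
  by (auto simp: auto_def hom_def)

lemma auto_hom: "f \<in> auto G \<Longrightarrow> x \<in> carrier G \<Longrightarrow> y \<in> carrier G \<Longrightarrow> f (x \<otimes>\<^bsub>G\<^esub> y) = f x \<otimes>\<^bsub>G\<^esub> f y"
  by (auto simp: auto_def hom_def)

lemma auto_mult: "\<lbrakk>f \<in> auto G; g \<in> auto G; x \<in> carrier G\<rbrakk> \<Longrightarrow> (f \<otimes>\<^bsub>AutoGroup G\<^esub> g) x = f (g x)"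
  by (simp add: AutoGroup_simps compose_def)

context group
begin

lemma inv_cancel: "\<lbrakk>g \<in> carrier G; z \<in> carrier G\<rbrakk> \<Longrightarrow> inv g \<otimes> (g \<otimes> z) = z"
  "\<lbrakk>g \<in> carrier G; z \<in> carrier G\<rbrakk> \<Longrightarrow> g \<otimes> (inv g \<otimes> z) = z"
  by (simp_all flip: m_assoc)

lemma inn_auto: "g \<in> carrier G \<Longrightarrow> inn G g \<in> auto G"
proof -
  assume g: "g \<in> carrier G"
  have "inn G g \<in> hom G G"
    using g by (auto simp: hom_def inn_def m_assoc inv_cancel)
  moreover have "bij_betw (inn G g) (carrier G) (carrier G)"
    by (rule bij_betw_byWitness[of _ "inn G (inv g)"])
      (use g in \<open>auto simp: inn_def m_assoc inv_cancel\<close>)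
  ultimately show ?thesis by (simp add: auto_def Bij_def inn_def)
qed

lemma auto_inv: assumes "f \<in> auto G" "x \<in> carrier G" shows "f (inv x) = inv (f x)"
  using group_hom.hom_inv[of G G f x] assms by (simp add: group_hom_def group_hom_axioms_def auto_def)

lemma auto_inn:
  assumes f: "f \<in> auto G" and g: "g \<in> carrier G"
  shows "f \<otimes>\<^bsub>AutoGroup G\<^esub> inn G g = inn G (f g) \<otimes>\<^bsub>AutoGroup G\<^esub> f"
proof (rule auto_ext)
  have i: "inn G g \<in> auto G" "inn G (f g) \<in> auto G" using inn_auto g auto_closed[OF f g] by auto
  show "f \<otimes>\<^bsub>AutoGroup G\<^esub> inn G g \<in> auto G" "inn G (f g) \<otimes>\<^bsub>AutoGroup G\<^esub> f \<in> auto G"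
    using monoid.m_closed[OF group.is_monoid[OF AutoGroup]] f i unfolding AutoGroup_simps by auto
  fix x assume x: "x \<in> carrier G"
  have "f (g \<otimes> x \<otimes> inv g) = f g \<otimes> f x \<otimes> inv (f g)"
    using x g by (simp add: auto_hom[OF f] auto_inv[OF f])
  then show "(f \<otimes>\<^bsub>AutoGroup G\<^esub> inn G g) x = (inn G (f g) \<otimes>\<^bsub>AutoGroup G\<^esub> f) x"
    unfolding auto_mult[OF f i(1) x] auto_mult[OF i(2) f x] using x auto_closed[OF f x] by (simp add: inn_def)
qed

lemma finite_auto: "finite (carrier G) \<Longrightarrow> finite (auto G)"
proof (rule finite_subset)
  show "auto G \<subseteq> carrier G \<rightarrow>\<^sub>E carrier G" by (auto simp: auto_def hom_def Bij_def PiE_def)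
qed (rule finite_PiE)

end

text \<open>Conjugating \<open>\<pi>\<close> and r by the same automorphism preserves all the
  relations, and N is kept because it is invariant. This extends every result about the graph
  automorphism to its conjugates.\<close>

lemma (in triality_action) triality_action_conj:
  assumes a: "a \<in> carrier A" and n: "\<And>n. n \<in> N \<Longrightarrow> conjg A n a \<in> N" "\<And>n. n \<in> N \<Longrightarrow> a \<otimes> n \<otimes> inv a \<in> N"
  shows "triality_action A N (\<lambda>w. conjg A (\<pi> w) a) (conjg A r a)"
proof unfold_locales
  have mul: "conjg A x a \<otimes> conjg A y a = conjg A (x \<otimes> y) a" if "x \<in> carrier A" "y \<in> carrier A" for x y
    using that a by (simp add: conjg_def m_assoc inv_cancel)
  have cl: "conjg A x a \<in> carrier A" if "x \<in> carrier A" for x using that a by (simp add: conjg_def)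
  have one: "conjg A x a = \<one> \<longleftrightarrow> x = \<one>" if "x \<in> carrier A" for x
  proof
    assume "conjg A x a = \<one>"
    then have "a \<otimes> conjg A x a \<otimes> inv a = \<one>" using a by simp
    then show "x = \<one>" using a that by (simp add: conjg_def m_assoc inv_cancel)
  qed (use a in \<open>simp add: conjg_def\<close>)
  show "finite (carrier A)" by (rule fin)
  show "conjg A (\<pi> w) a \<in> carrier A" for w by (simp add: cl)
  show "conjg A (\<pi> (u @ w)) a = conjg A (\<pi> u) a \<otimes> conjg A (\<pi> w) a" for u w by (simp add: mul pi_append)
  show "conjg A r a \<in> carrier A" by (simp add: cl)
  show "conjg A r a \<otimes> conjg A (\<pi> w) a = conjg A (\<pi> (shift w)) a \<otimes> conjg A r a" for w by (simp add: mul r_pi)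
  show "conjg A r a \<otimes> conjg A r a \<otimes> conjg A r a = \<one>" by (simp add: mul r_cube one)
  show "conjg A (\<pi> w) a = \<one> \<longleftrightarrow> triv w" for w by (simp add: one pi_one_iff)
  show "range (\<lambda>w. conjg A (\<pi> w) a) = N"
  proof (intro equalityI subsetI)
    fix m assume "m \<in> N"
    then have "a \<otimes> m \<otimes> inv a \<in> N" and mc: "m \<in> carrier A" using n N_carrier by auto
    then obtain w where w: "a \<otimes> m \<otimes> inv a = \<pi> w" using pi_range by auto
    have "conjg A (\<pi> w) a = m" unfolding w[symmetric] conjg_def using a mc by (simp add: m_assoc inv_cancel)
    then show "m \<in> range (\<lambda>w. conjg A (\<pi> w) a)" by blast
  qed (use n in auto)
qed

context prime_field
begin

abbreviation "S \<equiv> POmega8 p"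

lemma cls_closed [simp]: "cls w \<in> carrier S" by (simp add: carrier_POmega8)

lemma inn_cls: "inn S (cls w) (cls u) = cls (w @ u @ winv w)"
  by (simp add: inn_def cls_inv cls_append group.is_monoid[OF POmega8_group] monoid.m_assoc)

lemma auto_eq_cls:
  "\<lbrakk>f \<in> auto S; g \<in> auto S; \<And>u. f (cls u) = g (cls u)\<rbrakk> \<Longrightarrow> f = g"
  by (rule auto_ext) (auto simp: carrier_POmega8)

lemma step_cube: "p = 3 \<Longrightarrow> run [Pos k (1::'f), Pos k 1, Pos k 1] x = x" "p = 3 \<Longrightarrow> run [Neg k (1::'f), Neg k 1, Neg k 1] x = x"
proof -
  assume "p = 3"
  then have "val (of_int 3) = val (of_int 0)" unfolding val_of_int by simp
  then have "(3::'f) = 0" unfolding val_eq_iff by simp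
  then have t: "y + (y + y) = 0" for y :: 'f using mult_2[of y] distrib_right[of 1 2 y] by simp
  have t': "z + (y + (y + y)) = z" "z - y - y - y = z" for y z :: 'f
    using t[of y] by (simp_all add: algebra_simps)
  show "run [Pos k (1::'f), Pos k 1, Pos k 1] x = x" "run [Neg k (1::'f), Neg k 1, Neg k 1] x = x"
    by (cases k; cases x; simp only: run.simps step.simps mult_1 add.assoc t')+
qed

text \<open>The projective group has trivial centre. An inner automorphism that is trivial means
  commuting with each root element up to sign; once the sign is excluded,
  \<open>triv_if_commutes\<close> applies.\<close>

lemma inn_cls_one_iff: "inn S (cls w) = \<one>\<^bsub>AutoGroup S\<^esub> \<longleftrightarrow> triv w"
proof
  assume i: "inn S (cls w) = \<one>\<^bsub>AutoGroup S\<^esub>"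
  have c: "run w (step l x) = step l (run w x)" if cube: "p = 3 \<Longrightarrow> \<forall>x. run [l, l, l] x = x" for l x
  proof -
    have "cls (w @ [l] @ winv w) = cls [l]"
      using fun_cong[OF i, of "cls [l]"] by (simp only: inn_cls AutoGroup_simps restrict_apply cls_closed if_True)
    then have "(\<forall>y. run (w @ [l] @ winv w) y = run [l] y) \<or> (\<forall>y. run (w @ [l] @ winv w) y = - run [l] y)"
      unfolding cls_eq_iff triv_winv_append .
    then show ?thesis
    proof
      assume "\<forall>y. run (w @ [l] @ winv w) y = run [l] y"
      from spec[OF this, of "run w x"] show ?thesis by simp
    next
      assume m: "\<forall>y. run (w @ [l] @ winv w) y = - run [l] y"
      then have m': "run w (step l x) = - step l (run w x)" for x using spec[OF m, of "run w x"] by simp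
      show ?thesis
      proof (cases "p = 2")
        case True
        then have "val (of_int (- 1)) = val (of_int 1)" unfolding val_of_int by simp
        then have one: "(- 1 :: 'f) = 1" unfolding val_eq_iff by simp
        have "- z = z" for z :: "'f vec"
          using scale_simps(2)[of z] unfolding one scale_simps(1) by (rule sym)
        then show ?thesis unfolding m' .
      next
        case False
        then have p3: "p = 3" using p by simp
        define y where "y = run w (Vec 1 0 0 0 0 0 0 0)"
        have sm: "step l (- z) = - step l z" for z using run_uminus[of "[l]" z] by simp
        \<comment> \<open>In characteristic 3 a root element has cube 1, so a sign acquired by
          conjugation would survive cubing and give 1 = -1.\<close>
        have "y = run w (step l (step l (step l (Vec 1 0 0 0 0 0 0 0))))" using cube[OF p3] by (simp add: y_def)
        also have "\<dots> = - step l (step l (step l y))" unfolding m' sm by (simp add: y_def)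
        also have "\<dots> = - y" using cube[OF p3] by simp
        finally have "y = - y" .
        moreover have "- y = run w (- Vec 1 0 0 0 0 0 0 0)" unfolding y_def run_uminus ..
        ultimately have "y = run w (- Vec 1 0 0 0 0 0 0 0)" by (rule trans)
        then have "Vec 1 0 0 0 0 0 0 0 = - Vec (1::'f) 0 0 0 0 0 0 0" unfolding y_def run_inj .
        then have "(1::'f) = - 1" by (simp only: uminus_vec.simps vec.inject)
        then have "val (of_int 1) = val (of_int (- 1))" by (simp only: of_int_1 of_int_minus)
        then show ?thesis unfolding val_of_int p3 by simp
      qed
    qed
  qed
  show "triv w"
  proof (rule triv_if_commutes)
    fix k x
    show "run w (step (Pos k 1) x) = step (Pos k 1) (run w x)"
      by (rule c) (simp only: step_cube(1), simp)
    show "run w (step (Neg k 1) x) = step (Neg k 1) (run w x)"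
      by (rule c) (simp only: step_cube(2), simp)
  qed
next
  assume t: "triv w"
  have "cls (w @ u @ winv w) = cls u" for u
  proof (rule cls_cong)
    fix x
    define z where "z = run (winv w) x"
    have x: "x = run w z" by (simp add: z_def)
    show "run (w @ u @ winv w) x = run u x" unfolding x using t unfolding triv_def by (auto simp: run_uminus)
  qed
  then have c: "inn S (cls w) (cls u) = \<one>\<^bsub>AutoGroup S\<^esub> (cls u)" for u
    unfolding inn_cls AutoGroup_simps(2) by simp
  show "inn S (cls w) = \<one>\<^bsub>AutoGroup S\<^esub>"
  proof (rule auto_eq_cls)
    show "inn S (cls w) \<in> auto S" by (rule group.inn_auto[OF POmega8_group cls_closed])
    show "\<one>\<^bsub>AutoGroup S\<^esub> \<in> auto S" unfolding AutoGroup_simps(2) by (rule group.id_in_auto[OF POmega8_group])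
  qed (rule c)
qed

lemma num_tri: "num (tri k) = tri_perm (num k)" by (cases k) (simp_all add: tri_perm_def)

lemma graph_triality_cls:
  assumes "is_graph_triality p f" shows "f (cls w) = cls (shift w)"
proof -
  have f: "f \<in> auto S" using assms by (simp add: is_graph_triality_def)
  have nr: "num k \<in> {1..4}" for k by (cases k) auto
  have "f (xbar p (Xlet l) (val (param l))) = xbar p (Xlet (shl l)) (val (param (shl l)))" for l
    using assms nr by (cases l) (simp_all add: is_graph_triality_def num_tri)
  then have l: "f (cls [l]) = cls [shl l]" for l unfolding cls_root .
  show ?thesis
  proof (induction w)
    case Nil
    have "cls [] \<otimes>\<^bsub>S\<^esub> cls [] = cls []" using cls_append[of "[]" "[]"] by simp
    then have "cls [] = \<one>\<^bsub>S\<^esub>" using group.l_cancel_one[OF POmega8_group] by simp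
    moreover have "f \<one>\<^bsub>S\<^esub> = \<one>\<^bsub>S\<^esub>"
      using f POmega8_group by (intro hom_one) (simp_all add: auto_def)
    ultimately show ?case by simp
  next
    case (Cons a w)
    have "f (cls (a # w)) = f (cls [a]) \<otimes>\<^bsub>S\<^esub> f (cls w)"
      using cls_append[of "[a]" w] auto_hom[OF f, of "cls [a]" "cls w"] by simp
    also have "\<dots> = cls (shift (a # w))" using cls_append[of "[shl a]" "shift w"] by (simp add: l Cons)
    finally show ?case .
  qed
qed

lemma graph_triality_action:
  assumes f: "is_graph_triality p f"
  shows "triality_action (AutoGroup S) (Inn S) (\<lambda>w. inn S (cls w)) f"
proof -
  interpret G: group S by (rule POmega8_group)
  interpret A: group "AutoGroup S" by (rule G.AutoGroup)
  have fa: "f \<in> auto S" using f by (simp add: is_graph_triality_def)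
  have mc: "x \<otimes>\<^bsub>AutoGroup S\<^esub> y \<in> auto S" if "x \<in> auto S" "y \<in> auto S" for x y
    using A.m_closed that unfolding AutoGroup_simps by auto
  have oc: "\<one>\<^bsub>AutoGroup S\<^esub> \<in> auto S" using A.one_closed unfolding AutoGroup_simps(1) .
  show ?thesis
  proof unfold_locales
    show "finite (carrier (AutoGroup S))" by (simp add: AutoGroup_simps G.finite_auto finite_POmega8)
    show "inn S (cls w) \<in> carrier (AutoGroup S)" for w by (simp add: AutoGroup_simps G.inn_auto)
    show "inn S (cls (u @ w)) = inn S (cls u) \<otimes>\<^bsub>AutoGroup S\<^esub> inn S (cls w)" for u w
      by (rule auto_eq_cls) (simp_all add: mc G.inn_auto auto_mult inn_cls)
    show "range (\<lambda>w. inn S (cls w)) = Inn S" by (auto simp: Inn_def carrier_POmega8)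
    show "f \<in> carrier (AutoGroup S)" by (simp add: AutoGroup_simps fa)
    show "f \<otimes>\<^bsub>AutoGroup S\<^esub> inn S (cls w) = inn S (cls (shift w)) \<otimes>\<^bsub>AutoGroup S\<^esub> f" for w
      using G.auto_inn[OF fa, of "cls w"] by (simp add: graph_triality_cls[OF f])
    show "f \<otimes>\<^bsub>AutoGroup S\<^esub> f \<otimes>\<^bsub>AutoGroup S\<^esub> f = \<one>\<^bsub>AutoGroup S\<^esub>"
      by (rule auto_eq_cls) (simp_all add: mc fa oc auto_mult graph_triality_cls[OF f], simp add: AutoGroup_simps)
    show "inn S (cls w) = \<one>\<^bsub>AutoGroup S\<^esub> \<longleftrightarrow> triv w" for w by (rule inn_cls_one_iff)
  qed
qed

lemma triality_action_exists:
  assumes f: "is_graph_triality p f" and a: "a \<in> carrier (AutoGroup S)"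
  shows "\<exists>\<pi> :: 'f letter list \<Rightarrow> _. triality_action (AutoGroup S) (Inn S) \<pi> (conjg (AutoGroup S) f a)"
proof -
  interpret G: group S by (rule POmega8_group)
  interpret T: triality_action "AutoGroup S" "Inn S" "\<lambda>w. inn S (cls w)" f by (rule graph_triality_action[OF f])
  have nn: "b \<otimes>\<^bsub>AutoGroup S\<^esub> n \<otimes>\<^bsub>AutoGroup S\<^esub> inv\<^bsub>AutoGroup S\<^esub> b \<in> Inn S"
    if b: "b \<in> carrier (AutoGroup S)" and n: "n \<in> Inn S" for b n
  proof -
    have ba: "b \<in> auto S" using b by (simp add: AutoGroup_simps)
    obtain g where g: "g \<in> carrier S" "n = inn S g" using n by (auto simp: Inn_def)
    have bg: "b g \<in> carrier S" by (rule auto_closed[OF ba g(1)])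
    have ic: "inn S (b g) \<in> carrier (AutoGroup S)" using G.inn_auto[OF bg] by (simp add: AutoGroup_simps)
    have "b \<otimes>\<^bsub>AutoGroup S\<^esub> n \<otimes>\<^bsub>AutoGroup S\<^esub> inv\<^bsub>AutoGroup S\<^esub> b = inn S (b g)"
      unfolding g(2) G.auto_inn[OF ba g(1)] T.m_assoc[OF ic b T.inv_closed[OF b]] by (simp add: b ic)
    then show ?thesis using bg by (simp add: Inn_def)
  qed
  have "triality_action (AutoGroup S) (Inn S) (\<lambda>w. conjg (AutoGroup S) (inn S (cls w)) a) (conjg (AutoGroup S) f a)"
  proof (rule T.triality_action_conj[OF a])
    fix n assume n: "n \<in> Inn S"
    show "conjg (AutoGroup S) n a \<in> Inn S"
      using nn[OF T.inv_closed[OF a] n] unfolding conjg_def T.inv_inv[OF a] .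
    show "a \<otimes>\<^bsub>AutoGroup S\<^esub> n \<otimes>\<^bsub>AutoGroup S\<^esub> inv\<^bsub>AutoGroup S\<^esub> a \<in> Inn S" by (rule nn[OF a n])
  qed
  then show ?thesis by blast
qed

end

section \<open>The two prime fields and the conclusion\<close>

definition val2 :: "f2 \<Rightarrow> int" where "val2 t = (case t of Z2 \<Rightarrow> 0 | I2 \<Rightarrow> 1)"
definition val3 :: "f3 \<Rightarrow> int" where "val3 t = (case t of Z3 \<Rightarrow> 0 | I3 \<Rightarrow> 1 | J3 \<Rightarrow> 2)"

lemma prime_field_f2: "prime_field 2 val2"
proof
  have "(of_int (1 + 1) :: f2) = 0"
    unfolding of_int_add of_int_1 by (simp only: one_f2_def zero_f2_def plus_f2.simps)
  then have two: "(of_int 2 :: f2) = 0" by simp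
  show "of_int (val2 t) = t" for t by (cases t) (simp_all add: val2_def zero_f2_def one_f2_def)
  show "val2 (of_int n) = n mod int 2" for n
  proof -
    have "(of_int n :: f2) = of_int (2 * (n div 2) + n mod 2)" by simp
    also have "\<dots> = of_int (n mod 2)" unfolding of_int_add of_int_mult two by simp
    finally have e: "(of_int n :: f2) = of_int (n mod 2)" .
    have "n mod 2 = 0 \<or> n mod 2 = 1" by presburger
    then show ?thesis unfolding e by (auto simp: val2_def zero_f2_def one_f2_def)
  qed
qed simp

lemma prime_field_f3: "prime_field 3 val3"
proof
  have "(of_int (1 + 1) :: f3) = J3"
    unfolding of_int_add of_int_1 by (simp only: one_f3_def plus_f3.simps)
  then have two: "(of_int 2 :: f3) = J3" by simp
  have "(of_int (2 + 1) :: f3) = 0"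
    unfolding of_int_add two of_int_1 by (simp only: one_f3_def zero_f3_def plus_f3.simps)
  then have three: "(of_int 3 :: f3) = 0" by simp
  show "of_int (val3 t) = t" for t
    using two by (cases t) (simp_all add: val3_def zero_f3_def one_f3_def)
  show "val3 (of_int n) = n mod int 3" for n
  proof -
    have "(of_int n :: f3) = of_int (3 * (n div 3) + n mod 3)" by simp
    also have "\<dots> = of_int (n mod 3)" unfolding of_int_add of_int_mult three by simp
    finally have e: "(of_int n :: f3) = of_int (n mod 3)" .
    have "n mod 3 = 0 \<or> n mod 3 = 1 \<or> n mod 3 = 2" by presburger
    then show ?thesis unfolding e using two by (auto simp: val3_def zero_f3_def one_f3_def)
  qed
qed simp

text \<open>Shared by both fields: the facts obtained by evaluation over a particular field enter as
  hypotheses, and conjugation by words is translated into conjugation by elements of S.\<close>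

lemma triality_conclusion:
  fixes S :: "('a, 'b) monoid_scheme" and \<pi> :: "'f::small_field letter list \<Rightarrow> 'a \<Rightarrow> 'a"
  assumes T: "triality_action (AutoGroup S) (Inn S) \<pi> \<rho>"
    and pair: "\<And>u v :: 'f vec. nrm u = - 1 \<Longrightarrow> nrm v = - 1 \<Longrightarrow> pair_reducible u v"
    and five: "triv (wpow (w5 :: 'f letter list) 5)" "\<not> triv w5"
    and three: "Inn S \<subseteq> generate (AutoGroup S) {\<rho>, conjg (AutoGroup S) \<rho> (\<pi> g), conjg (AutoGroup S) \<rho> (\<pi> h)}"
    and other: "\<And>s. \<lbrakk>(\<pi> s \<otimes>\<^bsub>AutoGroup S\<^esub> \<rho>) \<otimes>\<^bsub>AutoGroup S\<^esub> (\<pi> s \<otimes>\<^bsub>AutoGroup S\<^esub> \<rho>) \<otimes>\<^bsub>AutoGroup S\<^esub> (\<pi> s \<otimes>\<^bsub>AutoGroup S\<^esub> \<rho>) = \<one>\<^bsub>AutoGroup S\<^esub>;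
        \<nexists>g. \<pi> s \<otimes>\<^bsub>AutoGroup S\<^esub> \<rho> = conjg (AutoGroup S) \<rho> (\<pi> g)\<rbrakk>
        \<Longrightarrow> triality_action.alphaN (AutoGroup S) (Inn S) (\<pi> s \<otimes>\<^bsub>AutoGroup S\<^esub> \<rho>) = 2"
  shows "(\<forall>g \<in> carrier S. is_pi_group_set {2, 3} (generate (AutoGroup S) {\<rho>, conjg (AutoGroup S) \<rho> (inn S g)}))
    \<and> alpha_inv S \<rho> = 3
    \<and> (\<forall>\<sigma> \<in> Inn S #>\<^bsub>AutoGroup S\<^esub> \<rho>. group.ord (AutoGroup S) \<sigma> = 3
        \<and> \<not> (\<exists>g \<in> carrier S. \<sigma> = conjg (AutoGroup S) \<rho> (inn S g)) \<longrightarrow> alpha_inv S \<sigma> = 2)"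
proof -
  interpret triality_action "AutoGroup S" "Inn S" \<pi> \<rho> by (rule T)
  have al: "alpha_inv S x = alphaN x" for x by (simp add: alpha_inv_def alphaN_def Let_def)
  have iii: "alpha_inv S \<sigma> = 2"
    if \<sigma>: "\<sigma> \<in> Inn S #>\<^bsub>AutoGroup S\<^esub> \<rho>" "ord \<sigma> = 3"
      and nc: "\<not> (\<exists>g \<in> carrier S. \<sigma> = conjg (AutoGroup S) \<rho> (inn S g))" for \<sigma>
  proof -
    obtain n where n: "n \<in> Inn S" "\<sigma> = n \<otimes>\<^bsub>AutoGroup S\<^esub> \<rho>" using \<sigma>(1) by (auto simp: r_coset_def)
    obtain s where s: "n = \<pi> s" using n(1) pi_range by auto
    have c: "\<sigma> \<in> carrier (AutoGroup S)" using n(2) s by simp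
    have "\<sigma> [^]\<^bsub>AutoGroup S\<^esub> (3::nat) = \<one>\<^bsub>AutoGroup S\<^esub>" using pow_ord_eq_1[OF c] \<sigma>(2) by simp
    then have "\<sigma> \<otimes>\<^bsub>AutoGroup S\<^esub> \<sigma> \<otimes>\<^bsub>AutoGroup S\<^esub> \<sigma> = \<one>\<^bsub>AutoGroup S\<^esub>" using c by (simp add: numeral_eq_Suc)
    moreover have "\<nexists>g. \<sigma> = conjg (AutoGroup S) \<rho> (\<pi> g)"
    proof
      assume "\<exists>g. \<sigma> = conjg (AutoGroup S) \<rho> (\<pi> g)"
      then obtain g where g: "\<sigma> = conjg (AutoGroup S) \<rho> (\<pi> g)" by blast
      have "\<pi> g \<in> Inn S" by simp
      then obtain x where "x \<in> carrier S" "\<pi> g = inn S x" unfolding Inn_def by blast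
      then show False using nc g by auto
    qed
    ultimately show ?thesis using other[of s] unfolding al n(2) s by simp
  qed
  have i: "is_pi_group_set {2, 3} (generate (AutoGroup S) {\<rho>, conjg (AutoGroup S) \<rho> (inn S g)})"
    if g: "g \<in> carrier S" for g
  proof (rule pair_pi_group)
    show "inn S g \<in> Inn S" using g by (simp add: Inn_def)
    fix u v :: "'f vec" assume "nrm u = - 1" "nrm v = - 1"
    then show "pair_reducible u v" by (rule pair)
  qed
  have ii: "alphaN \<rho> = 3"
  proof (rule alpha_r[OF _ five three])
    fix u v :: "'f vec" assume "nrm u = - 1" "nrm v = - 1"
    then show "pair_reducible u v" by (rule pair)
  qed
  show ?thesis
  proof (intro conjI ballI impI)
    show "alpha_inv S \<rho> = 3" unfolding al by (rule ii)
  next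
    fix \<sigma> assume \<sigma>: "\<sigma> \<in> Inn S #>\<^bsub>AutoGroup S\<^esub> \<rho>"
      and c: "ord \<sigma> = 3 \<and> \<not> (\<exists>g \<in> carrier S. \<sigma> = conjg (AutoGroup S) \<rho> (inn S g))"
    show "alpha_inv S \<sigma> = 2" by (rule iii[OF \<sigma> conjunct1[OF c] conjunct2[OF c]])
  next
    fix g assume "g \<in> carrier S"
    then show "is_pi_group_set {2, 3} (generate (AutoGroup S) {\<rho>, conjg (AutoGroup S) \<rho> (inn S g)})" by (rule i)
  qed
qed

lemma (in triality_f2) generate_three_f2:
  "N \<subseteq> generate A {r, conjg A r (\<pi> [Neg A1 1, Pos A2 1, Pos A3 1]),
     conjg A r (\<pi> [Pos A4 1, Pos A2 1, Pos A1 1, Neg A3 1, Neg A2 1])}"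
proof (rule generate_three)
  fix k assume k: "k = A1 \<or> k = A2"
  show "reaches {[], winv [Neg A1 1, Pos A2 1, Pos A3 1] @ shift [Neg A1 1, Pos A2 1, Pos A3 1],
      winv [Pos A4 1, Pos A2 1, Pos A1 1, Neg A3 1, Neg A2 1] @ shift [Pos A4 1, Pos A2 1, Pos A1 1, Neg A3 1, Neg A2 1]} [Pos k (1 :: f2)]"
    using k three2_P1 three2_P2 unfolding three2a_def three2b_conj three2c_conj
    by (elim disjE) (simp_all only:)
  show "reaches {[], winv [Neg A1 1, Pos A2 1, Pos A3 1] @ shift [Neg A1 1, Pos A2 1, Pos A3 1],
      winv [Pos A4 1, Pos A2 1, Pos A1 1, Neg A3 1, Neg A2 1] @ shift [Pos A4 1, Pos A2 1, Pos A1 1, Neg A3 1, Neg A2 1]} [Neg k (1 :: f2)]"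
    using k three2_M1 three2_M2 unfolding three2a_def three2b_conj three2c_conj
    by (elim disjE) (simp_all only:)
qed

lemma (in triality_f3) generate_three_f3:
  "N \<subseteq> generate A {r, conjg A r (\<pi> [Neg A3 (- 1), Neg A2 1, Pos A3 1, Neg A1 1]),
     conjg A r (\<pi> [Pos A3 (- 1), Neg A2 (- 1), Pos A2 1, Pos A1 (- 1)])}"
proof (rule generate_three)
  fix k assume k: "k = A1 \<or> k = A2"
  show "reaches {[], winv [Neg A3 (- 1), Neg A2 1, Pos A3 1, Neg A1 1] @ shift [Neg A3 (- 1), Neg A2 1, Pos A3 1, Neg A1 1],
      winv [Pos A3 (- 1), Neg A2 (- 1), Pos A2 1, Pos A1 (- 1)] @ shift [Pos A3 (- 1), Neg A2 (- 1), Pos A2 1, Pos A1 (- 1)]} [Pos k (1 :: f3)]"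
    using k three3_P1 three3_P2 unfolding three3a_def three3b_conj three3c_conj
    by (elim disjE) (simp_all only:)
  show "reaches {[], winv [Neg A3 (- 1), Neg A2 1, Pos A3 1, Neg A1 1] @ shift [Neg A3 (- 1), Neg A2 1, Pos A3 1, Neg A1 1],
      winv [Pos A3 (- 1), Neg A2 (- 1), Pos A2 1, Pos A1 (- 1)] @ shift [Pos A3 (- 1), Neg A2 (- 1), Pos A2 1, Pos A1 (- 1)]} [Neg k (1 :: f3)]"
    using k three3_M1 three3_M2 unfolding three3a_def three3b_conj three3c_conj
    by (elim disjE) (simp_all only:)
qed

theorem theorem2:
  fixes p :: nat
    and \<rho>0 \<rho> :: "(nat \<Rightarrow> nat \<Rightarrow> int) set \<Rightarrow> (nat \<Rightarrow> nat \<Rightarrow> int) set"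
  assumes "p = 2 \<or> p = 3"
    and "is_graph_triality p \<rho>0"
    and "\<exists>a \<in> carrier (AutoGroup (POmega8 p)). \<rho> = conjg (AutoGroup (POmega8 p)) \<rho>0 a"
  shows "(\<forall>g \<in> carrier (POmega8 p).
            is_pi_group_set {2, 3}
              (generate (AutoGroup (POmega8 p))
                 {\<rho>, conjg (AutoGroup (POmega8 p)) \<rho> (inn (POmega8 p) g)}))
         \<and> alpha_inv (POmega8 p) \<rho> = 3
         \<and> (\<forall>\<sigma> \<in> Inn (POmega8 p) #>\<^bsub>AutoGroup (POmega8 p)\<^esub> \<rho>.
              group.ord (AutoGroup (POmega8 p)) \<sigma> = 3
              \<and> \<not> (\<exists>g \<in> carrier (POmega8 p). \<sigma> = conjg (AutoGroup (POmega8 p)) \<rho> (inn (POmega8 p) g))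
              \<longrightarrow> alpha_inv (POmega8 p) \<sigma> = 2)"
proof -
  obtain a where a: "a \<in> carrier (AutoGroup (POmega8 p))" "\<rho> = conjg (AutoGroup (POmega8 p)) \<rho>0 a"
    using assms(3) by blast
  show ?thesis
    using assms(1)
  proof
    assume p: "p = 2"
    obtain \<pi> :: "f2 letter list \<Rightarrow> _" where T: "triality_action (AutoGroup (POmega8 p)) (Inn (POmega8 p)) \<pi> \<rho>"
      using prime_field.triality_action_exists[OF prime_field_f2] assms(2) a unfolding p by blast
    interpret triality_f2 "AutoGroup (POmega8 p)" "Inn (POmega8 p)" \<pi> \<rho> by (rule triality_f2.intro[OF T])
    show ?thesis
    proof (rule triality_conclusion[OF T _ order_5_f2 generate_three_f2])
      fix u v :: "f2 vec" assume "nrm u = - 1" "nrm v = - 1"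
      then show "pair_reducible u v" by (rule pair_reducible_f2)
    next
      fix s
      assume s: "(\<pi> s \<otimes>\<^bsub>AutoGroup (POmega8 p)\<^esub> \<rho>) \<otimes>\<^bsub>AutoGroup (POmega8 p)\<^esub> (\<pi> s \<otimes>\<^bsub>AutoGroup (POmega8 p)\<^esub> \<rho>)
          \<otimes>\<^bsub>AutoGroup (POmega8 p)\<^esub> (\<pi> s \<otimes>\<^bsub>AutoGroup (POmega8 p)\<^esub> \<rho>) = \<one>\<^bsub>AutoGroup (POmega8 p)\<^esub>"
        and n: "\<nexists>g. \<pi> s \<otimes>\<^bsub>AutoGroup (POmega8 p)\<^esub> \<rho> = conjg (AutoGroup (POmega8 p)) \<rho> (\<pi> g)"
      show "alphaN (\<pi> s \<otimes>\<^bsub>AutoGroup (POmega8 p)\<^esub> \<rho>) = 2"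
        by (rule alpha_other[OF s]) (unfold conjN_def, rule n)
    qed
  next
    assume p: "p = 3"
    obtain \<pi> :: "f3 letter list \<Rightarrow> _" where T: "triality_action (AutoGroup (POmega8 p)) (Inn (POmega8 p)) \<pi> \<rho>"
      using prime_field.triality_action_exists[OF prime_field_f3] assms(2) a unfolding p by blast
    interpret triality_f3 "AutoGroup (POmega8 p)" "Inn (POmega8 p)" \<pi> \<rho> by (rule triality_f3.intro[OF T])
    show ?thesis
    proof (rule triality_conclusion[OF T _ order_5_f3 generate_three_f3])
      fix u v :: "f3 vec" assume "nrm u = - 1" "nrm v = - 1"
      then show "pair_reducible u v" by (rule pair_reducible_f3)
    next
      fix s
      assume s: "(\<pi> s \<otimes>\<^bsub>AutoGroup (POmega8 p)\<^esub> \<rho>) \<otimes>\<^bsub>AutoGroup (POmega8 p)\<^esub> (\<pi> s \<otimes>\<^bsub>AutoGroup (POmega8 p)\<^esub> \<rho>)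
          \<otimes>\<^bsub>AutoGroup (POmega8 p)\<^esub> (\<pi> s \<otimes>\<^bsub>AutoGroup (POmega8 p)\<^esub> \<rho>) = \<one>\<^bsub>AutoGroup (POmega8 p)\<^esub>"
        and n: "\<nexists>g. \<pi> s \<otimes>\<^bsub>AutoGroup (POmega8 p)\<^esub> \<rho> = conjg (AutoGroup (POmega8 p)) \<rho> (\<pi> g)"
      show "alphaN (\<pi> s \<otimes>\<^bsub>AutoGroup (POmega8 p)\<^esub> \<rho>) = 2"
        by (rule alpha_other[OF s]) (unfold conjN_def, rule n)
    qed
  qed
qed

end
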